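(* Let $\gamma>1$ and $C>0$, and let $a'\in(0,\infty)$ be a constant for which there exists $c'\in(0,\infty)$ such that for all integers $k\ge1$ and all distinct dynamical times $\tau,\tau'$, $$\mathbb{P}(\hat A_k^{\tau}\cap\hat A_k^{\tau'})\le\mathbb{P}(\hat A_k^{0})^2+c'\left(\frac{1}{\hat d_k|\tau-\tau'|}\right)^{a'} .$$ If $a'(1-\gamma^{-3/2})-2C^2>0$, then, almost surely, $$\dim_H\left(\left\{\tau\in[0,\infty):\limsup_{t\to\infty}\frac{S_0^\tau(t)}{\sqrt{t\log(t)}}\ge C\right\}\right)\ \ge\ 1-\frac{2\gamma^2C^2}{\gamma-1}.$$
   Context: $\dim_H$ is Hausdorff dimension; by ergodicity of the DyDW in $\tau$ the dimension of the random set considered is almost surely constant. Dynamical discrete web (DyDW): let $\mathbb{Z}^2_{\mathrm{even}}=\{(x,t)\in\mathbb{Z}^2: x+t \text{ even}\}$, where $x$ is space and $t$ is (random walk) time. To each $z\in\mathbb{Z}^2_{\mathrm{even}}$ assign, independently over $z$, a right-continuous process $(\xi_z^\tau)_{\tau\ge 0}$ with values in $\{-1,+1\}$: $\xi_z^0$ is uniform on $\{\pm1\}$, and at each ring of a rate one Poisson clock attached to $z$ the value is replaced by a fresh independent uniform $\pm1$ variable (which may agree with the old value). All clocks, initial values and resampled values are independent. The parameter $\tau$ is called dynamical time. For fixed $\tau$, draw an arrow from each $(x,t)\in\mathbb{Z}^2_{\mathrm{even}}$ to $(x+\xi_{(x,t)}^\tau,t+1)$; $S_{z}^{\tau}(\cdot)$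 denotes the path that starts at $z$ and follows the arrows at dynamical time $\tau$ (linearly interpolated between integer times). $S_0^\tau:=S_{(0,0)}^\tau$ is the path from the origin. Rectangle events: given $\gamma>1$ and $C>0$, for integers $k\ge0$ put $\hat d_k=2\left(\lfloor \gamma^{\gamma^k}/2\rfloor+1\right)$, $\hat w_k=2\left(\lfloor C\sqrt{\hat d_k^2\log(\hat d_k^2)}/2\rfloor+1\right)$ and $\hat t_k=\hat d_0^2+\dots+\hat d_{k-1}^2$ (so $\hat t_0=0$). For $k\ge1$ let $\hat l_k=(-\hat w_{k-1},\hat t_k)$ and $$\hat A_k^\tau:=\{S_{\hat l_k}^\tau(\hat t_{k+1})>\hat w_k\}.$$ *)

theory Defs
  imports "HOL-Probability.Probability"
begin

subsection \<open>Hausdorff dimension\<close>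

text \<open>The weight is \<open>diam(U)\<^sup>s\<close> with the conventions \<open>diam({})\<^sup>s = 0\<close> and
  \<open>diam(U)\<^sup>0 = 1\<close> for nonempty \<open>U\<close>; the case distinction is needed because
  \<open>0 powr 0 = 0\<close>. Boundedness is required of covering sets because \<open>diameter\<close> is
  meaningless for unbounded sets.\<close>

definition hausdorff_weight :: "real \<Rightarrow> 'a::metric_space set \<Rightarrow> ennreal" where
  "hausdorff_weight s U =
     (if U = {} then 0 else if s = 0 then 1 else ennreal (diameter U powr s))"

definition hausdorff_pre_measure :: "real \<Rightarrow> real \<Rightarrow> 'a::metric_space set \<Rightarrow> ennreal" where
  "hausdorff_pre_measure s \<delta> A =
     (INF U \<in> {U :: nat \<Rightarrow> 'a set. A \<subseteq> (\<Union>i. U i) \<and> (\<forall>i. bounded (U i) \<and> diameter (U i) \<le> \<delta>)}.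
        (\<Sum>i. hausdorff_weight s (U i)))"

definition hausdorff_measure :: "real \<Rightarrow> 'a::metric_space set \<Rightarrow> ennreal" where
  "hausdorff_measure s A = (SUP \<delta> \<in> {0<..}. hausdorff_pre_measure s \<delta> A)"

definition hausdorff_dim :: "'a::metric_space set \<Rightarrow> ereal" where
  "hausdorff_dim A = Inf (ereal ` {s. 0 \<le> s \<and> hausdorff_measure s A = 0})"


subsection \<open>The dynamical discrete web\<close>

text \<open>A site is a pair (space, random walk time).\<close>

type_synonym site = "int \<times> int"

definition even_sites :: "site set" where
  "even_sites = {(x, t). even (x + t)}"

text \<open>The clock at \<open>z\<close> rings at the times \<open>gap z 0 + \<dots> + gap z n\<close> for \<open>n \<ge> 0\<close>; the gaps are
  i.i.d. exponential with parameter 1, so the clock is a rate one Poisson process.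
  \<open>mark z 0\<close> is the initial value at \<open>z\<close>, and \<open>mark z (n + 1)\<close> is the fresh value drawn at the
  ring with index \<open>n\<close>. The two assumptions together say that all gaps and marks are
  independent, including the gap and the mark that share an index.\<close>

locale dynamical_discrete_web = prob_space M for M :: "'a measure" +
  fixes gap :: "site \<Rightarrow> nat \<Rightarrow> 'a \<Rightarrow> real"
    and mark :: "site \<Rightarrow> nat \<Rightarrow> 'a \<Rightarrow> int"
  assumes indep_gap_mark:
      "indep_vars (\<lambda>_. borel \<Otimes>\<^sub>M count_space {-1, 1})
         (\<lambda>(z, n) \<omega>. (gap z n \<omega>, mark z n \<omega>)) (even_sites \<times> UNIV)"
    and distr_gap_mark:
      "\<And>z n. z \<in> even_sites \<Longrightarrow>
         distr M (borel \<Otimes>\<^sub>M count_space {-1, 1}) (\<lambda>\<omega>. (gap z n \<omega>, mark z n \<omega>)) =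
           density lborel (\<lambda>x. ennreal (exponential_density 1 x)) \<Otimes>\<^sub>M uniform_count_measure {-1, 1}"

text \<open>Almost surely the set of rings up to time \<open>\<tau>\<close> is finite for every \<open>\<tau>\<close>; on the exceptional
  null set \<open>card\<close> may be 0 by convention. Counting rings at times \<open>\<le> \<tau>\<close> makes
  \<open>\<xi>\<close> right-continuous in \<open>\<tau>\<close>.\<close>

definition ring_count :: "(site \<Rightarrow> nat \<Rightarrow> 'a \<Rightarrow> real) \<Rightarrow> site \<Rightarrow> real \<Rightarrow> 'a \<Rightarrow> nat" where
  "ring_count gap z \<tau> \<omega> = card {n. (\<Sum>i\<le>n. gap z i \<omega>) \<le> \<tau>}"

definition \<xi> ::
    "(site \<Rightarrow> nat \<Rightarrow> 'a \<Rightarrow> real) \<Rightarrow> (site \<Rightarrow> nat \<Rightarrow> 'a \<Rightarrow> int) \<Rightarrow> real \<Rightarrow> 'a \<Rightarrow> site \<Rightarrow> int" where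
  "\<xi> gap mark \<tau> \<omega> z = mark z (ring_count gap z \<tau> \<omega>) \<omega>"

definition arrow_step :: "(site \<Rightarrow> int) \<Rightarrow> site \<Rightarrow> site" where
  "arrow_step a z = (fst z + a z, snd z + 1)"

text \<open>Linear interpolation; only meaningful at times \<open>t\<close> not before the time of \<open>z\<close>.\<close>

definition arrow_path :: "(site \<Rightarrow> int) \<Rightarrow> site \<Rightarrow> real \<Rightarrow> real" where
  "arrow_path a z t =
     (let s = t - real_of_int (snd z);
          n = nat \<lfloor>s\<rfloor>;
          x = real_of_int (fst ((arrow_step a ^^ n) z));
          y = real_of_int (fst ((arrow_step a ^^ Suc n) z))
      in x + frac s * (y - x))"

definition web_path ::
    "(site \<Rightarrow> nat \<Rightarrow> 'a \<Rightarrow> real) \<Rightarrow> (site \<Rightarrow> nat \<Rightarrow> 'a \<Rightarrow> int) \<Rightarrow> site \<Rightarrow> real \<Rightarrow> 'a \<Rightarrow> real \<Rightarrow> real" where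
  "web_path gap mark z \<tau> \<omega> t = arrow_path (\<xi> gap mark \<tau> \<omega>) z t"


subsection \<open>Rectangle events\<close>

definition hat_d :: "real \<Rightarrow> nat \<Rightarrow> int" where
  "hat_d \<gamma> k = 2 * (\<lfloor>(\<gamma> powr (\<gamma> ^ k)) / 2\<rfloor> + 1)"

definition hat_w :: "real \<Rightarrow> real \<Rightarrow> nat \<Rightarrow> int" where
  "hat_w \<gamma> C k =
     2 * (\<lfloor>C * sqrt ((real_of_int (hat_d \<gamma> k))\<^sup>2 * ln ((real_of_int (hat_d \<gamma> k))\<^sup>2)) / 2\<rfloor> + 1)"

definition hat_t :: "real \<Rightarrow> nat \<Rightarrow> int" where
  "hat_t \<gamma> k = (\<Sum>j<k. (hat_d \<gamma> j)\<^sup>2)"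

text \<open>Only used for \<open>k \<ge> 1\<close>.\<close>

definition hat_l :: "real \<Rightarrow> real \<Rightarrow> nat \<Rightarrow> site" where
  "hat_l \<gamma> C k = (- hat_w \<gamma> C (k - 1), hat_t \<gamma> k)"

definition hat_A ::
    "'a measure \<Rightarrow> (site \<Rightarrow> nat \<Rightarrow> 'a \<Rightarrow> real) \<Rightarrow> (site \<Rightarrow> nat \<Rightarrow> 'a \<Rightarrow> int) \<Rightarrow>
      real \<Rightarrow> real \<Rightarrow> nat \<Rightarrow> real \<Rightarrow> 'a set" where
  "hat_A M gap mark \<gamma> C k \<tau> =
     {\<omega> \<in> space M.
        web_path gap mark (hat_l \<gamma> C k) \<tau> \<omega> (real_of_int (hat_t \<gamma> (k + 1)))
          > real_of_int (hat_w \<gamma> C k)}"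

end

theory Submission
  imports Defs "HOL-Real_Asymp.Real_Asymp"
begin

text \<open>If the path from the origin is not to the left of \<open>- hat_w \<gamma> C K\<close> at time \<open>hat_t \<gamma> (K + 1)\<close>
  and all later rectangle events occur at \<open>\<tau>\<close>, then by non-crossing \<open>\<tau>\<close> belongs to the random
  set. The events of distinct levels use disjoint time strips, so they are independent, and the
  second moment of the normalised Lebesgue measure \<open>\<mu>\<^sub>n\<close> on the dynamical times in \<open>[0, 1]\<close> that
  survive the first \<open>n\<close> levels is controlled by a product over the levels. A Gaussian lower bound
  makes the probability at level \<open>k\<close> at least \<open>D\<^sub>k powr (-q)\<close> with \<open>D\<^sub>k = \<gamma> powr (\<gamma> ^ k)\<close> and \<open>q\<close>
  slightly above \<open>C\<^sup>2\<close>. With the correlation hypothesis, the product at distance \<open>h\<close> is at most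
  \<open>1 + \<delta> * h powr (-\<rho>)\<close> for \<open>\<rho> = 2 \<gamma>\<^sup>2 C\<^sup>2 / (\<gamma> - 1)\<close>, where \<open>\<delta>\<close> is small when the first level is
  large: among the levels that do not yet separate points at distance \<open>h\<close>, the largest costs at
  most \<open>h powr (-2 q)\<close> and the others form a geometric sum in the exponent.

  Hence, with probability close to \<open>1\<close>, infinitely many \<open>\<mu>\<^sub>n\<close> have mass at least \<open>1/2\<close> and
  bounded \<open>s\<close>-energy, for \<open>s < 1 - \<rho>\<close>. By compactness this prevents coverings with
  a small sum of \<open>diam\<^sup>s\<close>; the closures only add the countably many jump times. Since \<open>\<delta>\<close> is
  arbitrary, the bound on the dimension holds almost surely without a zero-one law.\<close>

section \<open>Energy and Hausdorff measure\<close>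


text \<open>The condition on \<open>a'\<close> says that, for \<open>q\<close> slightly above
  \<open>C^2\<close>, the exponent \<open>\<theta> = 1 - 2 q / a'\<close> is at least
  \<open>\<gamma> powr (-3/2)\<close>. The relative error of the correlation bound at level
  \<open>k\<close> and distance \<open>h\<close> is a multiple of
  \<open>(D k powr \<theta> * h) powr (-a')\<close>, so levels with
  \<open>D k >= h powr (- \<gamma> powr (3/2))\<close> count as separated. Bounding every remaining
  level by \<open>1 / P(A)\<close> would cost the exponent
  \<open>q \<gamma> powr (5/2) / (\<gamma> - 1)\<close>, which exceeds \<rho> once \<gamma> is at
  least 4. This is why the largest of them is treated apart with the minimum of its two bounds; the
  resulting exponent \<open>q (2 + \<gamma> powr (3/2) / (\<gamma> - 1))\<close> is below \<rho> for
  every \<gamma> above 1 when \<open>q\<close> is close to \<open>C^2\<close>.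

  No limit measure is constructed: the time sets are not closed, and the mass and energy bounds hold
  only for infinitely many indices that depend on the sample point. A cover of the limit set is
  instead tested against one of the approximating measures, at a good index beyond the one given by
  compactness.\<close>

definition riesz_kernel :: "real \<Rightarrow> real \<Rightarrow> real \<Rightarrow> ennreal" where
  "riesz_kernel s x y = (if x = y then \<infinity> else ennreal (\<bar>x - y\<bar> powr (-s)))"

definition riesz_energy :: "real \<Rightarrow> real set \<Rightarrow> ennreal" where
  "riesz_energy s E = (\<integral>\<^sup>+x\<in>E. (\<integral>\<^sup>+y\<in>E. riesz_kernel s x y \<partial>lborel) \<partial>lborel)"

lemma measurable_riesz_kernel [measurable]:
  "(\<lambda>(x, y). riesz_kernel s x y) \<in> borel_measurable (borel \<Otimes>\<^sub>M borel)"
  unfolding riesz_kernel_def by measurable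

text \<open>The case \<open>x = y\<close> is the reason for the infinite value on the diagonal,
  since \<open>0 powr (-s)\<close> is \<open>0\<close>.\<close>

lemma riesz_kernel_ge:
  assumes "\<bar>x - y\<bar> \<le> r" "0 \<le> s"
  shows "ennreal (r powr (-s)) \<le> riesz_kernel s x y"
proof (cases "x = y")
  case False
  then have "r powr (-s) \<le> \<bar>x - y\<bar> powr (-s)"
    using assms by (intro powr_mono2') auto
  then show ?thesis using False by (simp add: riesz_kernel_def ennreal_leI)
qed (simp add: riesz_kernel_def)

text \<open>Frostman's argument for the measure with density \<open>c\<close> on \<open>E\<close>.
  By Markov's inequality, points whose potential exceeds \<open>4 b\<close> carry mass at most
  \<open>1/4\<close>. If a covering set contains a point of smaller potential, then the part of it
  in \<open>E1\<close> has mass at most \<open>4 b * R i powr s\<close>, because the kernel is at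
  least \<open>R i powr (-s)\<close> there. These masses must account for the remaining
  \<open>1/4\<close>.\<close>

lemma riesz_energy_covering_bound:
  fixes E :: "real set" and V :: "nat \<Rightarrow> real set" and R :: "nat \<Rightarrow> real"
  assumes E [measurable]: "E \<in> sets borel" and V [measurable]: "\<And>i. V i \<in> sets borel"
    and cover: "E \<subseteq> (\<Union>i. V i)"
    and R: "\<And>i. R i > 0" "\<And>i x y. x \<in> V i \<Longrightarrow> y \<in> V i \<Longrightarrow> \<bar>x - y\<bar> \<le> R i"
    and "0 \<le> s" "0 < c" "0 < b"
    and mass: "ennreal (1/2) \<le> ennreal c * emeasure lborel E"
    and energy: "ennreal (c\<^sup>2) * riesz_energy s E \<le> ennreal b"
  shows "ennreal (1/4) \<le> (\<Sum>i. ennreal (4 * b * R i powr s))"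
proof -
  define \<phi> where "\<phi> = (\<lambda>x. \<integral>\<^sup>+y\<in>E. riesz_kernel s x y \<partial>lborel)"
  have [measurable]: "\<phi> \<in> borel_measurable borel"
    unfolding \<phi>_def by measurable
  define E1 where "E1 = {x \<in> E. ennreal c * \<phi> x \<le> ennreal (4 * b)}"
  define E2 where "E2 = {x \<in> E. 1 \<le> ennreal (c / (4 * b)) * \<phi> x}"
  have [measurable]: "E1 \<in> sets borel" "E2 \<in> sets borel"
    unfolding E1_def E2_def by measurable
  have sub: "E \<subseteq> E1 \<union> E2"
  proof
    fix x assume "x \<in> E"
    show "x \<in> E1 \<union> E2"
    proof (cases "ennreal c * \<phi> x \<le> ennreal (4 * b)")
      case False
      then have "ennreal (4 * b) \<le> ennreal c * \<phi> x" by simp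
      then have "ennreal (1 / (4 * b)) * ennreal (4 * b) \<le> ennreal (1 / (4 * b)) * (ennreal c * \<phi> x)"
        by (rule mult_left_mono) simp
      also have "ennreal (1 / (4 * b)) * ennreal (4 * b) = 1"
        using \<open>0 < b\<close> by (simp flip: ennreal_mult')
      also have "ennreal (1 / (4 * b)) * (ennreal c * \<phi> x) = ennreal (c / (4 * b)) * \<phi> x"
        using \<open>0 < b\<close> \<open>0 < c\<close> by (simp add: mult.assoc[symmetric] flip: ennreal_mult')
      finally show ?thesis using \<open>x \<in> E\<close> by (simp add: E2_def)
    qed (use \<open>x \<in> E\<close> in \<open>simp add: E1_def\<close>)
  qed
  have E2_le: "ennreal c * emeasure lborel E2 \<le> ennreal (1/4)"
  proof -
    have "emeasure lborel E2 \<le> ennreal (c / (4 * b)) * (\<integral>\<^sup>+x\<in>E. \<phi> x \<partial>lborel)"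
      unfolding E2_def by (rule nn_integral_Markov_inequality) auto
    also have "(\<integral>\<^sup>+x\<in>E. \<phi> x \<partial>lborel) = riesz_energy s E"
      by (simp add: riesz_energy_def \<phi>_def)
    finally have "ennreal c * emeasure lborel E2 \<le> ennreal c * (ennreal (c / (4 * b)) * riesz_energy s E)"
      by (rule mult_left_mono) simp
    also have "\<dots> = ennreal (1 / (4 * b)) * (ennreal (c\<^sup>2) * riesz_energy s E)"
      using \<open>0 < b\<close> \<open>0 < c\<close> by (simp add: mult.assoc[symmetric] power2_eq_square ennreal_mult'[symmetric])
    also have "\<dots> \<le> ennreal (1 / (4 * b)) * ennreal b"
      by (rule mult_left_mono) (use energy in auto)
    also have "\<dots> = ennreal (1/4)"
      using \<open>0 < b\<close> by (simp flip: ennreal_mult')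
    finally show ?thesis .
  qed
  have E1V_le: "ennreal c * emeasure lborel (E1 \<inter> V i) \<le> ennreal (4 * b * R i powr s)" for i
  proof (cases "E1 \<inter> V i = {}")
    case False
    then obtain x where x: "x \<in> E1" "x \<in> V i" by auto
    have "ennreal (R i powr (-s)) * emeasure lborel (E1 \<inter> V i)
        = (\<integral>\<^sup>+y\<in>E1 \<inter> V i. ennreal (R i powr (-s)) \<partial>lborel)"
      by (rule nn_integral_cmult_indicator[symmetric]) measurable
    also have "\<dots> \<le> \<phi> x"
      unfolding \<phi>_def
      by (intro nn_integral_mono)
        (use x R \<open>0 \<le> s\<close> in \<open>auto simp: indicator_def E1_def intro!: riesz_kernel_ge\<close>)
    finally have "ennreal c * (ennreal (R i powr (-s)) * emeasure lborel (E1 \<inter> V i)) \<le> ennreal c * \<phi> x"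
      by (rule mult_left_mono) simp
    also have "\<dots> \<le> ennreal (4 * b)" using x by (simp add: E1_def)
    finally have "ennreal (R i powr s) * (ennreal c * (ennreal (R i powr (-s)) * emeasure lborel (E1 \<inter> V i)))
       \<le> ennreal (R i powr s) * ennreal (4 * b)"
      by (rule mult_left_mono) simp
    also have "ennreal (R i powr s) * (ennreal c * (ennreal (R i powr (-s)) * emeasure lborel (E1 \<inter> V i)))
      = ennreal (R i powr s * c * R i powr (-s)) * emeasure lborel (E1 \<inter> V i)"
      using \<open>0 < c\<close> by (simp add: ennreal_mult' mult_ac)
    also have "R i powr s * c * R i powr (-s) = c"
      using R(1)[of i] by (simp add: powr_minus field_simps)
    also have "ennreal (R i powr s) * ennreal (4 * b) = ennreal (4 * b * R i powr s)"
      using \<open>0 < b\<close> by (simp add: mult_ac flip: ennreal_mult')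
    finally show ?thesis .
  qed simp
  have "ennreal (1/2) \<le> ennreal c * emeasure lborel E" by fact
  also have "emeasure lborel E \<le> emeasure lborel (E1 \<union> E2)"
    by (rule emeasure_mono[OF sub]) auto
  also have "\<dots> \<le> emeasure lborel E1 + emeasure lborel E2"
    by (rule emeasure_subadditive) auto
  also have "E1 = (\<Union>i. E1 \<inter> V i)" using cover by (auto simp: E1_def)
  also have "emeasure lborel (\<Union>i. E1 \<inter> V i) \<le> (\<Sum>i. emeasure lborel (E1 \<inter> V i))"
    by (rule emeasure_subadditive_countably) auto
  finally have "ennreal (1/2) \<le> ennreal c * ((\<Sum>i. emeasure lborel (E1 \<inter> V i)) + emeasure lborel E2)"
    by (simp add: mult_left_mono)
  also have "\<dots> = (\<Sum>i. ennreal c * emeasure lborel (E1 \<inter> V i)) + ennreal c * emeasure lborel E2"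
    by (simp add: distrib_left)
  also have "\<dots> \<le> (\<Sum>i. ennreal (4 * b * R i powr s)) + ennreal (1/4)"
    by (intro add_mono suminf_le E1V_le E2_le) auto
  also have "\<dots> = ennreal (1/4) + (\<Sum>i. ennreal (4 * b * R i powr s))"
    by (rule add.commute)
  also have "ennreal (1/2) = ennreal (1/4) + ennreal (1/4)"
    by (simp flip: ennreal_plus)
  finally show ?thesis unfolding ennreal_add_left_cancel_le by simp
qed

text \<open>The energy argument runs at one positive exponent \<open>s\<close>; this transfers its
  conclusion to every smaller exponent, including \<open>t = 0\<close>, where the weight of a
  nonempty set is \<open>1\<close>.\<close>

lemma diameter_powr_le_hausdorff_weight:
  assumes "bounded U" "diameter U \<le> 1" "0 \<le> t" "t \<le> s" "0 < s"
  shows "ennreal (diameter U powr s) \<le> hausdorff_weight t U"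
proof (cases "U = {}")
  case False
  have "0 \<le> diameter U" by (rule diameter_ge_0) fact
  then have "diameter U powr s \<le> 1" "diameter U powr s \<le> diameter U powr t"
    using assms by (auto intro: powr_mono' simp: powr_le1)
  then have "ennreal (diameter U powr s) \<le> 1" "ennreal (diameter U powr s) \<le> ennreal (diameter U powr t)"
    by (auto intro: ennreal_leI simp: ennreal_le_1)
  then show ?thesis using False by (simp add: hausdorff_weight_def)
qed (use assms in auto)

lemma hausdorff_measure_mono:
  assumes "A \<subseteq> B"
  shows "hausdorff_measure s A \<le> hausdorff_measure s B"
  unfolding hausdorff_measure_def hausdorff_pre_measure_def
  by (intro SUP_mono' INF_superset_mono) (use assms in auto)

text \<open>A cover with small weights is enlarged to an open set that also swallows
  \<open>D\<close>. It then contains all limit points of the decreasing sequence, hence by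
  compactness some \<open>closure (E m)\<close>, hence every later \<open>E n\<close>. Infinitely
  many good indices are assumed because \<open>m\<close> depends on the cover.\<close>

lemma hausdorff_measure_limit_set_nonzero:
  fixes E :: "nat \<Rightarrow> real set" and c :: "nat \<Rightarrow> real"
  assumes E: "\<And>n. E n \<in> sets borel" "\<And>n. E n \<subseteq> {0..1}" "decseq E"
    and D: "countable D" "\<And>n. closure (E n) \<subseteq> E n \<union> D"
    and c: "\<And>n. 0 < c n" and "0 < b"
    and freq: "\<exists>\<^sub>\<infinity>n. ennreal (1/2) \<le> ennreal (c n) * emeasure lborel (E n)
                   \<and> ennreal ((c n)\<^sup>2) * riesz_energy s (E n) \<le> ennreal b"
    and "0 \<le> t" "t \<le> s" "0 < s"
  shows "hausdorff_measure t (\<Inter>n. E n) \<noteq> 0"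
proof
  assume zero: "hausdorff_measure t (\<Inter>n. E n) = 0"
  \<comment> \<open>The final sum is at most \<open>4 * b * 4 powr s * (3 * \<epsilon>)\<close>: one
    \<epsilon> from the cover and one from each of the two uses of the radii. This choice makes it
    \<open>3/16\<close>, below \<open>1/4\<close>.\<close>
  define \<epsilon> where "\<epsilon> = 1 / (64 * b * 4 powr s)"
  have "\<epsilon> > 0" using \<open>0 < b\<close> by (simp add: \<epsilon>_def)
  \<comment> \<open>Mesh size \<open>1\<close> is chosen because the comparison of exponents
    requires diameters at most \<open>1\<close>.\<close>
  have "hausdorff_pre_measure t 1 (\<Inter>n. E n) \<le> hausdorff_measure t (\<Inter>n. E n)"
    unfolding hausdorff_measure_def by (rule SUP_upper) simp
  then have "hausdorff_pre_measure t 1 (\<Inter>n. E n) < ennreal \<epsilon>"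
    using zero \<open>\<epsilon> > 0\<close> by simp
  then obtain U where U: "(\<Inter>n. E n) \<subseteq> (\<Union>i. U i)" "\<And>i. bounded (U i)" "\<And>i. diameter (U i) \<le> 1"
      and sumU: "(\<Sum>i. hausdorff_weight t (U i)) < ennreal \<epsilon>"
    unfolding hausdorff_pre_measure_def INF_less_iff by auto
  \<comment> \<open>Positive radii with \<open>\<Sum> r i powr s = \<epsilon>\<close>; they open up
    the covering sets, even those of diameter \<open>0\<close>.\<close>
  define r where "r = (\<lambda>i. (\<epsilon> * (1/2) ^ Suc i) powr (1/s))"
  have r: "r i > 0" "r i powr s = \<epsilon> * (1/2) ^ Suc i" for i
    using \<open>\<epsilon> > 0\<close> \<open>0 < s\<close> by (auto simp: r_def powr_powr)
  define a where "a = (\<lambda>i. diameter (U i))"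
  have a0: "0 \<le> a i" for i unfolding a_def by (rule diameter_ge_0) (rule U)
  define u where "u = (\<lambda>i. SOME x. x \<in> U i)"
  define d where "d = from_nat_into D"
  have d: "D \<subseteq> range d"
    unfolding d_def using range_from_nat_into[OF _ \<open>countable D\<close>] by (cases "D = {}") auto
  \<comment> \<open>The first ball contains \<open>U i\<close>, the second the \<open>i\<close>-th
    point of \<open>D\<close>. If \<open>U i\<close> or \<open>D\<close> is empty, the ball has an
    arbitrary centre, which does no harm to a cover.\<close>
  define V where "V = (\<lambda>i. ball (u i) (a i + r i) \<union> ball (d i) (r i))"
  define W where "W = (\<Union>i. V i)"
  have "open W" by (auto simp: W_def V_def)
  have "(\<Inter>n. E n) \<subseteq> (\<Union>i. ball (u i) (a i + r i))"
  proof
    fix x assume "x \<in> (\<Inter>n. E n)"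
    then obtain i where i: "x \<in> U i" using U(1) by auto
    then have "u i \<in> U i" unfolding u_def by (rule someI)
    then have "dist (u i) x \<le> a i"
      unfolding a_def using i U(2) by (intro diameter_bounded_bound) auto
    then show "x \<in> (\<Union>i. ball (u i) (a i + r i))"
      using r(1)[of i] by (auto intro!: exI[of _ i])
  qed
  then have EW: "(\<Inter>n. E n) \<subseteq> W" by (auto simp: W_def V_def)
  have DW: "D \<subseteq> W"
  proof
    fix x assume "x \<in> D"
    then obtain i where "x = d i" using d by auto
    then have "x \<in> V i" using r(1)[of i] by (simp add: V_def)
    then show "x \<in> W" by (auto simp: W_def)
  qed
  have sub: "(\<Inter>n. closure (E n)) \<subseteq> W"
  proof
    fix x assume x: "x \<in> (\<Inter>n. closure (E n))"
    show "x \<in> W"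
    proof (cases "x \<in> D")
      case False
      then have "x \<in> E n" for n using x D(2)[of n] by auto
      then show ?thesis using EW by auto
    qed (use DW in auto)
  qed
  have "\<exists>n. closure (E n) \<subseteq> W"
  proof (rule ccontr)
    assume neg: "\<not> ?thesis"
    have cpt: "compact (closure (E n))" for n
      using E(2)[of n] bounded_subset[OF bounded_closed_interval] by (simp add: compact_closure)
    have "\<Inter>(range (\<lambda>n. closure (E n) - W)) \<noteq> {}"
    proof (rule compact_nest)
      show "compact (closure (E n) - W)" for n
        using cpt \<open>open W\<close> by (rule compact_diff)
      show "closure (E n) - W \<noteq> {}" for n using neg by auto
      show "closure (E n) - W \<subseteq> closure (E m) - W" if "m \<le> n" for m n
        using closure_mono[OF decseqD[OF E(3) that]] by auto
    qed
    then show False using sub by auto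
  qed
  then obtain m where m: "closure (E m) \<subseteq> W" by auto
  obtain n where n: "n \<ge> m"
      "ennreal (1/2) \<le> ennreal (c n) * emeasure lborel (E n)"
      "ennreal ((c n)\<^sup>2) * riesz_energy s (E n) \<le> ennreal b"
    using freq unfolding INFM_nat_le by blast
  have EnW: "E n \<subseteq> W"
    using m closure_subset[of "E m"] decseqD[OF E(3) n(1)] by auto
  \<comment> \<open>The two families of balls are interleaved into one sequence, so that each member
    has its own diameter bound.\<close>
  define V' where "V' = (\<lambda>i. if even i then ball (u (i div 2)) (a (i div 2) + r (i div 2))
      else ball (d (i div 2)) (r (i div 2)))"
  define R where "R = (\<lambda>i. 2 * (if even i then a (i div 2) + r (i div 2) else r (i div 2)))"
  have "V i \<subseteq> (\<Union>i. V' i)" for i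
  proof -
    have "V i = V' (2 * i) \<union> V' (2 * i + 1)" by (simp add: V_def V'_def)
    then show ?thesis by auto
  qed
  then have "W \<subseteq> (\<Union>i. V' i)" unfolding W_def by (rule UN_least)
  with EnW have "E n \<subseteq> (\<Union>i. V' i)" by (rule order_trans)
  then have "ennreal (1/4) \<le> (\<Sum>i. ennreal (4 * b * R i powr s))"
  proof (rule riesz_energy_covering_bound[rotated 2, where c = "c n"])
    show "0 < R i" for i using a0[of "i div 2"] r(1)[of "i div 2"] by (simp add: R_def)
    show "\<bar>x - y\<bar> \<le> R i" if "x \<in> V' i" "y \<in> V' i" for i x y
      using that by (cases "even i") (auto simp: R_def V'_def dist_real_def)
  qed (use E c n \<open>0 < b\<close> \<open>0 < s\<close> in \<open>auto simp: V'_def\<close>)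
  also have "\<dots> \<le> ennreal (4 * b * 4 powr s) * ennreal (3 * \<epsilon>)"
  proof -
    have Rle: "R i powr s \<le> 4 powr s * ((if even i then a (i div 2) powr s else 0) + r (i div 2) powr s)" for i
    proof -
      \<comment> \<open>Estimating the sum by twice the maximum works for every positive
        \<open>s\<close>, whether the power is concave or convex.\<close>
      have "(2 * (x + y)) powr s \<le> 4 powr s * (x powr s + y powr s)" if "0 \<le> x" "0 < y" for x y
      proof -
        have "(2 * (x + y)) powr s \<le> (4 * max x y) powr s"
          using that \<open>0 < s\<close> by (intro powr_mono2) auto
        also have "\<dots> = 4 powr s * (max x y powr s)" using that by (simp add: powr_mult)
        also have "\<dots> \<le> 4 powr s * (x powr s + y powr s)" by (auto simp: max_def)
        finally show ?thesis .
      qed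
      from this[of "a (i div 2)" "r (i div 2)"] this[of 0 "r (i div 2)"]
      show ?thesis using a0 r(1) \<open>0 < s\<close> by (auto simp: R_def)
    qed
    define f where "f = (\<lambda>i. ennreal (if even i then a (i div 2) powr s else 0))"
    define g where "g = (\<lambda>i. ennreal (r (i div 2) powr s))"
    have split: "(\<Sum>i. h i) = (\<Sum>i. h (2 * i) + h (2 * i + 1))" for h :: "nat \<Rightarrow> ennreal"
    proof -
      have "h sums (\<Sum>i. h i)" by (simp add: summable_sums)
      from sums_group[OF this, of 2]
      have "(\<lambda>n. \<Sum>i\<in>{n * 2..<n * 2 + 2}. h i) sums (\<Sum>i. h i)" by simp
      moreover have "(\<Sum>i\<in>{n * 2..<n * 2 + 2}. h i) = h (2 * n) + h (2 * n + 1)" for n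
      proof -
        have "{n * 2..<n * 2 + 2} = {2 * n, 2 * n + 1}" by auto
        then show ?thesis by simp
      qed
      ultimately show ?thesis by (simp add: sums_unique)
    qed
    have "(\<Sum>i. f i) = (\<Sum>i. ennreal (a i powr s))" by (subst split) (simp add: f_def)
    also have "\<dots> \<le> (\<Sum>i. hausdorff_weight t (U i))"
      unfolding a_def
      by (intro suminf_le diameter_powr_le_hausdorff_weight) (use U \<open>0 \<le> t\<close> \<open>t \<le> s\<close> \<open>0 < s\<close> in auto)
    finally have f_le: "(\<Sum>i. f i) \<le> ennreal \<epsilon>" using sumU by simp
    have "(\<lambda>i. \<epsilon> * (1/2) ^ Suc i) sums (\<epsilon> * 1)"
      by (rule sums_mult) (rule power_half_series)
    then have rs: "(\<Sum>i. ennreal (r i powr s)) = ennreal \<epsilon>"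
      using \<open>\<epsilon> > 0\<close> unfolding r(2) by (subst suminf_ennreal2) (auto simp: sums_iff)
    have "(\<Sum>i. g i) = (\<Sum>i. ennreal (r i powr s) + ennreal (r i powr s))"
      by (subst split) (simp add: g_def)
    also have "\<dots> = ennreal (2 * \<epsilon>)"
      using \<open>\<epsilon> > 0\<close> unfolding suminf_add[OF summableI summableI, symmetric] rs
      by (simp flip: ennreal_plus)
    finally have g_eq: "(\<Sum>i. g i) = ennreal (2 * \<epsilon>)" .
    have "(\<Sum>i. ennreal (4 * b * R i powr s)) \<le> (\<Sum>i. ennreal (4 * b * 4 powr s) * (f i + g i))"
    proof (rule suminf_le)
      fix i
      have "ennreal (4 * b * R i powr s) \<le> ennreal (4 * b * (4 powr s *
         ((if even i then a (i div 2) powr s else 0) + r (i div 2) powr s)))"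
        using Rle[of i] \<open>0 < b\<close> by (intro ennreal_leI mult_left_mono) auto
      also have "\<dots> = ennreal (4 * b * 4 powr s) * (f i + g i)"
      proof -
        have "f i + g i = ennreal ((if even i then a (i div 2) powr s else 0) + r (i div 2) powr s)"
          unfolding f_def g_def by (subst ennreal_plus) auto
        moreover have "0 \<le> 4 * b * 4 powr s" using \<open>0 < b\<close> by simp
        ultimately show ?thesis
          by (simp only: ennreal_mult'[symmetric] mult.assoc)
      qed
      finally show "ennreal (4 * b * R i powr s) \<le> ennreal (4 * b * 4 powr s) * (f i + g i)" .
    qed auto
    also have "\<dots> = ennreal (4 * b * 4 powr s) * ((\<Sum>i. f i) + (\<Sum>i. g i))"
      by (simp only: ennreal_suminf_cmult suminf_add[OF summableI summableI])
    also have "\<dots> \<le> ennreal (4 * b * 4 powr s) * (ennreal \<epsilon> + ennreal (2 * \<epsilon>))"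
      using f_le g_eq by (intro mult_left_mono add_mono) auto
    also have "\<dots> = ennreal (4 * b * 4 powr s) * ennreal (3 * \<epsilon>)"
      using \<open>\<epsilon> > 0\<close> by (simp flip: ennreal_plus)
    finally show ?thesis .
  qed
  also have "\<dots> = ennreal (4 * b * 4 powr s * (3 * \<epsilon>))"
    using \<open>0 < b\<close> by (intro ennreal_mult'[symmetric]) auto
  also have "4 * b * 4 powr s * (3 * \<epsilon>) = 3 / 16"
    using \<open>0 < b\<close> by (simp add: \<epsilon>_def field_simps)
  finally show False by (simp add: ennreal_le_iff)
qed

section \<open>The second moment bound\<close>


lemma nn_integral_abs_diff_powr_le:
  assumes "0 \<le> r" "r < 1"
  shows "(\<integral>\<^sup>+x\<in>{0..1}. (\<integral>\<^sup>+y\<in>{0..1}. ennreal (\<bar>x - y\<bar> powr (-r)) \<partial>lborel) \<partial>lborel) \<le> ennreal (2 / (1 - r))"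
proof -
  define f :: "real \<Rightarrow> ennreal" where "f = (\<lambda>h. ennreal (h powr (-r)) * indicator {0..1} h)"
  have [measurable]: "f \<in> borel_measurable borel" unfolding f_def by measurable
  have "((\<lambda>x. x powr (-r)) has_integral (1 powr (-r + 1) / (-r + 1))) {0..1}"
    by (rule has_integral_powr_from_0) (use assms in auto)
  then have f: "(\<integral>\<^sup>+h. f h \<partial>lborel) = ennreal (1 / (1 - r))"
    unfolding f_def by (subst nn_integral_has_integral_lebesgue') auto
  have "(\<integral>\<^sup>+y\<in>{0..1}. ennreal (\<bar>x - y\<bar> powr (-r)) \<partial>lborel) \<le> ennreal (2 / (1 - r))"
    if "x \<in> {0..1}" for x
  proof -
    have "(\<integral>\<^sup>+y\<in>{0..1}. ennreal (\<bar>x - y\<bar> powr (-r)) \<partial>lborel) \<le> (\<integral>\<^sup>+y. f (x - y) + f (-x + y) \<partial>lborel)"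
      using that by (intro nn_integral_mono) (auto simp: f_def indicator_def)
    also have "\<dots> = (\<integral>\<^sup>+y. f (x - y) \<partial>lborel) + (\<integral>\<^sup>+y. f (-x + y) \<partial>lborel)"
      by (rule nn_integral_add) auto
    also have "(\<integral>\<^sup>+y. f (x - y) \<partial>lborel) = (\<integral>\<^sup>+y. f y \<partial>lborel)"
      using nn_integral_real_affine[of f "-1" x] by simp
    also have "(\<integral>\<^sup>+y. f (-x + y) \<partial>lborel) = (\<integral>\<^sup>+y. f y \<partial>lborel)"
      using nn_integral_real_affine[of f 1 "-x"] by simp
    also have "(\<integral>\<^sup>+y. f y \<partial>lborel) + (\<integral>\<^sup>+y. f y \<partial>lborel) = ennreal (2 / (1 - r))"
      using assms unfolding f by (subst ennreal_plus[symmetric]) (auto simp: field_simps)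
    finally show ?thesis .
  qed
  then have "(\<integral>\<^sup>+x\<in>{0..1}. (\<integral>\<^sup>+y\<in>{0..1}. ennreal (\<bar>x - y\<bar> powr (-r)) \<partial>lborel) \<partial>lborel)
      \<le> (\<integral>\<^sup>+x\<in>{0..1::real}. ennreal (2 / (1 - r)) \<partial>lborel)"
    by (intro nn_integral_mono) (auto simp: indicator_def)
  also have "\<dots> = ennreal (2 / (1 - r))"
    by (subst nn_integral_cmult_indicator) auto
  finally show ?thesis .
qed

context prob_space
begin

definition time_slice :: "(real \<times> 'a) set \<Rightarrow> 'a \<Rightarrow> real set" where
  "time_slice R \<omega> = {\<tau> \<in> {0..1}. (\<tau>, \<omega>) \<in> R}"

lemma measurable_slice_integral:
  fixes R :: "(real \<times> 'a) set"
  assumes [measurable]: "R \<in> sets (borel \<Otimes>\<^sub>M M)" "(\<lambda>(x, y). K x y) \<in> borel_measurable (borel \<Otimes>\<^sub>M borel)"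
  shows "(\<lambda>\<omega>. \<integral>\<^sup>+x\<in>time_slice R \<omega>. (\<integral>\<^sup>+y\<in>time_slice R \<omega>. K x y \<partial>lborel) \<partial>lborel) \<in> borel_measurable M"
    (is "?g \<in> _")
proof -
  have "?g = (\<lambda>\<omega>. \<integral>\<^sup>+x. (\<integral>\<^sup>+y. K x y * (indicator {0..1} y * indicator R (y, \<omega>)) \<partial>lborel)
      * (indicator {0..1} x * indicator R (x, \<omega>)) \<partial>lborel)"
    by (intro ext nn_integral_cong arg_cong2[where f = "(*)"])
       (auto simp: time_slice_def indicator_def)
  then show ?thesis by simp
qed

text \<open>Tonelli: integrating over a random set twice weights the kernel with the joint
  probability of two times. The kernel \<open>1\<close> gives the second moment of the mass, the
  Riesz kernel gives the expected energy.\<close>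

lemma nn_integral_slice_integral:
  fixes R :: "(real \<times> 'a) set" and K :: "real \<Rightarrow> real \<Rightarrow> ennreal"
  assumes [measurable]: "R \<in> sets (borel \<Otimes>\<^sub>M M)" "(\<lambda>(x, y). K x y) \<in> borel_measurable (borel \<Otimes>\<^sub>M borel)"
  shows "(\<integral>\<^sup>+\<omega>. (\<integral>\<^sup>+x\<in>time_slice R \<omega>. (\<integral>\<^sup>+y\<in>time_slice R \<omega>. K x y \<partial>lborel) \<partial>lborel) \<partial>M)
    = (\<integral>\<^sup>+x\<in>{0..1}. (\<integral>\<^sup>+y\<in>{0..1}. K x y * emeasure M {\<omega> \<in> space M. (x, \<omega>) \<in> R \<and> (y, \<omega>) \<in> R} \<partial>lborel) \<partial>lborel)"
proof -
  interpret P: pair_sigma_finite lborel M ..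
  define g :: "real \<Rightarrow> 'a \<Rightarrow> ennreal" where "g = (\<lambda>x \<omega>. indicator {0..1} x * indicator R (x, \<omega>))"
  have [measurable]: "(\<lambda>(x, \<omega>). g x \<omega>) \<in> borel_measurable (borel \<Otimes>\<^sub>M M)" unfolding g_def by measurable
  have "(\<integral>\<^sup>+\<omega>. (\<integral>\<^sup>+x\<in>time_slice R \<omega>. (\<integral>\<^sup>+y\<in>time_slice R \<omega>. K x y \<partial>lborel) \<partial>lborel) \<partial>M)
    = (\<integral>\<^sup>+\<omega>. (\<integral>\<^sup>+x. (\<integral>\<^sup>+y. K x y * g y \<omega> * g x \<omega> \<partial>lborel) \<partial>lborel) \<partial>M)"
  proof (intro nn_integral_cong)
    fix \<omega> x assume [measurable]: "\<omega> \<in> space M"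
    have "(\<integral>\<^sup>+y\<in>time_slice R \<omega>. K x y \<partial>lborel) * indicator (time_slice R \<omega>) x = (\<integral>\<^sup>+y. K x y * g y \<omega> \<partial>lborel) * g x \<omega>"
      by (intro nn_integral_cong arg_cong2[where f = "(*)"])
       (auto simp: time_slice_def indicator_def g_def)
    also have "\<dots> = (\<integral>\<^sup>+y. K x y * g y \<omega> * g x \<omega> \<partial>lborel)"
      by (rule nn_integral_multc[symmetric]) measurable
    finally show "(\<integral>\<^sup>+y\<in>time_slice R \<omega>. K x y \<partial>lborel) * indicator (time_slice R \<omega>) x = \<dots>" .
  qed
  also have "\<dots> = (\<integral>\<^sup>+x. (\<integral>\<^sup>+\<omega>. (\<integral>\<^sup>+y. K x y * g y \<omega> * g x \<omega> \<partial>lborel) \<partial>M) \<partial>lborel)"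
    by (rule P.Fubini') measurable
  also have "\<dots> = (\<integral>\<^sup>+x. (\<integral>\<^sup>+y. (\<integral>\<^sup>+\<omega>. K x y * g y \<omega> * g x \<omega> \<partial>M) \<partial>lborel) \<partial>lborel)"
    by (intro nn_integral_cong P.Fubini') measurable
  also have "\<dots> = (\<integral>\<^sup>+x\<in>{0..1}. (\<integral>\<^sup>+y\<in>{0..1}. K x y * emeasure M {\<omega> \<in> space M. (x, \<omega>) \<in> R \<and> (y, \<omega>) \<in> R} \<partial>lborel) \<partial>lborel)"
  proof (intro nn_integral_cong)
    fix x :: real
    have "(\<integral>\<^sup>+\<omega>. K x y * g y \<omega> * g x \<omega> \<partial>M) = K x y * emeasure M {\<omega> \<in> space M. (x, \<omega>) \<in> R \<and> (y, \<omega>) \<in> R}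
      * indicator {0..1} y * indicator {0..1} x" for y
    proof -
      have "(\<integral>\<^sup>+\<omega>. K x y * g y \<omega> * g x \<omega> \<partial>M)
        = (\<integral>\<^sup>+\<omega>. (K x y * indicator {0..1} y * indicator {0..1} x) * indicator {\<omega> \<in> space M. (x, \<omega>) \<in> R \<and> (y, \<omega>) \<in> R} \<omega> \<partial>M)"
        by (intro nn_integral_cong) (auto simp: g_def indicator_def)
      also have "\<dots> = (K x y * indicator {0..1} y * indicator {0..1} x) * emeasure M {\<omega> \<in> space M. (x, \<omega>) \<in> R \<and> (y, \<omega>) \<in> R}"
        by (rule nn_integral_cmult_indicator) measurable
      finally show ?thesis by (simp add: mult_ac)
    qed
    then have "(\<integral>\<^sup>+y. (\<integral>\<^sup>+\<omega>. K x y * g y \<omega> * g x \<omega> \<partial>M) \<partial>lborel) =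
      (\<integral>\<^sup>+y. K x y * emeasure M {\<omega> \<in> space M. (x, \<omega>) \<in> R \<and> (y, \<omega>) \<in> R} * indicator {0..1} y * indicator {0..1} x \<partial>lborel)"
      by simp
    also have "\<dots> = (\<integral>\<^sup>+y. K x y * emeasure M {\<omega> \<in> space M. (x, \<omega>) \<in> R \<and> (y, \<omega>) \<in> R} * indicator {0..1} y \<partial>lborel) * indicator {0..1} x"
      by (rule nn_integral_multc) measurable
    finally show "(\<integral>\<^sup>+y. (\<integral>\<^sup>+\<omega>. K x y * g y \<omega> * g x \<omega> \<partial>M) \<partial>lborel) = \<dots>" .
  qed
  finally show ?thesis .
qed

text \<open>The diagonal is exempt because it is a null set; the Riesz kernel is infinite on it and
  the correlation estimate concerns distinct times.\<close>

lemma nn_integral_slice_integral_le: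
  fixes R :: "(real \<times> 'a) set" and K :: "real \<Rightarrow> real \<Rightarrow> ennreal" and B :: "real \<Rightarrow> real \<Rightarrow> ennreal"
  assumes [measurable]: "R \<in> sets (borel \<Otimes>\<^sub>M M)" "(\<lambda>(x, y). K x y) \<in> borel_measurable (borel \<Otimes>\<^sub>M borel)"
    and le: "\<And>x y. x \<in> {0..1} \<Longrightarrow> y \<in> {0..1} \<Longrightarrow> x \<noteq> y \<Longrightarrow>
       K x y * emeasure M {\<omega> \<in> space M. (x, \<omega>) \<in> R \<and> (y, \<omega>) \<in> R} \<le> B x y"
  shows "(\<integral>\<^sup>+\<omega>. (\<integral>\<^sup>+x\<in>time_slice R \<omega>. (\<integral>\<^sup>+y\<in>time_slice R \<omega>. K x y \<partial>lborel) \<partial>lborel) \<partial>M)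
    \<le> (\<integral>\<^sup>+x\<in>{0..1}. (\<integral>\<^sup>+y\<in>{0..1}. B x y \<partial>lborel) \<partial>lborel)"
  unfolding nn_integral_slice_integral[OF assms(1,2)]
proof (intro nn_integral_mono)
  fix x :: real
  show "(\<integral>\<^sup>+y\<in>{0..1}. K x y * emeasure M {\<omega> \<in> space M. (x, \<omega>) \<in> R \<and> (y, \<omega>) \<in> R} \<partial>lborel) * indicator {0..1} x
     \<le> (\<integral>\<^sup>+y\<in>{0..1}. B x y \<partial>lborel) * indicator {0..1} x"
  proof (cases "x \<in> {0..1}")
    case True
    have "(\<integral>\<^sup>+y\<in>{0..1}. K x y * emeasure M {\<omega> \<in> space M. (x, \<omega>) \<in> R \<and> (y, \<omega>) \<in> R} \<partial>lborel)
        \<le> (\<integral>\<^sup>+y\<in>{0..1}. B x y \<partial>lborel)"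
      by (rule nn_integral_mono_AE, rule eventually_mono[OF AE_lborel_singleton[of x]])
         (use le True in \<open>auto simp: indicator_def\<close>)
    then show ?thesis by (rule mult_right_mono) simp
  qed simp
qed

text \<open>The tail unions decrease to the limit superior and each contains one of the
  \<open>G n\<close>, so continuity from above keeps the uniform bound \<open>p\<close>.\<close>

lemma prob_limsup_ge:
  fixes G :: "nat \<Rightarrow> 'a set"
  assumes [measurable]: "\<And>n. G n \<in> events" and G: "\<And>n. p \<le> prob (G n)"
  shows "p \<le> prob (\<Inter>m. \<Union>n\<in>{m..}. G n)"
proof (rule LIMSEQ_le_const)
  show "(\<lambda>m. prob (\<Union>n\<in>{m..}. G n)) \<longlonglongrightarrow> prob (\<Inter>m. \<Union>n\<in>{m..}. G n)"
  proof (rule finite_Lim_measure_decseq)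
    show "decseq (\<lambda>m. \<Union>n\<in>{m..}. G n)"
      unfolding decseq_def by (intro allI impI UN_mono) auto
  qed auto
  have "prob (G m) \<le> prob (\<Union>n\<in>{m..}. G n)" for m
    by (rule finite_measure_mono) (measurable, auto)
  then show "\<exists>N. \<forall>m\<ge>N. p \<le> prob (\<Union>n\<in>{m..}. G n)"
    using G order_trans by blast
qed

text \<open>The normalised mass has mean \<open>1\<close> and variance at most
  \<open>2 \<delta> / (1 - \<rho>)\<close>; Chebyshev's inequality at distance \<open>1/2\<close>
  produces the loss \<open>8 \<delta> / (1 - \<rho>)\<close>. Markov's inequality for the energy
  loses \<epsilon>. Both bounds are uniform in \<open>n\<close>, so they survive for infinitely many
  \<open>n\<close> at once.\<close>

lemma frequently_mass_and_energy:
  fixes R :: "nat \<Rightarrow> (real \<times> 'a) set" and \<pi> :: "nat \<Rightarrow> real"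
  assumes R [measurable]: "\<And>n. R n \<in> sets (borel \<Otimes>\<^sub>M M)"
    and first: "\<And>n x. x \<in> {0..1} \<Longrightarrow> prob {\<omega> \<in> space M. (x, \<omega>) \<in> R n} = \<pi> n"
    and pos: "\<And>n. 0 < \<pi> n"
    and second: "\<And>n x y. x \<in> {0..1} \<Longrightarrow> y \<in> {0..1} \<Longrightarrow> x \<noteq> y \<Longrightarrow>
       prob {\<omega> \<in> space M. (x, \<omega>) \<in> R n \<and> (y, \<omega>) \<in> R n} \<le> (\<pi> n)\<^sup>2 * (1 + \<delta> * \<bar>x - y\<bar> powr (-\<rho>))"
    and "0 < s" "0 \<le> \<rho>" "s + \<rho> < 1" "0 \<le> \<delta>" "0 < \<epsilon>"
  shows "\<exists>b>0. \<exists>A\<in>events. 1 - 8 * \<delta> / (1 - \<rho>) - \<epsilon> \<le> prob A \<and>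
     (\<forall>\<omega>\<in>A. \<exists>\<^sub>\<infinity>n. ennreal (1/2) \<le> ennreal (1 / \<pi> n) * emeasure lborel (time_slice (R n) \<omega>)
                   \<and> ennreal ((1 / \<pi> n)\<^sup>2) * riesz_energy s (time_slice (R n) \<omega>) \<le> ennreal b)"
proof -
  let ?S = "\<lambda>n. time_slice (R n)"
  \<comment> \<open>On the unit interval \<open>1 + \<delta> h powr (-\<rho>)\<close> is at most
    \<open>(1 + \<delta>) h powr (-\<rho>)\<close>, so the expected normalised energy is at most the
    numerator; the division by \<epsilon> is for Markov's inequality.\<close>
  define b where "b = (1 + \<delta>) * (2 / (1 - (s + \<rho>))) / \<epsilon>"
  have "0 < b" using assms by (simp add: b_def)
  define Z where "Z = (\<lambda>n \<omega>. (1 / \<pi> n) * measure lborel (?S n \<omega>))"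
  have slice_borel [measurable]: "?S n \<omega> \<in> sets borel" if [measurable]: "\<omega> \<in> space M" for n \<omega>
    unfolding time_slice_def by measurable
  have slice_le: "emeasure lborel (?S n \<omega>) \<le> 1" for n \<omega>
  proof -
    have "emeasure lborel (?S n \<omega>) \<le> emeasure lborel {0..1::real}"
      by (rule emeasure_mono) (auto simp: time_slice_def)
    then show ?thesis by simp
  qed
  have slice_eq: "emeasure lborel (?S n \<omega>) = (\<integral>\<^sup>+x. indicator {0..1} x * indicator (R n) (x, \<omega>) \<partial>lborel)"
    if [measurable]: "\<omega> \<in> space M" for n \<omega>
  proof -
    have "emeasure lborel (?S n \<omega>) = (\<integral>\<^sup>+x. indicator (?S n \<omega>) x \<partial>lborel)"
      by simp
    also have "\<dots> = (\<integral>\<^sup>+x. indicator {0..1} x * indicator (R n) (x, \<omega>) \<partial>lborel)"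
      by (intro nn_integral_cong) (auto simp: time_slice_def indicator_def)
    finally show ?thesis .
  qed
  have [measurable]: "(\<lambda>\<omega>. emeasure lborel (?S n \<omega>)) \<in> borel_measurable M" for n
    by (subst measurable_cong[OF slice_eq]) measurable
  have Z_meas [measurable]: "Z n \<in> borel_measurable M" for n
    unfolding Z_def measure_def by measurable
  have ennZ: "ennreal (Z n \<omega>) = ennreal (1 / \<pi> n) * emeasure lborel (?S n \<omega>)" for n \<omega>
  proof -
    have "emeasure lborel (?S n \<omega>) = ennreal (measure lborel (?S n \<omega>))"
      using slice_le[of n \<omega>] by (intro emeasure_eq_ennreal_measure) (auto simp: top_unique)
    then show ?thesis using pos[of n] by (simp add: Z_def ennreal_mult'[symmetric])
  qed
  have Z0: "0 \<le> Z n \<omega>" for n \<omega> using pos[of n] by (simp add: Z_def)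
  have Zle: "Z n \<omega> \<le> 1 / \<pi> n" for n \<omega>
  proof -
    have "ennreal (Z n \<omega>) \<le> ennreal (1 / \<pi> n) * 1"
      unfolding ennZ by (intro mult_left_mono slice_le) auto
    then show ?thesis using pos[of n] by (simp add: ennreal_le_iff)
  qed
  have int1: "integrable M (Z n)" for n
    by (rule integrable_const_bound[where B = "1 / \<pi> n"]) (use Z0 Zle in auto)
  have int2: "integrable M (\<lambda>\<omega>. (Z n \<omega>)\<^sup>2)" for n
  proof (rule integrable_const_bound[where B = "(1 / \<pi> n)\<^sup>2"])
    show "AE \<omega> in M. norm ((Z n \<omega>)\<^sup>2) \<le> (1 / \<pi> n)\<^sup>2"
      using Z0 Zle by (intro AE_I2) (auto intro!: power_mono)
  qed simp
  interpret P: pair_sigma_finite lborel M ..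
  have EZ: "expectation (Z n) = 1" for n
  proof -
    have "(\<integral>\<^sup>+\<omega>. ennreal (Z n \<omega>) \<partial>M) = ennreal (1 / \<pi> n) * (\<integral>\<^sup>+\<omega>. emeasure lborel (?S n \<omega>) \<partial>M)"
      unfolding ennZ by (rule nn_integral_cmult) measurable
    also have "(\<integral>\<^sup>+\<omega>. emeasure lborel (?S n \<omega>) \<partial>M)
       = (\<integral>\<^sup>+\<omega>. \<integral>\<^sup>+x. indicator {0..1} x * indicator (R n) (x, \<omega>) \<partial>lborel \<partial>M)"
      by (intro nn_integral_cong slice_eq)
    also have "\<dots> = (\<integral>\<^sup>+x. \<integral>\<^sup>+\<omega>. indicator {0..1} x * indicator (R n) (x, \<omega>) \<partial>M \<partial>lborel)"
      by (rule P.Fubini') measurable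
    also have "\<dots> = (\<integral>\<^sup>+x\<in>{0..1::real}. ennreal (\<pi> n) \<partial>lborel)"
    proof (intro nn_integral_cong)
      fix x :: real
      have "(\<integral>\<^sup>+\<omega>. indicator {0..1} x * indicator (R n) (x, \<omega>) \<partial>M)
          = (\<integral>\<^sup>+\<omega>. indicator {0..1} x * indicator {\<omega> \<in> space M. (x, \<omega>) \<in> R n} \<omega> \<partial>M)"
        by (intro nn_integral_cong) (auto simp: indicator_def)
      also have "\<dots> = indicator {0..1} x * emeasure M {\<omega> \<in> space M. (x, \<omega>) \<in> R n}"
        by (rule nn_integral_cmult_indicator) measurable
      also have "\<dots> = ennreal (\<pi> n) * indicator {0..1} x"
        using first[of x n] by (auto simp: indicator_def emeasure_eq_measure)
      finally show "(\<integral>\<^sup>+\<omega>. indicator {0..1} x * indicator (R n) (x, \<omega>) \<partial>M) = \<dots>" .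
    qed
    also have "\<dots> = ennreal (\<pi> n)" by (subst nn_integral_cmult_indicator) auto
    also have "ennreal (1 / \<pi> n) * ennreal (\<pi> n) = 1"
      using pos[of n] by (simp add: ennreal_mult'[symmetric])
    finally show ?thesis using Z0 by (subst integral_eq_nn_integral) auto
  qed
  have second': "emeasure M {\<omega> \<in> space M. (x, \<omega>) \<in> R n \<and> (y, \<omega>) \<in> R n}
      \<le> ennreal ((\<pi> n)\<^sup>2 * (1 + \<delta> * \<bar>x - y\<bar> powr (-\<rho>)))"
    if "x \<in> {0..1}" "y \<in> {0..1}" "x \<noteq> y" for x y n
    using second[OF that, of n] by (simp add: emeasure_eq_measure ennreal_leI)
  have EZ2: "expectation (\<lambda>\<omega>. (Z n \<omega>)\<^sup>2) \<le> 1 + 2 * \<delta> / (1 - \<rho>)" for n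
  proof -
    have "(\<integral>\<^sup>+\<omega>. ennreal ((Z n \<omega>)\<^sup>2) \<partial>M)
        = (\<integral>\<^sup>+\<omega>. ennreal ((1 / \<pi> n)\<^sup>2) * (\<integral>\<^sup>+x\<in>?S n \<omega>. (\<integral>\<^sup>+y\<in>?S n \<omega>. 1 \<partial>lborel) \<partial>lborel) \<partial>M)"
    proof (intro nn_integral_cong)
      fix \<omega> assume [measurable]: "\<omega> \<in> space M"
      have sq: "(\<integral>\<^sup>+x\<in>?S n \<omega>. (\<integral>\<^sup>+y\<in>?S n \<omega>. 1 \<partial>lborel) \<partial>lborel)
        = emeasure lborel (?S n \<omega>) * emeasure lborel (?S n \<omega>)"
        by (subst nn_integral_cmult_indicator, simp)+ simp
      have "ennreal ((Z n \<omega>)\<^sup>2) = ennreal (Z n \<omega>) * ennreal (Z n \<omega>)"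
        using Z0 by (simp add: power2_eq_square ennreal_mult')
      also have "\<dots> = ennreal (1 / \<pi> n) * ennreal (1 / \<pi> n) * (emeasure lborel (?S n \<omega>) * emeasure lborel (?S n \<omega>))"
        unfolding ennZ by (simp add: mult_ac)
      also have "ennreal (1 / \<pi> n) * ennreal (1 / \<pi> n) = ennreal ((1 / \<pi> n)\<^sup>2)"
        unfolding power2_eq_square using pos[of n] by (intro ennreal_mult'[symmetric]) simp
      finally show "ennreal ((Z n \<omega>)\<^sup>2) = ennreal ((1 / \<pi> n)\<^sup>2) * (\<integral>\<^sup>+x\<in>?S n \<omega>. (\<integral>\<^sup>+y\<in>?S n \<omega>. 1 \<partial>lborel) \<partial>lborel)"
        unfolding sq .
    qed
    also have "\<dots> = ennreal ((1 / \<pi> n)\<^sup>2) * (\<integral>\<^sup>+\<omega>. (\<integral>\<^sup>+x\<in>?S n \<omega>. (\<integral>\<^sup>+y\<in>?S n \<omega>. 1 \<partial>lborel) \<partial>lborel) \<partial>M)"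
      by (rule nn_integral_cmult, rule measurable_slice_integral) measurable
    also have "\<dots> \<le> ennreal ((1 / \<pi> n)\<^sup>2) * (\<integral>\<^sup>+x\<in>{0..1}. (\<integral>\<^sup>+y\<in>{0..1}.
        ennreal ((\<pi> n)\<^sup>2 * (1 + \<delta> * \<bar>x - y\<bar> powr (-\<rho>))) \<partial>lborel) \<partial>lborel)"
      by (intro mult_left_mono nn_integral_slice_integral_le) (use second' in auto)
    also have "\<dots> = ennreal ((1 / \<pi> n)\<^sup>2) * (ennreal ((\<pi> n)\<^sup>2) * (1 + ennreal \<delta> * (\<integral>\<^sup>+x\<in>{0..1}. (\<integral>\<^sup>+y\<in>{0..1}.
        ennreal (\<bar>x - y\<bar> powr (-\<rho>)) \<partial>lborel) \<partial>lborel)))"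
    proof -
      have "(\<integral>\<^sup>+x\<in>{0..1}. (\<integral>\<^sup>+y\<in>{0..1}. ennreal ((\<pi> n)\<^sup>2 * (1 + \<delta> * \<bar>x - y\<bar> powr (-\<rho>))) \<partial>lborel) \<partial>lborel)
        = (\<integral>\<^sup>+x. ennreal ((\<pi> n)\<^sup>2) * (indicator {0..1} x + ennreal \<delta> * ((\<integral>\<^sup>+y\<in>{0..1}.
        ennreal (\<bar>x - y\<bar> powr (-\<rho>)) \<partial>lborel) * indicator {0..1} x)) \<partial>lborel)"
      proof (intro nn_integral_cong)
        fix x :: real
        have "(\<integral>\<^sup>+y\<in>{0..1}. ennreal ((\<pi> n)\<^sup>2 * (1 + \<delta> * \<bar>x - y\<bar> powr (-\<rho>))) \<partial>lborel)
          = (\<integral>\<^sup>+y. ennreal ((\<pi> n)\<^sup>2) * (indicator {0..1} y + ennreal \<delta> * (ennreal (\<bar>x - y\<bar> powr (-\<rho>)) * indicator {0..1} y)) \<partial>lborel)"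
          using \<open>0 \<le> \<delta>\<close> by (intro nn_integral_cong) (simp add: ennreal_mult' ennreal_plus indicator_def)
        also have "\<dots> = ennreal ((\<pi> n)\<^sup>2) * (1 + ennreal \<delta> * (\<integral>\<^sup>+y\<in>{0..1}. ennreal (\<bar>x - y\<bar> powr (-\<rho>)) \<partial>lborel))"
          by (simp add: nn_integral_cmult nn_integral_add)
        finally show "(\<integral>\<^sup>+y\<in>{0..1}. ennreal ((\<pi> n)\<^sup>2 * (1 + \<delta> * \<bar>x - y\<bar> powr (-\<rho>))) \<partial>lborel) * indicator {0..1} x
          = ennreal ((\<pi> n)\<^sup>2) * (indicator {0..1} x + ennreal \<delta> * ((\<integral>\<^sup>+y\<in>{0..1}.
             ennreal (\<bar>x - y\<bar> powr (-\<rho>)) \<partial>lborel) * indicator {0..1} x))"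
          by (simp add: indicator_def)
      qed
      then show ?thesis by (simp add: nn_integral_cmult nn_integral_add)
    qed
    also have "\<dots> \<le> ennreal ((1 / \<pi> n)\<^sup>2) * (ennreal ((\<pi> n)\<^sup>2) * (1 + ennreal \<delta> * ennreal (2 / (1 - \<rho>))))"
      by (intro mult_left_mono add_left_mono nn_integral_abs_diff_powr_le) (use assms in auto)
    also have "\<dots> = ennreal (1 + 2 * \<delta> / (1 - \<rho>))"
    proof -
      have "1 + ennreal \<delta> * ennreal (2 / (1 - \<rho>)) = ennreal (1 + 2 * \<delta> / (1 - \<rho>))"
        using assms by (simp add: ennreal_mult'[symmetric] mult_ac ennreal_plus)
      then show ?thesis using pos[of n] by (simp add: mult.assoc[symmetric] ennreal_mult'[symmetric] power_divide)
    qed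
    finally have le: "(\<integral>\<^sup>+\<omega>. ennreal ((Z n \<omega>)\<^sup>2) \<partial>M) \<le> ennreal (1 + 2 * \<delta> / (1 - \<rho>))" .
    have "0 \<le> 2 * \<delta> / (1 - \<rho>)" using assms by auto
    then have "0 \<le> 1 + 2 * \<delta> / (1 - \<rho>)" by linarith
    then show ?thesis
      using le nn_integral_eq_integral[OF int2, of n] by (simp only: ennreal_le_iff AE_I2 zero_le_power2 simp_thms)
  qed
  define B1 where "B1 = (\<lambda>n. {\<omega> \<in> space M. 1/2 \<le> \<bar>Z n \<omega> - 1\<bar>})"
  have [measurable]: "B1 n \<in> events" for n unfolding B1_def by measurable
  have B1: "prob (B1 n) \<le> 8 * \<delta> / (1 - \<rho>)" for n
  proof -
    have "prob (B1 n) \<le> variance (Z n) / (1/2)\<^sup>2"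
      using Chebyshev_inequality[OF Z_meas int2, of "1/2" n] unfolding EZ B1_def by simp
    also have "variance (Z n) \<le> 2 * \<delta> / (1 - \<rho>)"
      using EZ2[of n] by (subst variance_eq[OF int1 int2]) (simp add: EZ)
    finally show ?thesis by (simp add: power2_eq_square mult_ac)
  qed
  have [measurable]: "(\<lambda>\<omega>. riesz_energy s (?S n \<omega>)) \<in> borel_measurable M" for n
    unfolding riesz_energy_def by (rule measurable_slice_integral) measurable
  define B2 where "B2 = (\<lambda>n. {\<omega> \<in> space M. 1 \<le> ennreal (1/b) * (ennreal ((1 / \<pi> n)\<^sup>2) * riesz_energy s (?S n \<omega>))})"
  have [measurable]: "B2 n \<in> events" for n unfolding B2_def by measurable
  have Een: "(\<integral>\<^sup>+\<omega>. riesz_energy s (?S n \<omega>) \<partial>M) \<le> ennreal ((\<pi> n)\<^sup>2) * (ennreal (1 + \<delta>) * ennreal (2 / (1 - (s + \<rho>))))" for n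
  proof -
    have "(\<integral>\<^sup>+\<omega>. riesz_energy s (?S n \<omega>) \<partial>M) \<le> (\<integral>\<^sup>+x\<in>{0..1}. (\<integral>\<^sup>+y\<in>{0..1}.
        ennreal ((\<pi> n)\<^sup>2 * (1 + \<delta>)) * ennreal (\<bar>x - y\<bar> powr (-(s + \<rho>))) \<partial>lborel) \<partial>lborel)"
      unfolding riesz_energy_def
    proof (rule nn_integral_slice_integral_le)
      fix x y :: real assume xy: "x \<in> {0..1}" "y \<in> {0..1}" "x \<noteq> y"
      have h: "0 < \<bar>x - y\<bar>" "\<bar>x - y\<bar> \<le> 1" using xy by auto
      have "1 \<le> \<bar>x - y\<bar> powr (-\<rho>)"
        using powr_mono2'[of "-\<rho>" "\<bar>x - y\<bar>" 1] h \<open>0 \<le> \<rho>\<close> by simp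
      then have le: "1 + \<delta> * \<bar>x - y\<bar> powr (-\<rho>) \<le> (1 + \<delta>) * \<bar>x - y\<bar> powr (-\<rho>)"
        by (simp add: algebra_simps)
      have "riesz_kernel s x y * emeasure M {\<omega> \<in> space M. (x, \<omega>) \<in> R n \<and> (y, \<omega>) \<in> R n}
          \<le> ennreal (\<bar>x - y\<bar> powr (-s)) * ennreal ((\<pi> n)\<^sup>2 * (1 + \<delta> * \<bar>x - y\<bar> powr (-\<rho>)))"
        using second'[OF xy, of n] xy(3) by (auto simp: riesz_kernel_def intro!: mult_left_mono)
      also have "\<dots> \<le> ennreal (\<bar>x - y\<bar> powr (-s)) * ennreal ((\<pi> n)\<^sup>2 * ((1 + \<delta>) * \<bar>x - y\<bar> powr (-\<rho>)))"
        by (intro mult_left_mono ennreal_leI le) auto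
      also have "\<dots> = ennreal (\<bar>x - y\<bar> powr (-s) * ((\<pi> n)\<^sup>2 * ((1 + \<delta>) * \<bar>x - y\<bar> powr (-\<rho>))))"
        by (rule ennreal_mult'[symmetric]) simp
      also have "\<bar>x - y\<bar> powr (-s) * ((\<pi> n)\<^sup>2 * ((1 + \<delta>) * \<bar>x - y\<bar> powr (-\<rho>)))
           = ((\<pi> n)\<^sup>2 * (1 + \<delta>)) * \<bar>x - y\<bar> powr (-(s + \<rho>))"
        by (simp add: powr_add powr_diff powr_minus field_simps)
      also have "ennreal \<dots> = ennreal ((\<pi> n)\<^sup>2 * (1 + \<delta>)) * ennreal (\<bar>x - y\<bar> powr (-(s + \<rho>)))"
        using \<open>0 \<le> \<delta>\<close> by (intro ennreal_mult') auto
      finally show "riesz_kernel s x y * emeasure M {\<omega> \<in> space M. (x, \<omega>) \<in> R n \<and> (y, \<omega>) \<in> R n} \<le> \<dots>" .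
    qed measurable
    also have "\<dots> = ennreal ((\<pi> n)\<^sup>2 * (1 + \<delta>)) * (\<integral>\<^sup>+x\<in>{0..1}. (\<integral>\<^sup>+y\<in>{0..1}.
        ennreal (\<bar>x - y\<bar> powr (-(s + \<rho>))) \<partial>lborel) \<partial>lborel)"
      by (simp add: mult.assoc nn_integral_cmult)
    also have "\<dots> \<le> ennreal ((\<pi> n)\<^sup>2 * (1 + \<delta>)) * ennreal (2 / (1 - (s + \<rho>)))"
      by (intro mult_left_mono nn_integral_abs_diff_powr_le) (use assms in auto)
    finally show ?thesis by (simp add: ennreal_mult' mult.assoc)
  qed
  have B2: "prob (B2 n) \<le> \<epsilon>" for n
  proof -
    have "emeasure M (B2 n) = emeasure M {\<omega> \<in> space M. 1 \<le> ennreal (1 / b * (1 / \<pi> n)\<^sup>2) * riesz_energy s (?S n \<omega>)}"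
      unfolding B2_def mult.assoc[symmetric] using \<open>0 < b\<close> by (subst ennreal_mult'[symmetric]) auto
    also have "\<dots> \<le> ennreal (1 / b * (1 / \<pi> n)\<^sup>2) * (\<integral>\<^sup>+\<omega>\<in>space M. riesz_energy s (?S n \<omega>) \<partial>M)"
      by (rule nn_integral_Markov_inequality) measurable
    also have "(\<integral>\<^sup>+\<omega>\<in>space M. riesz_energy s (?S n \<omega>) \<partial>M) = (\<integral>\<^sup>+\<omega>. riesz_energy s (?S n \<omega>) \<partial>M)"
      by (intro nn_integral_cong) simp
    also have "ennreal (1 / b * (1 / \<pi> n)\<^sup>2) * \<dots> \<le> ennreal (1 / b * (1 / \<pi> n)\<^sup>2) * (ennreal ((\<pi> n)\<^sup>2) * (ennreal (1 + \<delta>) * ennreal (2 / (1 - (s + \<rho>)))))"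
      by (intro mult_left_mono Een) auto
    also have "\<dots> = ennreal (1 / b * (1 / \<pi> n)\<^sup>2 * ((\<pi> n)\<^sup>2 * ((1 + \<delta>) * (2 / (1 - (s + \<rho>))))))"
      using \<open>0 < b\<close> assms by (simp only: ennreal_mult'[symmetric] zero_le_power2 zero_le_mult_iff)
        (subst ennreal_mult'[symmetric], auto)
    also have "1 / b * (1 / \<pi> n)\<^sup>2 * ((\<pi> n)\<^sup>2 * ((1 + \<delta>) * (2 / (1 - (s + \<rho>))))) = \<epsilon>"
    proof -
      define q where "q = (1 + \<delta>) * (2 / (1 - (s + \<rho>)))"
      have "q > 0" using assms by (simp add: q_def)
      then show ?thesis unfolding b_def q_def[symmetric]
        using pos[of n] by (simp add: field_simps)
    qed
    finally show ?thesis using \<open>0 < \<epsilon>\<close> by (simp add: emeasure_eq_measure ennreal_le_iff)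
  qed
  define G where "G = (\<lambda>n. space M - (B1 n \<union> B2 n))"
  have [measurable]: "G n \<in> events" for n unfolding G_def by measurable
  have Gp: "1 - 8 * \<delta> / (1 - \<rho>) - \<epsilon> \<le> prob (G n)" for n
  proof -
    have "prob (B1 n \<union> B2 n) \<le> prob (B1 n) + prob (B2 n)"
      by (rule measure_Un_le) auto
    then show ?thesis unfolding G_def using B1[of n] B2[of n] by (subst prob_compl) auto
  qed
  have Gd: "ennreal (1/2) \<le> ennreal (1 / \<pi> n) * emeasure lborel (?S n \<omega>)
       \<and> ennreal ((1 / \<pi> n)\<^sup>2) * riesz_energy s (?S n \<omega>) \<le> ennreal b" if "\<omega> \<in> G n" for n \<omega>
  proof
    have "\<not> 1/2 \<le> \<bar>Z n \<omega> - 1\<bar>" using that by (auto simp: G_def B1_def)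
    then have "1/2 \<le> Z n \<omega>" by linarith
    then show "ennreal (1/2) \<le> ennreal (1 / \<pi> n) * emeasure lborel (?S n \<omega>)"
      unfolding ennZ[symmetric] by (rule ennreal_leI)
    define q where "q = ennreal ((1 / \<pi> n)\<^sup>2) * riesz_energy s (?S n \<omega>)"
    have "ennreal (1/b) * q \<le> 1"
      using that by (auto simp: G_def B2_def q_def not_le)
    then have "ennreal b * (ennreal (1/b) * q) \<le> ennreal b * 1"
      by (rule mult_left_mono) simp
    also have "ennreal b * (ennreal (1/b) * q) = q"
      using \<open>0 < b\<close> by (simp add: mult.assoc[symmetric] ennreal_mult'[symmetric])
    finally show "ennreal ((1 / \<pi> n)\<^sup>2) * riesz_energy s (?S n \<omega>) \<le> ennreal b"
      unfolding q_def by simp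
  qed
  show ?thesis
  proof (intro exI[of _ b] conjI bexI[of _ "\<Inter>m. \<Union>n\<in>{m..}. G n"] ballI)
    show "1 - 8 * \<delta> / (1 - \<rho>) - \<epsilon> \<le> prob (\<Inter>m. \<Union>n\<in>{m..}. G n)"
      by (rule prob_limsup_ge) (use Gp in auto)
    fix \<omega> assume "\<omega> \<in> (\<Inter>m. \<Union>n\<in>{m..}. G n)"
    then have "\<exists>\<^sub>\<infinity>n. \<omega> \<in> G n" unfolding INFM_nat_le by auto
    then show "\<exists>\<^sub>\<infinity>n. ennreal (1/2) \<le> ennreal (1 / \<pi> n) * emeasure lborel (?S n \<omega>)
                   \<and> ennreal ((1 / \<pi> n)\<^sup>2) * riesz_energy s (?S n \<omega>) \<le> ennreal b"
      by (rule frequently_mono[rotated]) (use Gd in auto)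
  qed (use \<open>0 < b\<close> in auto)
qed

end

section \<open>Paths of the web\<close>


lemma snd_funpow_arrow_step [simp]: "snd ((arrow_step a ^^ n) z) = snd z + int n"
  by (induction n) (auto simp: arrow_step_def)

lemma funpow_arrow_step_even:
  assumes "\<And>w. w \<in> even_sites \<Longrightarrow> a w \<in> {-1, 1}" "z \<in> even_sites"
  shows "(arrow_step a ^^ n) z \<in> even_sites"
proof (induction n)
  case (Suc n)
  have "arrow_step a w \<in> even_sites" if "w \<in> even_sites" for w
    using assms(1)[OF that] that by (cases w) (auto simp: arrow_step_def even_sites_def)
  then show ?case using Suc by simp
qed (use assms in simp)

text \<open>Agreement is required only along the path of \<open>a\<close>. This locality serves
  twice: for small changes of the dynamical time, and for restricting the web to a time
  strip.\<close>

lemma funpow_arrow_step_cong: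
  assumes "\<And>i. i < n \<Longrightarrow> b ((arrow_step a ^^ i) z) = a ((arrow_step a ^^ i) z)"
  shows "(arrow_step b ^^ n) z = (arrow_step a ^^ n) z"
  using assms by (induction n) (auto simp: arrow_step_def)

text \<open>Non-crossing by parity: distinct even sites at the same time are at least
  \<open>2\<close> apart, so steps of size \<open>1\<close> let them meet but not swap, and once
  they meet they follow the same arrows.\<close>

lemma funpow_arrow_step_mono:
  assumes a: "\<And>w. w \<in> even_sites \<Longrightarrow> a w \<in> {-1, 1}"
    and xy: "x \<in> even_sites" "y \<in> even_sites" "snd x = snd y" "fst x \<le> fst y"
  shows "fst ((arrow_step a ^^ n) x) \<le> fst ((arrow_step a ^^ n) y)"
proof (induction n)
  case (Suc n)
  define u v where "u = (arrow_step a ^^ n) x" and "v = (arrow_step a ^^ n) y"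
  have uv: "u \<in> even_sites" "v \<in> even_sites" "snd u = snd v"
    unfolding u_def v_def using funpow_arrow_step_even[OF a] xy by auto
  have "fst u + a u \<le> fst v + a v"
  proof (cases "fst u = fst v")
    case True
    then have "u = v" using uv by (simp add: prod_eq_iff)
    then show ?thesis by simp
  next
    case False
    moreover have "even (fst v - fst u)"
      using uv by (auto simp: even_sites_def case_prod_beta)
    moreover have "fst u \<le> fst v" using Suc by (simp add: u_def v_def)
    ultimately have "fst u + 2 \<le> fst v" by presburger
    then show ?thesis using a[of u] a[of v] uv by auto
  qed
  then have "fst (arrow_step a u) \<le> fst (arrow_step a v)" by (simp add: arrow_step_def)
  then show ?case by (simp add: u_def v_def)
qed (use xy in simp)

lemma arrow_path_of_int:
  assumes "snd z \<le> T"
  shows "arrow_path a z (of_int T) = of_int (fst ((arrow_step a ^^ nat (T - snd z)) z))"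
proof -
  have "real_of_int T - real_of_int (snd z) = of_int (T - snd z)" by simp
  then show ?thesis unfolding arrow_path_def Let_def by (simp only: frac_of_int floor_of_int mult_zero_left add_0_right)
qed

lemma funpow_arrow_step_sum:
  assumes "\<And>i. i < n \<Longrightarrow> a (fst z + (\<Sum>j<i. e j), snd z + int i) = e i"
  shows "(arrow_step a ^^ n) z = (fst z + (\<Sum>j<n. e j), snd z + int n)"
  using assms by (induction n) (auto simp: arrow_step_def)

text \<open>The limit of the ring times is included so that explosion of the clock need not be excluded.
  If the ring times diverge, then \<open>lim\<close> is some unspecified real, which is harmless.\<close>

definition jump_times :: "(nat \<Rightarrow> real) \<Rightarrow> real set" where
  "jump_times g = insert (lim (\<lambda>n. \<Sum>i\<le>n. g i)) (range (\<lambda>n. \<Sum>i\<le>n. g i))"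

lemma countable_jump_times: "countable (jump_times g)"
  by (simp add: jump_times_def)

text \<open>If some ring time exceeds \<tau>, monotonicity leaves only finitely many comparisons to
  keep unchanged. Otherwise the ring times accumulate at a limit which is at most \<tau>, and
  differs from it because the limit belongs to \<open>jump_times\<close>; then all ring times stay
  below a neighbourhood of \<tau>.\<close>

lemma eventually_ring_set_eq:
  fixes g :: "nat \<Rightarrow> real"
  assumes g: "\<And>i. 0 \<le> g i" and \<tau>: "\<tau> \<notin> jump_times g"
  shows "eventually (\<lambda>\<tau>'. {n. (\<Sum>i\<le>n. g i) \<le> \<tau>'} = {n. (\<Sum>i\<le>n. g i) \<le> \<tau>}) (nhds \<tau>)"
proof -
  define s where "s = (\<lambda>n. \<Sum>i\<le>n. g i)"
  have s: "incseq s" unfolding s_def incseq_def by (auto intro!: sum_mono2 g)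
  have ne: "s n \<noteq> \<tau>" for n using \<tau> by (auto simp: jump_times_def s_def)
  have same: "eventually (\<lambda>\<tau>'. s n \<le> \<tau>' \<longleftrightarrow> s n \<le> \<tau>) (nhds \<tau>)" for n
  proof (cases "s n < \<tau>")
    case True
    then have "eventually (\<lambda>\<tau>'. \<tau>' \<in> {s n<..}) (nhds \<tau>)" by (intro eventually_nhds_in_open) auto
    then show ?thesis by eventually_elim (use True in auto)
  next
    case False
    then have "\<tau> < s n" using ne[of n] by simp
    then have "eventually (\<lambda>\<tau>'. \<tau>' \<in> {..<s n}) (nhds \<tau>)" by (intro eventually_nhds_in_open) auto
    then show ?thesis by eventually_elim (use \<open>\<tau> < s n\<close> in auto)
  qed
  have "eventually (\<lambda>\<tau>'. {n. s n \<le> \<tau>'} = {n. s n \<le> \<tau>}) (nhds \<tau>)"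
  proof (cases "\<exists>N. \<tau> < s N")
    case True
    then obtain N where N: "\<tau> < s N" by auto
    have "eventually (\<lambda>\<tau>'. \<forall>n\<in>{..N}. s n \<le> \<tau>' \<longleftrightarrow> s n \<le> \<tau>) (nhds \<tau>)"
      by (intro eventually_ball_finite) (use same in auto)
    then show ?thesis
    proof eventually_elim
      case (elim \<tau>')
      then have "s N \<le> \<tau>' \<longleftrightarrow> s N \<le> \<tau>" by simp
      then have "\<tau>' < s N" using N by linarith
      have "s n \<le> \<tau>' \<longleftrightarrow> s n \<le> \<tau>" for n
      proof (cases "n \<le> N")
        case False
        then have "s N \<le> s n" using s by (simp add: incseqD)
        then show ?thesis using N \<open>\<tau>' < s N\<close> by auto
      qed (use elim in auto)
      then show ?case by simp
    qed
  next
    case False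
    then have le: "s n \<le> \<tau>" for n by (simp add: not_less)
    then obtain L where L: "s \<longlonglongrightarrow> L" using incseq_convergent[OF s] by blast
    have "s n \<le> L" for n using incseq_le[OF s L] .
    moreover have "L \<le> \<tau>" using L le by (intro LIMSEQ_le_const2[OF L]) auto
    moreover have "L \<noteq> \<tau>" using \<tau> limI[OF L] by (auto simp: jump_times_def s_def)
    ultimately have "L < \<tau>" "\<And>n. s n \<le> L" by auto
    then have "eventually (\<lambda>\<tau>'. \<tau>' \<in> {L<..}) (nhds \<tau>)" by (intro eventually_nhds_in_open) auto
    then show ?thesis
    proof eventually_elim
      case (elim \<tau>')
      then have "s n \<le> \<tau>'" for n using \<open>s n \<le> L\<close> by simp
      then show ?case using le by auto
    qed
  qed
  then show ?thesis by (simp add: s_def)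
qed

text \<open>The path at \<tau> reads finitely many arrows, each locally constant away from its own
  jump times, so a common neighbourhood exists without any uniformity over the sites.\<close>

lemma eventually_path_eq:
  assumes gap: "\<And>w i. w \<in> even_sites \<Longrightarrow> 0 \<le> gap w i \<omega>"
    and mark: "\<And>w i. w \<in> even_sites \<Longrightarrow> mark w i \<omega> \<in> {-1, 1}"
    and z: "z \<in> even_sites"
    and \<tau>: "\<tau> \<notin> (\<Union>w\<in>even_sites. jump_times (\<lambda>i. gap w i \<omega>))"
  shows "eventually (\<lambda>\<tau>'. (arrow_step (\<xi> gap mark \<tau>' \<omega>) ^^ n) z = (arrow_step (\<xi> gap mark \<tau> \<omega>) ^^ n) z) (nhds \<tau>)"
proof -
  have ev: "eventually (\<lambda>\<tau>'. \<xi> gap mark \<tau>' \<omega> w = \<xi> gap mark \<tau> \<omega> w) (nhds \<tau>)" if "w \<in> even_sites" for w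
  proof -
    have "eventually (\<lambda>\<tau>'. {n. (\<Sum>i\<le>n. gap w i \<omega>) \<le> \<tau>'} = {n. (\<Sum>i\<le>n. gap w i \<omega>) \<le> \<tau>}) (nhds \<tau>)"
      by (rule eventually_ring_set_eq) (use gap that \<tau> in auto)
    then show ?thesis by eventually_elim (simp add: \<xi>_def ring_count_def)
  qed
  have even: "(arrow_step (\<xi> gap mark \<tau> \<omega>) ^^ i) z \<in> even_sites" for i
    by (rule funpow_arrow_step_even) (use mark z in \<open>auto simp: \<xi>_def\<close>)
  have "eventually (\<lambda>\<tau>'. \<forall>i\<in>{..<n}. \<xi> gap mark \<tau>' \<omega> ((arrow_step (\<xi> gap mark \<tau> \<omega>) ^^ i) z)
      = \<xi> gap mark \<tau> \<omega> ((arrow_step (\<xi> gap mark \<tau> \<omega>) ^^ i) z)) (nhds \<tau>)"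
    by (intro eventually_ball_finite) (use ev even in auto)
  then show ?thesis by eventually_elim (intro funpow_arrow_step_cong, auto)
qed

lemma closure_subset_exceptional:
  fixes S D :: "'b::topological_space set"
  assumes "\<And>x. x \<notin> D \<Longrightarrow> x \<notin> S \<Longrightarrow> eventually (\<lambda>y. y \<notin> S) (nhds x)"
  shows "closure S \<subseteq> S \<union> D"
proof (rule subsetI, rule ccontr)
  fix x assume x: "x \<in> closure S" "x \<notin> S \<union> D"
  then obtain U where U: "open U" "x \<in> U" "\<And>y. y \<in> U \<Longrightarrow> y \<notin> S"
    using assms[of x] unfolding eventually_nhds by auto
  then have "U \<inter> closure S = {}" by (subst open_Int_closure_eq_empty) auto
  then show False using U x by auto
qed

section \<open>Measurability of path positions\<close>

lemma measurable_count_space_subset: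
  fixes f :: "'a \<Rightarrow> 'b"
  assumes "f \<in> measurable N (count_space UNIV)" "\<And>q. q \<in> space N \<Longrightarrow> f q \<in> Z"
  shows "f \<in> measurable N (count_space Z)"
proof (rule measurableI)
  fix A :: "'b set" show "f -` A \<inter> space N \<in> sets N"
    by (rule measurable_sets[OF assms(1)]) auto
qed (use assms(2) in auto)

lemma sets_forall_less_eq:
  fixes n :: nat and e :: "nat \<Rightarrow> 'b"
  assumes "\<And>i. i < n \<Longrightarrow> f i \<in> measurable N (count_space UNIV)"
  shows "{q \<in> space N. \<forall>i<n. f i q = e i} \<in> sets N"
proof -
  have "Measurable.pred N (\<lambda>q. \<forall>i\<in>{..<n}. f i q = e i)"
  proof (intro pred_intros_finite)
    fix i assume "i \<in> {..<n}"
    then have [measurable]: "f i \<in> measurable N (count_space UNIV)" by (intro assms) simp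
    show "Measurable.pred N (\<lambda>q. f i q = e i)" by measurable
  qed simp
  then show ?thesis unfolding Ball_def lessThan_iff by (rule predE)
qed

lemma measurable_ring_count:
  assumes [measurable]: "\<And>n. gap z n \<in> borel_measurable N" "T \<in> borel_measurable N"
  shows "(\<lambda>q. ring_count gap z (T q) q) \<in> measurable N (count_space UNIV)"
  unfolding ring_count_def by measurable

lemma measurable_xi:
  assumes [measurable]: "\<And>n. gap z n \<in> borel_measurable N" "T \<in> borel_measurable N"
    and "\<And>n. mark z n \<in> measurable N (count_space UNIV)"
  shows "(\<lambda>q. \<xi> gap mark (T q) q z) \<in> measurable N (count_space UNIV)"
  unfolding \<xi>_def
proof (rule measurable_compose_countable'[where I = UNIV and f = "\<lambda>i q. mark z i q" and g = "\<lambda>q. ring_count gap z (T q) q"])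
  show "(\<lambda>q. ring_count gap z (T q) q) \<in> measurable N (count_space UNIV)"
    by (rule measurable_ring_count) (use assms in auto)
qed (use assms in auto)

text \<open>The dynamical time \<open>T\<close> may depend on the sample point: the projection
  \<open>fst\<close> on a product space yields joint measurability, a constant yields the case of a
  fixed time. \<open>Z\<close> confines the path to the sites whose gaps and marks are available,
  either all even sites or a strip.\<close>

lemma measurable_path_position:
  assumes gap: "\<And>w n. w \<in> Z \<Longrightarrow> gap w n \<in> borel_measurable N"
    and T: "T \<in> borel_measurable N"
    and mark: "\<And>w n. w \<in> Z \<Longrightarrow> mark w n \<in> measurable N (count_space UNIV)"
    and Z: "\<And>q i. q \<in> space N \<Longrightarrow> i < n \<Longrightarrow> (arrow_step (\<xi> gap mark (T q) q) ^^ i) z \<in> Z"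
  shows "(\<lambda>q. (arrow_step (\<xi> gap mark (T q) q) ^^ n) z) \<in> measurable N (count_space UNIV)"
  using Z
proof (induction n)
  case (Suc n)
  have "(\<lambda>q. (arrow_step (\<xi> gap mark (T q) q) ^^ n) z) \<in> measurable N (count_space Z)"
    by (rule measurable_count_space_subset[OF Suc.IH]) (use Suc.prems in auto)
  moreover have "(\<lambda>q. arrow_step (\<xi> gap mark (T q) q) w) \<in> measurable N (count_space UNIV)" if "w \<in> Z" for w
  proof -
    have [measurable]: "(\<lambda>q. \<xi> gap mark (T q) q w) \<in> measurable N (count_space UNIV)"
      by (rule measurable_xi) (use gap mark T that in auto)
    show ?thesis unfolding arrow_step_def by measurable
  qed
  ultimately have "(\<lambda>q. arrow_step (\<xi> gap mark (T q) q) ((arrow_step (\<xi> gap mark (T q) q) ^^ n) z))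
      \<in> measurable N (count_space UNIV)"
    by (intro measurable_compose_countable'[where I = Z and f = "\<lambda>w q. arrow_step (\<xi> gap mark (T q) q) w"
          and g = "\<lambda>q. (arrow_step (\<xi> gap mark (T q) q) ^^ n) z"]) auto
  then show ?case by simp
qed simp

section \<open>Law of the arrows\<close>


text \<open>For families indexed by a strip only the arrows inside it are known to be signs; a path
  of at most \<open>n\<close> steps reads no others.\<close>

lemma funpow_arrow_step_even_strip:
  assumes "\<And>w. w \<in> even_sites \<Longrightarrow> snd z \<le> snd w \<Longrightarrow> snd w < snd z + int n \<Longrightarrow> a w \<in> {-1, 1}"
    and "z \<in> even_sites" "i \<le> n"
  shows "(arrow_step a ^^ i) z \<in> even_sites"
  using \<open>i \<le> n\<close>
proof (induction i)
  case (Suc i)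
  define w where "w = (arrow_step a ^^ i) z"
  have w: "w \<in> even_sites" "snd w = snd z + int i" using Suc by (auto simp: w_def)
  then have "a w \<in> {-1, 1}" using Suc.prems by (intro assms) auto
  then have "arrow_step a w \<in> even_sites"
    using w by (cases w) (auto simp: arrow_step_def even_sites_def)
  then show ?case by (simp add: w_def)
qed (use assms in simp)

lemma even_sum_odd:
  fixes e :: "nat \<Rightarrow> int"
  assumes "\<And>j. j < i \<Longrightarrow> odd (e j)"
  shows "even ((\<Sum>j<i. e j) + int i)"
  using assms by (induction i) auto

lemma distr_uniform_sign:
  assumes "c \<in> {-1, 1::int}"
  shows "distr (uniform_count_measure {-1, 1}) (count_space {-1, 1}) ((*) c) = uniform_count_measure {-1, 1}"
proof (rule measure_eqI)
  have c: "(*) c \<in> measurable (uniform_count_measure {-1, 1}) (count_space {-1, 1})"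
    using assms by (intro measurableI) (auto simp: space_uniform_count_measure sets_uniform_count_measure)
  fix A assume "A \<in> sets (distr (uniform_count_measure {-1, 1}) (count_space {-1, 1}) ((*) c))"
  then have A: "A \<subseteq> {-1, 1}" by simp
  have "(*) c -` A \<inter> {-1, 1} = (*) c ` A" using A assms by (auto simp: image_iff)
  moreover have "card ((*) c ` A) = card A" using assms by (intro card_image) (auto simp: inj_on_def)
  moreover have "(*) c ` A \<subseteq> {-1, 1}" using A assms by auto
  ultimately show "emeasure (distr (uniform_count_measure {-1, 1}) (count_space {-1, 1}) ((*) c)) A
      = emeasure (uniform_count_measure {-1, 1}) A"
    using A by (subst emeasure_distr[OF c])
      (auto simp: space_uniform_count_measure emeasure_uniform_count_measure)
qed (simp add: sets_uniform_count_measure)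

context dynamical_discrete_web
begin

abbreviation site_space :: "(real \<times> int) measure" where
  "site_space \<equiv> borel \<Otimes>\<^sub>M count_space {-1, 1}"

abbreviation gap_mark :: "site \<times> nat \<Rightarrow> 'a \<Rightarrow> real \<times> int" where
  "gap_mark \<equiv> (\<lambda>(z, n) \<omega>. (gap z n \<omega>, mark z n \<omega>))"

abbreviation arrow :: "real \<Rightarrow> 'a \<Rightarrow> site \<Rightarrow> int" where
  "arrow \<equiv> \<xi> gap mark"

definition path_end :: "site \<Rightarrow> nat \<Rightarrow> real \<Rightarrow> 'a \<Rightarrow> int" where
  "path_end z N \<tau> \<omega> = fst ((arrow_step (arrow \<tau> \<omega>) ^^ N) z)"

lemma measurable_gap_mark:
  assumes "z \<in> even_sites"
  shows "(\<lambda>\<omega>. (gap z n \<omega>, mark z n \<omega>)) \<in> measurable M site_space"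
  using indep_gap_mark assms unfolding indep_vars_def by auto

lemma measurable_gap: "z \<in> even_sites \<Longrightarrow> gap z n \<in> borel_measurable M"
  using measurable_compose[OF measurable_gap_mark measurable_fst] by simp

lemma measurable_mark': "z \<in> even_sites \<Longrightarrow> mark z n \<in> measurable M (count_space {-1, 1})"
  using measurable_compose[OF measurable_gap_mark measurable_snd] by simp

lemma measurable_mark: "z \<in> even_sites \<Longrightarrow> mark z n \<in> measurable M (count_space UNIV)"
  using measurable_compose[OF measurable_mark', of z "\<lambda>x. x"] by simp

lemma mark_sign: "z \<in> even_sites \<Longrightarrow> \<omega> \<in> space M \<Longrightarrow> mark z n \<omega> \<in> {-1, 1}"
  using measurable_space[OF measurable_mark', of z \<omega> n] by simp

lemma xi_sign: "z \<in> even_sites \<Longrightarrow> \<omega> \<in> space M \<Longrightarrow> arrow \<tau> \<omega> z \<in> {-1, 1}"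
  unfolding \<xi>_def by (rule mark_sign)

lemma AE_gap_nonneg: "AE \<omega> in M. \<forall>z\<in>even_sites. \<forall>n. 0 \<le> gap z n \<omega>"
proof -
  have "AE \<omega> in M. 0 \<le> gap z n \<omega>" if z: "z \<in> even_sites" for z n
  proof (rule AE_I)
    note [measurable] = measurable_gap[OF z]
    interpret U: prob_space "uniform_count_measure {-1, 1::int}"
      by (rule prob_space_uniform_count_measure) auto
    have "emeasure M {\<omega> \<in> space M. gap z n \<omega> < 0}
        = emeasure (distr M site_space (\<lambda>\<omega>. (gap z n \<omega>, mark z n \<omega>))) ({..<0} \<times> {-1, 1})"
      using measurable_gap_mark[OF z] mark_sign[OF z]
      by (subst emeasure_distr) (auto intro!: arg_cong[where f = "emeasure M"])
    also have "\<dots> = emeasure (density lborel (\<lambda>x. ennreal (exponential_density 1 x))) {..<0}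
        * emeasure (uniform_count_measure {-1, 1::int}) {-1, 1}"
      unfolding distr_gap_mark[OF z]
      by (rule U.emeasure_pair_measure_Times) (auto simp: sets_uniform_count_measure)
    also have "emeasure (density lborel (\<lambda>x. ennreal (exponential_density 1 x))) {..<0::real}
        = (\<integral>\<^sup>+x\<in>{..<0}. ennreal (exponential_density 1 x) \<partial>lborel)"
      by (rule emeasure_density) auto
    also have "\<dots> = (\<integral>\<^sup>+(x::real). 0 \<partial>lborel)"
      by (intro nn_integral_cong) (auto simp: exponential_density_def indicator_def)
    finally show "emeasure M {\<omega> \<in> space M. gap z n \<omega> < 0} = 0" by simp
    show "{\<omega> \<in> space M. gap z n \<omega> < 0} \<in> events" by measurable
  qed auto
  then show ?thesis
    by (subst AE_ball_countable) (auto simp: AE_all_countable)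
qed

text \<open>The mark seen at a site has a random index. Its uniformity is derived from the invariance of
  the law under sign flips, which leave the ring counts unchanged.\<close>

lemma prob_flip_marks:
  fixes \<sigma> :: "site \<Rightarrow> int"
  assumes \<sigma>: "\<And>z. \<sigma> z \<in> {-1, 1}" and B: "B \<in> sets (PiM (even_sites \<times> UNIV) (\<lambda>_. site_space))"
  shows "prob {\<omega> \<in> space M. (\<lambda>i\<in>even_sites \<times> UNIV. gap_mark i \<omega>) \<in> B}
    = prob {\<omega> \<in> space M. (\<lambda>(z, n)\<in>even_sites \<times> UNIV. (gap z n \<omega>, \<sigma> z * mark z n \<omega>)) \<in> B}"
proof -
  define I where "I = even_sites \<times> (UNIV :: nat set)"
  have "(0, 0) \<in> even_sites" by (simp add: even_sites_def)
  then have "I \<noteq> {}" by (auto simp: I_def)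
  define F :: "site \<times> nat \<Rightarrow> real \<times> int \<Rightarrow> real \<times> int" where "F = (\<lambda>i (x, y). (x, \<sigma> (fst i) * y))"
  have times: "(*) c \<in> measurable (count_space {-1, 1}) (count_space {-1, 1})" if "c \<in> {-1, 1::int}" for c
    using that by (intro measurableI) auto
  have F: "F i \<in> measurable site_space site_space" for i
    using measurable_Pair[OF measurable_fst measurable_compose[OF measurable_snd times[OF \<sigma>[of "fst i"]]]]
    by (simp add: F_def split_beta')
  have X: "indep_vars (\<lambda>_. site_space) gap_mark I" using indep_gap_mark by (simp add: I_def)
  have X': "indep_vars (\<lambda>_. site_space) (\<lambda>i \<omega>. F i (gap_mark i \<omega>)) I"
    by (rule indep_vars_compose2[OF X]) (rule F)
  have rv: "random_variable site_space (gap_mark i)" if "i \<in> I" for i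
    using that measurable_gap_mark[of "fst i" "snd i"] by (simp add: I_def split_beta mem_Times_iff)
  have law: "distr M site_space (\<lambda>\<omega>. F i (gap_mark i \<omega>)) = distr M site_space (gap_mark i)" if i: "i \<in> I" for i
  proof -
    obtain z n where zn: "i = (z, n)" "z \<in> even_sites" using i by (auto simp: I_def)
    define E where "E = density lborel (\<lambda>x. ennreal (exponential_density 1 x))"
    define U where "U = uniform_count_measure {-1, 1::int}"
    interpret U: prob_space U unfolding U_def by (rule prob_space_uniform_count_measure) auto
    have sets: "sets E = sets borel" "sets U = sets (count_space {-1, 1})"
      by (auto simp: E_def U_def sets_uniform_count_measure)
    have lw: "distr M site_space (gap_mark i) = E \<Otimes>\<^sub>M U"
      using distr_gap_mark[OF zn(2), of n] zn(1) by (simp add: E_def U_def)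
    have EE: "distr E borel (\<lambda>x. x) = E" by (rule distr_id2) (simp add: sets)
    have UU: "distr U (count_space {-1, 1}) ((*) (\<sigma> z)) = U"
      unfolding U_def by (rule distr_uniform_sign) (rule \<sigma>)
    have "distr M site_space (\<lambda>\<omega>. F i (gap_mark i \<omega>)) = distr (distr M site_space (gap_mark i)) site_space (F i)"
      using distr_distr[OF F rv[OF i], of i] by (simp add: comp_def)
    also have "\<dots> = distr (E \<Otimes>\<^sub>M U) site_space (\<lambda>(x, y). (x, \<sigma> z * y))"
      unfolding lw by (simp add: F_def zn)
    also have "\<dots> = distr E borel (\<lambda>x. x) \<Otimes>\<^sub>M distr U (count_space {-1, 1}) ((*) (\<sigma> z))"
    proof (rule pair_measure_distr[symmetric])
      show "(\<lambda>x. x) \<in> borel_measurable E" unfolding measurable_cong_sets[OF sets(1) refl] by simp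
      show "(*) (\<sigma> z) \<in> measurable U (count_space {-1, 1})"
        unfolding measurable_cong_sets[OF sets(2) refl] by (rule times) (rule \<sigma>)
      show "sigma_finite_measure (distr U (count_space {-1, 1}) ((*) (\<sigma> z)))"
        unfolding UU by unfold_locales
    qed
    also have "\<dots> = distr M site_space (gap_mark i)" unfolding EE UU lw ..
    finally show ?thesis .
  qed
  \<comment> \<open>Independence turns both joint laws into products of marginals, and flipping
    signs preserves independence as well as each marginal.\<close>
  have d1: "distr M (PiM I (\<lambda>_. site_space)) (\<lambda>\<omega>. \<lambda>i\<in>I. gap_mark i \<omega>) = PiM I (\<lambda>i. distr M site_space (gap_mark i))"
    using indep_vars_iff_distr_eq_PiM'[OF \<open>I \<noteq> {}\<close>, where M' = "\<lambda>_. site_space" and X = gap_mark, OF rv] X by simp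
  have d2: "distr M (PiM I (\<lambda>_. site_space)) (\<lambda>\<omega>. \<lambda>i\<in>I. F i (gap_mark i \<omega>)) = PiM I (\<lambda>i. distr M site_space (\<lambda>\<omega>. F i (gap_mark i \<omega>)))"
    using indep_vars_iff_distr_eq_PiM'[OF \<open>I \<noteq> {}\<close>, where M' = "\<lambda>_. site_space" and X = "\<lambda>i \<omega>. F i (gap_mark i \<omega>)",
      OF measurable_compose[OF rv F]] X' by simp
  have eq: "distr M (PiM I (\<lambda>_. site_space)) (\<lambda>\<omega>. \<lambda>i\<in>I. gap_mark i \<omega>)
      = distr M (PiM I (\<lambda>_. site_space)) (\<lambda>\<omega>. \<lambda>i\<in>I. F i (gap_mark i \<omega>))"
    unfolding d1 d2 by (intro PiM_cong refl law[symmetric])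
  have m1: "(\<lambda>\<omega>. \<lambda>i\<in>I. gap_mark i \<omega>) \<in> measurable M (PiM I (\<lambda>_. site_space))"
    by (intro measurable_restrict rv)
  have m2: "(\<lambda>\<omega>. \<lambda>i\<in>I. F i (gap_mark i \<omega>)) \<in> measurable M (PiM I (\<lambda>_. site_space))"
    by (intro measurable_restrict measurable_compose[OF rv F])
  have B': "B \<in> sets (PiM I (\<lambda>_. site_space))" using B by (simp add: I_def)
  have "measure (distr M (PiM I (\<lambda>_. site_space)) (\<lambda>\<omega>. \<lambda>i\<in>I. gap_mark i \<omega>)) B
    = measure (distr M (PiM I (\<lambda>_. site_space)) (\<lambda>\<omega>. \<lambda>i\<in>I. F i (gap_mark i \<omega>))) B"
    unfolding eq ..
  then have "prob ((\<lambda>\<omega>. \<lambda>i\<in>I. gap_mark i \<omega>) -` B \<inter> space M) = prob ((\<lambda>\<omega>. \<lambda>i\<in>I. F i (gap_mark i \<omega>)) -` B \<inter> space M)"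
    by (simp add: measure_distr[OF m1 B'] measure_distr[OF m2 B'])
  moreover have "(\<lambda>(z, n)\<in>I. (gap z n \<omega>, \<sigma> z * mark z n \<omega>)) = (\<lambda>i\<in>I. F i (gap_mark i \<omega>))" for \<omega>
    by (rule restrict_ext) (simp add: F_def split: prod.split)
  moreover have "{\<omega> \<in> space M. f \<omega> \<in> B} = f -` B \<inter> space M" for f
    by blast
  ultimately show ?thesis unfolding I_def[symmetric] by (simp only:)
qed

text \<open>Feeding the coordinates of a product space to the same \<open>\<xi>\<close> expresses
  events about arrows as preimages of measurable sets of families, which is the form in which laws
  and independence are available.\<close>

abbreviation coord_gap :: "site \<Rightarrow> nat \<Rightarrow> (site \<times> nat \<Rightarrow> real \<times> int) \<Rightarrow> real" where
  "coord_gap z n y \<equiv> fst (y (z, n))"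

abbreviation coord_mark :: "site \<Rightarrow> nat \<Rightarrow> (site \<times> nat \<Rightarrow> real \<times> int) \<Rightarrow> int" where
  "coord_mark z n y \<equiv> snd (y (z, n))"

abbreviation coord_arrow :: "real \<Rightarrow> (site \<times> nat \<Rightarrow> real \<times> int) \<Rightarrow> site \<Rightarrow> int" where
  "coord_arrow \<equiv> \<xi> coord_gap coord_mark"

lemma measurable_coord:
  assumes "z \<in> Z"
  shows "coord_gap z n \<in> borel_measurable (PiM (Z \<times> UNIV) (\<lambda>_. site_space))"
    and "coord_mark z n \<in> measurable (PiM (Z \<times> UNIV) (\<lambda>_. site_space)) (count_space UNIV)"
proof -
  have 1: "(\<lambda>y. y (z, n)) \<in> measurable (PiM (Z \<times> UNIV) (\<lambda>_. site_space)) site_space"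
    using assms by (intro measurable_component_singleton) auto
  show "coord_gap z n \<in> borel_measurable (PiM (Z \<times> UNIV) (\<lambda>_. site_space))"
    by (rule measurable_compose[OF 1 measurable_fst])
  have "coord_mark z n \<in> measurable (PiM (Z \<times> UNIV) (\<lambda>_. site_space)) (count_space {-1, 1})"
    by (rule measurable_compose[OF 1 measurable_snd])
  from measurable_compose[OF this, of "\<lambda>x. x" "count_space UNIV"]
  show "coord_mark z n \<in> measurable (PiM (Z \<times> UNIV) (\<lambda>_. site_space)) (count_space UNIV)" by simp
qed

lemma xi_coord:
  assumes "z \<in> Z"
  shows "coord_arrow \<tau> (\<lambda>i\<in>Z \<times> UNIV. gap_mark i \<omega>) z = arrow \<tau> \<omega> z"
  using assms by (simp add: \<xi>_def ring_count_def)

lemma xi_coord_flip: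
  assumes "z \<in> Z"
  shows "coord_arrow \<tau> (\<lambda>(z, n)\<in>Z \<times> UNIV. (gap z n \<omega>, \<sigma> z * mark z n \<omega>)) z = \<sigma> z * arrow \<tau> \<omega> z"
  using assms by (simp add: \<xi>_def ring_count_def)

lemma measurable_xi_web: "z \<in> even_sites \<Longrightarrow> (\<lambda>\<omega>. arrow \<tau> \<omega> z) \<in> measurable M (count_space UNIV)"
  by (rule measurable_xi[where T = "\<lambda>_. \<tau>"]) (auto intro: measurable_gap measurable_mark)

text \<open>Flipping all marks at the last site preserves the law, reverses the last arrow and, by
  injectivity of \<open>w\<close>, leaves the earlier arrows alone. So each sign of the last arrow
  takes half of the probability of the earlier pattern.\<close>

lemma prob_xi_eq:
  assumes "\<And>i. i < n \<Longrightarrow> w i \<in> even_sites" "inj_on w {..<n}" "\<And>i. i < n \<Longrightarrow> e i \<in> {-1, 1}"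
  shows "prob {\<omega> \<in> space M. \<forall>i<n. arrow \<tau> \<omega> (w i) = e i} = (1/2) ^ n"
  using assms
proof (induction n)
  case 0
  then show ?case by (simp add: prob_space)
next
  case (Suc n)
  have IH: "prob {\<omega> \<in> space M. \<forall>i<n. arrow \<tau> \<omega> (w i) = e i} = (1/2) ^ n"
    using Suc by (intro Suc.IH) (auto simp: inj_on_def)
  define Ev where "Ev = (\<lambda>c. {\<omega> \<in> space M. (\<forall>i<n. arrow \<tau> \<omega> (w i) = e i) \<and> arrow \<tau> \<omega> (w n) = c})"
  have meas: "(\<lambda>\<omega>. arrow \<tau> \<omega> (w i)) \<in> measurable M (count_space UNIV)" if "i < Suc n" for i
    using Suc.prems(1)[OF that] by (rule measurable_xi_web)
  have Ev_meas [measurable]: "Ev c \<in> events" for c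
  proof -
    have [measurable]: "(\<lambda>\<omega>. arrow \<tau> \<omega> (w n)) \<in> measurable M (count_space UNIV)"
      by (rule meas) simp
    then have "{\<omega> \<in> space M. arrow \<tau> \<omega> (w n) = c} \<in> events" by measurable
    then show ?thesis
      unfolding Ev_def by (intro sets.sets_Collect_conj sets_forall_less_eq) (simp_all add: meas)
  qed
  have flip: "prob (Ev 1) = prob (Ev (-1))"
  proof -
    define \<sigma> where "\<sigma> = (\<lambda>z. if z = w n then -1 else (1::int))"
    define Pm where "Pm = PiM (even_sites \<times> (UNIV::nat set)) (\<lambda>_. site_space)"
    define B where "B = {y \<in> space Pm. (\<forall>i<n. coord_arrow \<tau> y (w i) = e i) \<and> coord_arrow \<tau> y (w n) = 1}"
    have m: "(\<lambda>y. coord_arrow \<tau> y (w i)) \<in> measurable Pm (count_space UNIV)" if "i < Suc n" for i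
      unfolding Pm_def
      by (rule measurable_xi[where T = "\<lambda>_. \<tau>"])
         (use Suc.prems(1)[OF that] in \<open>auto intro: measurable_coord\<close>)
    have "B \<in> sets Pm"
    proof -
      have [measurable]: "(\<lambda>y. coord_arrow \<tau> y (w n)) \<in> measurable Pm (count_space UNIV)"
        by (rule m) simp
      then have "{y \<in> space Pm. coord_arrow \<tau> y (w n) = 1} \<in> sets Pm" by measurable
      then show ?thesis
        unfolding B_def by (intro sets.sets_Collect_conj sets_forall_less_eq) (simp_all add: m)
    qed
    then have "prob {\<omega> \<in> space M. (\<lambda>i\<in>even_sites \<times> UNIV. gap_mark i \<omega>) \<in> B}
      = prob {\<omega> \<in> space M. (\<lambda>(z, n)\<in>even_sites \<times> UNIV. (gap z n \<omega>, \<sigma> z * mark z n \<omega>)) \<in> B}"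
      unfolding Pm_def by (intro prob_flip_marks) (auto simp: \<sigma>_def)
    moreover have "{\<omega> \<in> space M. (\<lambda>i\<in>even_sites \<times> UNIV. gap_mark i \<omega>) \<in> B} = Ev 1"
    proof -
      have "(\<lambda>i\<in>even_sites \<times> UNIV. gap_mark i \<omega>) \<in> B \<longleftrightarrow>
          (\<forall>i<n. arrow \<tau> \<omega> (w i) = e i) \<and> arrow \<tau> \<omega> (w n) = 1" if "\<omega> \<in> space M" for \<omega>
      proof -
        have "(\<lambda>i\<in>even_sites \<times> UNIV. gap_mark i \<omega>) \<in> space Pm"
          unfolding Pm_def using measurable_gap_mark that
          by (intro measurable_space[OF measurable_restrict]) auto
        moreover have "coord_arrow \<tau> (\<lambda>i\<in>even_sites \<times> UNIV. gap_mark i \<omega>) (w i)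
            = arrow \<tau> \<omega> (w i)" if "i < Suc n" for i
          using Suc.prems(1)[OF that] by (rule xi_coord)
        ultimately show ?thesis unfolding B_def by (simp add: Ball_def)
      qed
      then show ?thesis unfolding Ev_def by (intro Collect_cong conj_cong refl)
    qed
    moreover have "{\<omega> \<in> space M. (\<lambda>(z, n)\<in>even_sites \<times> UNIV. (gap z n \<omega>, \<sigma> z * mark z n \<omega>)) \<in> B} = Ev (-1)"
    proof -
      have "(\<lambda>(z, n)\<in>even_sites \<times> UNIV. (gap z n \<omega>, \<sigma> z * mark z n \<omega>)) \<in> B \<longleftrightarrow>
          (\<forall>i<n. arrow \<tau> \<omega> (w i) = e i) \<and> arrow \<tau> \<omega> (w n) = -1" if "\<omega> \<in> space M" for \<omega>
      proof -
        have "(\<lambda>(z, n)\<in>even_sites \<times> UNIV. (gap z n \<omega>, \<sigma> z * mark z n \<omega>)) \<in> space Pm"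
          unfolding Pm_def space_PiM
        proof (rule restrict_PiE_iff[THEN iffD2], rule ballI)
          fix i assume "i \<in> even_sites \<times> (UNIV :: nat set)"
          then obtain z n where i: "i = (z, n)" "z \<in> even_sites" by auto
          show "(case i of (z, n) \<Rightarrow> (gap z n \<omega>, \<sigma> z * mark z n \<omega>)) \<in> space site_space"
            using mark_sign[OF i(2) that, of n] by (auto simp: i(1) space_pair_measure \<sigma>_def)
        qed
        moreover have "coord_arrow \<tau> (\<lambda>(z, n)\<in>even_sites \<times> UNIV. (gap z n \<omega>, \<sigma> z * mark z n \<omega>)) (w i)
            = \<sigma> (w i) * arrow \<tau> \<omega> (w i)" if "i < Suc n" for i
          using Suc.prems(1)[OF that] by (rule xi_coord_flip)
        moreover have "\<sigma> (w i) = 1" if "i < n" for i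
          using inj_onD[OF Suc.prems(2), of i n] that by (auto simp: \<sigma>_def)
        moreover have "\<sigma> (w n) = -1" by (simp add: \<sigma>_def)
        moreover have "- c = 1 \<longleftrightarrow> c = -1" for c :: int by auto
        ultimately show ?thesis unfolding B_def by (simp add: Ball_def)
      qed
      then show ?thesis unfolding Ev_def by (intro Collect_cong conj_cong refl)
    qed
    ultimately show ?thesis by simp
  qed
  have "arrow \<tau> \<omega> (w n) = 1 \<or> arrow \<tau> \<omega> (w n) = -1" if "\<omega> \<in> space M" for \<omega>
    using xi_sign[OF Suc.prems(1)[of n] that, of \<tau>] by simp linarith
  then have split: "{\<omega> \<in> space M. \<forall>i<n. arrow \<tau> \<omega> (w i) = e i} = Ev 1 \<union> Ev (-1)"
    unfolding Ev_def by blast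
  have "prob (Ev 1 \<union> Ev (-1)) = prob (Ev 1) + prob (Ev (-1))"
    by (rule finite_measure_Union[OF Ev_meas Ev_meas]) (simp add: Ev_def disjoint_iff)
  then have half: "prob (Ev c) = (1/2) ^ Suc n" if "c \<in> {-1, 1}" for c
    using that flip IH unfolding split by auto
  have "{\<omega> \<in> space M. \<forall>i<Suc n. arrow \<tau> \<omega> (w i) = e i} = Ev (e n)"
    unfolding Ev_def less_Suc_eq by blast
  then show ?case using half[OF Suc.prems(3)[of n]] by simp
qed

end

section \<open>Law and independence of the paths\<close>


context dynamical_discrete_web
begin

lemma path_in_strip:
  assumes "z \<in> even_sites" "\<omega> \<in> space M" "i < N"
  shows "(arrow_step (arrow \<tau> \<omega>) ^^ i) z \<in> {w \<in> even_sites. snd z \<le> snd w \<and> snd w < snd z + int N}"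
proof -
  have "(arrow_step (arrow \<tau> \<omega>) ^^ i) z \<in> even_sites"
    by (intro funpow_arrow_step_even xi_sign assms)
  then show ?thesis using \<open>i < N\<close> by simp
qed

lemma path_end_joint_measurable:
  assumes "z \<in> even_sites"
  shows "{p \<in> space (borel \<Otimes>\<^sub>M M). c < path_end z N (fst p) (snd p)} \<in> sets (borel \<Otimes>\<^sub>M M)"
proof -
  \<comment> \<open>Gaps and marks are lifted to the product space so that the dynamical time
    becomes the measurable function \<open>fst\<close> of the sample point.\<close>
  have eq: "\<xi> (\<lambda>z n p. gap z n (snd p)) (\<lambda>z n p. mark z n (snd p)) (fst p) p = arrow (fst p) (snd p)" for p :: "real \<times> 'a"
    by (simp add: fun_eq_iff \<xi>_def ring_count_def)
  have "(\<lambda>p. (arrow_step (\<xi> (\<lambda>z n p. gap z n (snd p)) (\<lambda>z n p. mark z n (snd p)) (fst p) p) ^^ N) z)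
      \<in> measurable (borel \<Otimes>\<^sub>M M) (count_space UNIV)"
  proof (rule measurable_path_position)
    show "(arrow_step (\<xi> (\<lambda>z n p. gap z n (snd p)) (\<lambda>z n p. mark z n (snd p)) (fst p) p) ^^ i) z \<in> even_sites"
      if "p \<in> space (borel \<Otimes>\<^sub>M M)" for p i
      unfolding eq using that assms
      by (intro funpow_arrow_step_even xi_sign) (auto simp: space_pair_measure)
  qed (auto intro: measurable_compose[OF measurable_snd] measurable_gap measurable_mark)
  from measurable_compose[OF this, of fst "count_space UNIV"]
  have [measurable]: "(\<lambda>p. fst ((arrow_step (arrow (fst p) (snd p)) ^^ N) z)) \<in> measurable (borel \<Otimes>\<^sub>M M) (count_space UNIV)"
    unfolding eq by simp
  show ?thesis unfolding path_end_def by measurable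
qed

lemma path_end_measurable:
  assumes "z \<in> even_sites"
  shows "{\<omega> \<in> space M. c < path_end z N \<tau> \<omega>} \<in> events"
proof -
  have "(\<lambda>\<omega>. (arrow_step (arrow \<tau> \<omega>) ^^ N) z) \<in> measurable M (count_space UNIV)"
  proof (rule measurable_path_position[where T = "\<lambda>_. \<tau>"])
    show "(arrow_step (arrow \<tau> \<omega>) ^^ i) z \<in> even_sites" if "\<omega> \<in> space M" for \<omega> i
      using that assms by (intro funpow_arrow_step_even xi_sign) auto
  qed (auto intro: measurable_gap measurable_mark)
  from measurable_compose[OF this, of fst "count_space UNIV"]
  have [measurable]: "(\<lambda>\<omega>. fst ((arrow_step (arrow \<tau> \<omega>) ^^ N) z)) \<in> measurable M (count_space UNIV)"
    by simp
  show ?thesis unfolding path_end_def by measurable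
qed

text \<open>A prescribed sequence of increments fixes the sites visited, which are distinct because
  time increases, so each sequence has probability \<open>(1/2) ^ N\<close>. The right-hand side
  does not involve \<tau>, which also supplies stationarity in dynamical time.\<close>

lemma prob_path_end:
  assumes z: "z \<in> even_sites"
  shows "prob {\<omega> \<in> space M. c < path_end z N \<tau> \<omega>}
    = real (card {e \<in> PiE {..<N} (\<lambda>_. {-1, 1::int}). c < fst z + (\<Sum>i<N. e i)}) / 2 ^ N"
proof -
  define S where "S = PiE {..<N} (\<lambda>_. {-1, 1::int})"
  define G where "G = {e \<in> S. c < fst z + (\<Sum>i<N. e i)}"
  define w where "w = (\<lambda>e i. (fst z + (\<Sum>j<i. e j), snd z + int i))"
  define W where "W = (\<lambda>e. {\<omega> \<in> space M. \<forall>i<N. arrow \<tau> \<omega> (w e i) = e i})"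
  have "finite S" unfolding S_def by (intro finite_PiE) auto
  then have "finite G" by (simp add: G_def)
  have sign: "e i \<in> {-1, 1}" if "e \<in> S" "i < N" for e i
    using that by (auto simp: S_def PiE_iff)
  have w_even: "w e i \<in> even_sites" if "e \<in> S" "i < N" for e i
  proof -
    have "odd (e j)" if "j < i" for j
      using sign[OF \<open>e \<in> S\<close>, of j] that \<open>i < N\<close> by auto
    then have "even ((\<Sum>j<i. e j) + int i)" by (rule even_sum_odd)
    moreover have "even (fst z + snd z)" using z by (simp add: even_sites_def case_prod_beta)
    moreover have "fst (w e i) + snd (w e i) = (fst z + snd z) + ((\<Sum>j<i. e j) + int i)"
      by (simp add: w_def)
    ultimately have "even (fst (w e i) + snd (w e i))" by presburger
    then show ?thesis by (simp add: even_sites_def case_prod_beta)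
  qed
  have path: "(arrow_step (arrow \<tau> \<omega>) ^^ i) z = w e i" if "\<omega> \<in> W e" "i \<le> N" for e i \<omega>
    unfolding w_def by (rule funpow_arrow_step_sum) (use that in \<open>auto simp: W_def w_def\<close>)
  have W_meas: "W e \<in> events" if "e \<in> S" for e
    unfolding W_def by (intro sets_forall_less_eq measurable_xi_web w_even[OF that])
  have disj: "disjoint_family_on W S"
    unfolding disjoint_family_on_def
  proof (intro ballI impI)
    fix e e' assume e: "e \<in> S" "e' \<in> S" "e \<noteq> e'"
    show "W e \<inter> W e' = {}"
    proof (rule ccontr)
      assume "W e \<inter> W e' \<noteq> {}"
      then obtain \<omega> where \<omega>: "\<omega> \<in> W e" "\<omega> \<in> W e'" by auto
      have "e i = e' i" if "i < N" for i
      proof -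
        have "w e i = w e' i"
          using path[OF \<omega>(1), of i] path[OF \<omega>(2), of i] that by simp
        moreover have "arrow \<tau> \<omega> (w e i) = e i" "arrow \<tau> \<omega> (w e' i) = e' i"
          using \<omega> that by (auto simp: W_def)
        ultimately show ?thesis by simp
      qed
      then have "e = e'" using e unfolding S_def by (intro PiE_ext[of e _ _ e']) auto
      then show False using e by simp
    qed
  qed
  have cover: "\<exists>e\<in>S. \<omega> \<in> W e" if \<omega>: "\<omega> \<in> space M" for \<omega>
  proof -
    define e where "e = (\<lambda>i\<in>{..<N}. arrow \<tau> \<omega> ((arrow_step (arrow \<tau> \<omega>) ^^ i) z))"
    have "e \<in> S" unfolding S_def e_def
    proof (rule restrict_PiE_iff[THEN iffD2], rule ballI)
      fix i
      show "arrow \<tau> \<omega> ((arrow_step (arrow \<tau> \<omega>) ^^ i) z) \<in> {-1, 1}"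
        by (intro xi_sign funpow_arrow_step_even \<omega> z)
    qed
    have p: "(arrow_step (arrow \<tau> \<omega>) ^^ i) z = w e i" if "i \<le> N" for i
      using that
    proof (induction i)
      case (Suc i)
      then have IH: "(arrow_step (arrow \<tau> \<omega>) ^^ i) z = w e i" by simp
      have "e i = arrow \<tau> \<omega> ((arrow_step (arrow \<tau> \<omega>) ^^ i) z)"
        using Suc.prems by (simp add: e_def)
      then have "arrow \<tau> \<omega> (w e i) = e i" unfolding IH by simp
      then have "arrow_step (arrow \<tau> \<omega>) (w e i) = w e (Suc i)"
        by (simp add: arrow_step_def) (simp add: w_def)
      then show ?case using IH by simp
    qed (simp add: w_def)
    have "arrow \<tau> \<omega> (w e i) = e i" if "i < N" for i
      using p[of i] that by (simp add: e_def)
    then have "\<omega> \<in> W e" using \<omega> by (simp add: W_def)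
    then show ?thesis using \<open>e \<in> S\<close> by auto
  qed
  have "{\<omega> \<in> space M. c < path_end z N \<tau> \<omega>} = (\<Union>e\<in>G. W e)"
  proof (intro equalityI subsetI)
    fix \<omega> assume \<omega>: "\<omega> \<in> {\<omega> \<in> space M. c < path_end z N \<tau> \<omega>}"
    then obtain e where e: "e \<in> S" "\<omega> \<in> W e" using cover by auto
    then have "e \<in> G" using \<omega> path[OF e(2), of N] by (simp add: G_def path_end_def w_def)
    then show "\<omega> \<in> (\<Union>e\<in>G. W e)" using e by auto
  next
    fix \<omega> assume "\<omega> \<in> (\<Union>e\<in>G. W e)"
    then obtain e where e: "e \<in> G" "\<omega> \<in> W e" by auto
    then have "\<omega> \<in> space M" by (simp add: W_def)
    then show "\<omega> \<in> {\<omega> \<in> space M. c < path_end z N \<tau> \<omega>}"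
      using e path[OF e(2), of N] by (simp add: G_def path_end_def w_def)
  qed
  then have "prob {\<omega> \<in> space M. c < path_end z N \<tau> \<omega>} = prob (\<Union>e\<in>G. W e)" by simp
  also have "\<dots> = (\<Sum>e\<in>G. prob (W e))"
    by (rule finite_measure_finite_Union[OF \<open>finite G\<close>])
       (use W_meas disj in \<open>auto simp: G_def disjoint_family_on_def\<close>)
  also have "\<dots> = (\<Sum>e\<in>G. (1/2) ^ N)"
  proof (rule sum.cong[OF refl])
    fix e assume "e \<in> G"
    then have "e \<in> S" by (simp add: G_def)
    show "prob (W e) = (1/2) ^ N"
      unfolding W_def
      by (rule prob_xi_eq) (use w_even[OF \<open>e \<in> S\<close>] sign[OF \<open>e \<in> S\<close>] in \<open>auto simp: inj_on_def w_def\<close>)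
  qed
  finally show ?thesis by (simp add: G_def S_def power_divide)
qed

text \<open>A path reads gaps and marks only at sites in its own time strip, so disjoint strips use
  disjoint blocks of the independent family. Two dynamical times are treated together for the second
  moment; \<open>\<tau> = \<tau>'\<close> gives the first.\<close>

lemma prob_strips:
  fixes L :: "nat set" and z :: "nat \<Rightarrow> site" and N :: "nat \<Rightarrow> nat" and c :: "nat \<Rightarrow> int"
  assumes L: "finite L" and z: "\<And>k. k \<in> L \<Longrightarrow> z k \<in> even_sites"
    and disj: "disjoint_family_on (\<lambda>k. {snd (z k)..<snd (z k) + int (N k)}) L"
  shows "prob {\<omega> \<in> space M. \<forall>k\<in>L. c k < path_end (z k) (N k) \<tau> \<omega> \<and> c k < path_end (z k) (N k) \<tau>' \<omega>}
    = (\<Prod>k\<in>L. prob {\<omega> \<in> space M. c k < path_end (z k) (N k) \<tau> \<omega> \<and> c k < path_end (z k) (N k) \<tau>' \<omega>})"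
proof (cases "L = {}")
  case False
  define Z where "Z = (\<lambda>k. {w \<in> even_sites. snd (z k) \<le> snd w \<and> snd w < snd (z k) + int (N k)})"
  define K where "K = (\<lambda>k. Z k \<times> (UNIV :: nat set))"
  define X where "X = (\<lambda>k \<omega>. restrict (\<lambda>i. gap_mark i \<omega>) (K k))"
  define Pm where "Pm = (\<lambda>k. PiM (K k) (\<lambda>_. site_space))"
  define pe where "pe = (\<lambda>k \<tau> y. fst ((arrow_step (coord_arrow \<tau> y) ^^ N k) (z k)))"
  define B where "B = (\<lambda>k. {y \<in> space (Pm k). c k < pe k \<tau> y \<and> c k < pe k \<tau>' y})"
  have disjK: "disjoint_family_on K L"
    using disj unfolding disjoint_family_on_def K_def Z_def by fastforce
  have ind: "indep_vars Pm X L"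
    unfolding Pm_def X_def
    by (rule indep_vars_restrict[OF indep_gap_mark _ disjK]) (auto simp: K_def Z_def)
  have B: "B k \<in> sets (Pm k)" if "k \<in> L" for k
  proof -
    have "(\<lambda>y. (arrow_step (coord_arrow \<sigma> y) ^^ N k) (z k)) \<in> measurable (Pm k) (count_space UNIV)" for \<sigma>
    proof (rule measurable_path_position[where T = "\<lambda>_. \<sigma>" and Z = "Z k"])
      fix y i assume y: "y \<in> space (Pm k)" and i: "i < N k"
      have "(arrow_step (coord_arrow \<sigma> y) ^^ i) (z k) \<in> even_sites"
      proof (rule funpow_arrow_step_even_strip[where n = "N k"])
        fix w assume "w \<in> even_sites" "snd (z k) \<le> snd w" "snd w < snd (z k) + int (N k)"
        then have "(w, n) \<in> K k" for n by (simp add: K_def Z_def)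
        then have "y (w, n) \<in> space site_space" for n
          using y unfolding Pm_def space_PiM by (rule PiE_mem[rotated])
        then show "coord_arrow \<sigma> y w \<in> {-1, 1}"
          unfolding \<xi>_def space_pair_measure by (metis mem_Times_iff space_count_space)
      qed (use z[OF that] i in auto)
      then show "(arrow_step (coord_arrow \<sigma> y) ^^ i) (z k) \<in> Z k"
        using i by (simp add: Z_def)
    qed (auto simp: Pm_def K_def intro: measurable_coord)
    from measurable_compose[OF this, of fst "count_space UNIV"]
    have [measurable]: "pe k \<sigma> \<in> measurable (Pm k) (count_space UNIV)" for \<sigma>
      unfolding pe_def by simp
    show ?thesis unfolding B_def by measurable
  qed
  have XB: "X k -` B k \<inter> space M = {\<omega> \<in> space M. c k < path_end (z k) (N k) \<tau> \<omega> \<and> c k < path_end (z k) (N k) \<tau>' \<omega>}"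
    if "k \<in> L" for k
  proof -
    have pe: "pe k \<sigma> (X k \<omega>) = path_end (z k) (N k) \<sigma> \<omega>" if \<omega>: "\<omega> \<in> space M" for \<sigma> \<omega>
    proof -
      have "(arrow_step (coord_arrow \<sigma> (X k \<omega>)) ^^ N k) (z k) = (arrow_step (arrow \<sigma> \<omega>) ^^ N k) (z k)"
      proof (rule funpow_arrow_step_cong)
        fix i assume "i < N k"
        then have "(arrow_step (arrow \<sigma> \<omega>) ^^ i) (z k) \<in> Z k"
          unfolding Z_def by (rule path_in_strip[OF z[OF \<open>k \<in> L\<close>] \<omega>])
        then show "coord_arrow \<sigma> (X k \<omega>) ((arrow_step (arrow \<sigma> \<omega>) ^^ i) (z k))
          = arrow \<sigma> \<omega> ((arrow_step (arrow \<sigma> \<omega>) ^^ i) (z k))"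
          unfolding X_def K_def by (rule xi_coord)
      qed
      then show ?thesis by (simp add: pe_def path_end_def)
    qed
    have "random_variable (Pm k) (X k)" using ind that by (simp add: indep_vars_def)
    then have "X k \<omega> \<in> space (Pm k)" if "\<omega> \<in> space M" for \<omega> using that by (rule measurable_space)
    then show ?thesis using pe by (auto simp: B_def)
  qed
  have "prob (\<Inter>k\<in>L. X k -` B k \<inter> space M) = (\<Prod>k\<in>L. prob (X k -` B k \<inter> space M))"
    by (rule indep_varsD_finite[OF ind False L B])
  moreover have "(\<Inter>k\<in>L. X k -` B k \<inter> space M)
      = {\<omega> \<in> space M. \<forall>k\<in>L. c k < path_end (z k) (N k) \<tau> \<omega> \<and> c k < path_end (z k) (N k) \<tau>' \<omega>}"
    using False by (auto simp: XB)
  ultimately show ?thesis by (simp add: XB)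
qed (simp add: prob_space)

end

section \<open>Sums of signs\<close>


text \<open>Squaring removes the root from the bound on the central binomial coefficient, and the
  induction step comes down to \<open>4 m (m + 1) <= (2 m + 1)^2\<close>.\<close>

lemma central_binomial_square_bound:
  assumes "1 \<le> m"
  shows "16 ^ m \<le> 4 * real m * (real ((2 * m) choose m))\<^sup>2"
  using assms
proof (induction m rule: dec_induct)
  case base
  show ?case by (simp add: numeral_2_eq_2)
next
  case (step m)
  define b where "b = real ((2 * m) choose m)"
  have b': "real ((2 * Suc m) choose (Suc m)) = b * (2 * (2 * real m + 1)) / (real m + 1)"
  proof -
    have c: "real ((2 * k) choose k) = fact (2 * k) / (fact k * fact k)" for k :: nat
      by (subst binomial_fact) (auto simp: mult_2)
    have "fact (2 * Suc m) = (2 * real m + 2) * (2 * real m + 1) * fact (2 * m)"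
      by (simp add: algebra_simps)
    moreover have "fact (Suc m) = (real m + 1) * fact m" by simp
    moreover have "((2 * x + 2) * (2 * x + 1) * F) / (((x + 1) * f) * ((x + 1) * f)) = F / (f * f) * (2 * (2 * x + 1)) / (x + 1)"
      if "x + 1 \<noteq> 0" "f \<noteq> 0" for x f F :: real
      using that by (simp add: frac_eq_eq) algebra
    ultimately show ?thesis unfolding b_def c by (simp del: fact_Suc)
  qed
  have "4 * real m * (real m + 1) \<le> (2 * real m + 1)\<^sup>2"
    by (simp add: power2_eq_square algebra_simps)
  then have "4 * real m * b\<^sup>2 * (16 * (real m + 1)) \<le> 16 * b\<^sup>2 * (2 * real m + 1)\<^sup>2"
    using mult_left_mono[of "4 * real m * (real m + 1)" "(2 * real m + 1)\<^sup>2" "16 * b\<^sup>2"]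
    by (simp add: algebra_simps)
  then have "16 * (4 * real m * b\<^sup>2) \<le> 16 * b\<^sup>2 * (2 * real m + 1)\<^sup>2 / (real m + 1)"
    by (simp add: divide_simps algebra_simps)
  also have "\<dots> = 4 * real (Suc m) * (real ((2 * Suc m) choose (Suc m)))\<^sup>2"
  proof -
    have "16 * b\<^sup>2 * y\<^sup>2 / x = 4 * x * (b * (2 * y) / x)\<^sup>2" if "x \<noteq> 0" for x y :: real
      using that by (simp add: power_divide power_mult_distrib power2_eq_square)
    from this[of "real m + 1" "2 * real m + 1"] show ?thesis unfolding b' by (simp add: add.commute)
  qed
  finally show ?case using step.IH unfolding b_def by simp
qed

lemma central_binomial_ge:
  assumes "1 \<le> m"
  shows "4 ^ m / (2 * sqrt (real m)) \<le> real ((2 * m) choose m)"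
proof -
  have "(4 ^ m)\<^sup>2 \<le> (2 * sqrt (real m) * real ((2 * m) choose m))\<^sup>2"
    using central_binomial_square_bound[OF assms]
    by (simp add: power_mult_distrib power_mult[symmetric] mult.commute[of m 2] power_mult)
  then have "4 ^ m \<le> 2 * sqrt (real m) * real ((2 * m) choose m)"
    by (rule power2_le_imp_le) simp
  then show ?thesis using assms by (simp add: divide_simps mult_ac)
qed

text \<open>Pairing the factors as \<open>(m - j + i) / (m + i) = 1 - j / (m + i)\<close> instead of
  \<open>(m - i) / (m + i + 1)\<close> is what produces the sharp Gaussian exponent \<open>j\<^sup>2 / m\<close>.\<close>

lemma binomial_off_center_ge:
  assumes "j \<le> m" "1 \<le> m"
  shows "real ((2 * m) choose m) * (1 - real j / real m) ^ j \<le> real ((2 * m) choose (m + j))"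
proof -
  \<comment> \<open>Induction on the number \<open>a\<close> of factors paired so far; one more
    factor amounts to \<open>(1 - j/m) (m + a + 1) <= m - j + a + 1\<close>.\<close>
  have ind: "(1 - real j / real m) ^ a * fact (m + a) * fact (m - j) \<le> fact (m - j + a) * fact m" if "a \<le> j" for a
    using that
  proof (induction a)
    case (Suc a)
    have pos: "0 \<le> 1 - real j / real m" using assms by simp
    have "real j / real m * real m \<le> real j / real m * (real m + real a + 1)"
      by (intro mult_left_mono) auto
    then have "real j \<le> real j / real m * (real m + real a + 1)" using assms by simp
    then have step: "(1 - real j / real m) * (real m + real a + 1) \<le> real m - real j + real a + 1"
      by (simp add: left_diff_distrib)
    have IH: "(1 - real j / real m) ^ a * fact (m + a) * fact (m - j) \<le> fact (m - j + a) * fact m"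
      using Suc by simp
    have "(1 - real j / real m) ^ Suc a * fact (m + Suc a) * fact (m - j)
        = ((1 - real j / real m) * (real m + real a + 1)) * ((1 - real j / real m) ^ a * fact (m + a) * fact (m - j))"
      by (simp add: algebra_simps)
    also have "\<dots> \<le> (real m - real j + real a + 1) * (fact (m - j + a) * fact m)"
      by (rule mult_mono[OF step IH]) (use assms pos in \<open>auto intro!: mult_nonneg_nonneg\<close>)
    also have "\<dots> = fact (m - j + Suc a) * fact m"
      using assms by (simp add: of_nat_diff algebra_simps)
    finally show ?case .
  qed simp
  have le: "(1 - real j / real m) ^ j * (fact (m + j) * fact (m - j)) \<le> fact m * fact m"
    using ind[of j] assms by (simp add: mult.assoc)
  have "real ((2 * m) choose m) = fact (2 * m) / (fact m * fact m)"
    by (subst binomial_fact) (auto simp: mult_2)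
  moreover have "real ((2 * m) choose (m + j)) = fact (2 * m) / (fact (m + j) * fact (m - j))"
    using assms by (subst binomial_fact) (auto simp: mult_2)
  moreover have "fact (2 * m) / (fact m * fact m) * (1 - real j / real m) ^ j \<le> (fact (2 * m) / (fact (m + j) * fact (m - j)) :: real)"
  proof -
    have "fact (2 * m) * ((1 - real j / real m) ^ j * (fact (m + j) * fact (m - j))) \<le> fact (2 * m) * (fact m * fact m)"
      using le by (intro mult_left_mono) auto
    then show ?thesis by (simp add: divide_simps mult_ac)
  qed
  ultimately show ?thesis by simp
qed

text \<open>A sum of \<open>2 m\<close> signs exceeds \<open>2 J\<close> when the number of plus
  signs is \<open>m + j\<close> with \<open>j > J\<close>. Only the window of \<open>r\<close>
  values just above \<open>J\<close> is kept, each estimated by the value at its far end. With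
  \<open>r\<close> of order \<open>sqrt m\<close> the prefactor stays bounded below while the
  exponent changes only at lower order.\<close>

lemma card_sign_sequences_ge:
  assumes J: "J + r \<le> m" and m: "1 \<le> m"
  shows "real r / (2 * sqrt (real m)) * (1 - real (J + r) / real m) ^ (J + r)
    \<le> real (card {e \<in> PiE {..<2 * m} (\<lambda>_. {-1, 1::int}). 2 * int J < (\<Sum>i<2 * m. e i)}) / 2 ^ (2 * m)"
proof -
  define N where "N = 2 * m"
  define S where "S = {A. A \<subseteq> {..<N} \<and> 2 * int J < 2 * int (card A) - int N}"
  define T where "T = {e \<in> PiE {..<N} (\<lambda>_. {-1, 1::int}). 2 * int J < (\<Sum>i<N. e i)}"
  define f where "f = (\<lambda>A. \<lambda>i\<in>{..<N}. if i \<in> A then 1 else (-1::int))"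
  have "finite (PiE {..<N} (\<lambda>_. {-1, 1::int}))" by (intro finite_PiE) auto
  then have "finite T" unfolding T_def by (rule rev_finite_subset) auto
  have "card S \<le> card T"
  proof (rule card_inj_on_le[OF _ _ \<open>finite T\<close>])
    show "inj_on f S"
    proof (rule inj_onI)
      fix A B assume AB: "A \<in> S" "B \<in> S" "f A = f B"
      have "i \<in> A \<longleftrightarrow> i \<in> B" for i
      proof (cases "i < N")
        case True
        then show ?thesis using fun_cong[OF AB(3), of i] by (auto simp: f_def split: if_splits)
      qed (use AB in \<open>auto simp: S_def\<close>)
      then show "A = B" by auto
    qed
    show "f ` S \<subseteq> T"
    proof (rule image_subsetI)
      fix A assume A: "A \<in> S"
      have "(\<Sum>i<N. f A i) = (\<Sum>i<N. (if i \<in> A then 2 else 0) - 1)"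
        by (rule sum.cong) (auto simp: f_def)
      also have "\<dots> = (\<Sum>i<N. if i \<in> A then 2 else 0) - int N"
        by (simp add: sum_subtractf)
      also have "(\<Sum>i<N. if i \<in> A then 2 else (0::int)) = 2 * int (card A)"
        using A by (subst sum.inter_restrict[symmetric]) (auto simp: S_def Int_absorb1)
      finally show "f A \<in> T" using A by (auto simp: T_def S_def f_def)
    qed
  qed
  have sub: "(\<Union>j\<in>{J<..J + r}. {A. A \<subseteq> {..<N} \<and> card A = m + j}) \<subseteq> S"
    by (auto simp: S_def N_def)
  have fin: "finite S" unfolding S_def by (intro finite_Collect_conjI disjI1) auto
  have "(\<Sum>j\<in>{J<..J + r}. N choose (m + j)) = card (\<Union>j\<in>{J<..J + r}. {A. A \<subseteq> {..<N} \<and> card A = m + j})"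
    by (subst card_UN_disjoint) (auto simp: n_subsets)
  also have "\<dots> \<le> card S" by (rule card_mono[OF fin sub])
  also have "\<dots> \<le> card T" by fact
  finally have "real (\<Sum>j\<in>{J<..J + r}. N choose (m + j)) \<le> real (card T)"
    by (simp only: of_nat_le_iff)
  then have "(\<Sum>j\<in>{J<..J + r}. real (N choose (m + j))) \<le> real (card T)" by simp
  note total = this
  have lower: "4 ^ m / (2 * sqrt (real m)) * (1 - real (J + r) / real m) ^ (J + r) \<le> real (N choose (m + j))"
    if j: "j \<in> {J<..J + r}" for j
  proof -
    have "(1 - real (J + r) / real m) ^ (J + r) \<le> (1 - real (J + r) / real m) ^ j"
      using j J m by (intro power_decreasing) auto
    also have "\<dots> \<le> (1 - real j / real m) ^ j"
      using j J m by (intro power_mono) (auto simp: divide_simps)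
    finally have "4 ^ m / (2 * sqrt (real m)) * (1 - real (J + r) / real m) ^ (J + r)
        \<le> real ((2 * m) choose m) * (1 - real j / real m) ^ j"
      using J m by (intro mult_mono central_binomial_ge) auto
    also have "\<dots> \<le> real (N choose (m + j))"
      unfolding N_def using j J m by (intro binomial_off_center_ge) auto
    finally show ?thesis .
  qed
  have "(\<Sum>j\<in>{J<..J + r}. 4 ^ m / (2 * sqrt (real m)) * (1 - real (J + r) / real m) ^ (J + r))
      \<le> (\<Sum>j\<in>{J<..J + r}. real (N choose (m + j)))"
    by (rule sum_mono) (rule lower)
  also note total
  finally have "(\<Sum>j\<in>{J<..J + r}. 4 ^ m / (2 * sqrt (real m)) * (1 - real (J + r) / real m) ^ (J + r)) \<le> real (card T)" .
  then have "4 ^ m * (real r / (2 * sqrt (real m)) * (1 - real (J + r) / real m) ^ (J + r)) \<le> real (card T)"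
    by (simp add: mult_ac)
  then have "real r / (2 * sqrt (real m)) * (1 - real (J + r) / real m) ^ (J + r) \<le> real (card T) / 4 ^ m"
    by (subst pos_le_divide_eq) (auto simp: mult_ac)
  also have "(4::real) ^ m = 2 ^ (2 * m)" by (simp add: power_mult)
  finally show ?thesis unfolding T_def N_def .
qed

text \<open>The sharp exponent is \<open>x^2 / 2\<close>; the room left by \<open>x^2\<close> lets
  quadratic estimates of both exponentials suffice on the unit interval.\<close>

lemma exp_plus_exp_minus_le:
  fixes x :: real
  assumes "0 \<le> x" "x \<le> 1"
  shows "exp x + exp (-x) \<le> 2 * exp (x\<^sup>2)"
proof -
  have "exp x \<le> 1 + x + x\<^sup>2" by (rule exp_bound) (use assms in auto)
  moreover have "exp (-x) \<le> 1 - x + x\<^sup>2"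
  proof -
    have "1 \<le> (1 + x) * (1 - x + x\<^sup>2)"
      using assms by (simp add: algebra_simps power2_eq_square)
    also have "\<dots> \<le> exp x * (1 - x + x\<^sup>2)"
      using assms exp_ge_add_one_self[of x] by (intro mult_right_mono) auto
    finally show ?thesis by (simp add: exp_minus divide_simps mult_ac)
  qed
  moreover have "1 + x\<^sup>2 \<le> exp (x\<^sup>2)" by (rule exp_ge_add_one_self)
  ultimately show ?thesis by linarith
qed

text \<open>Chernoff's bound with parameter \<open>1 / sqrt N\<close>, whose moment generating
  factor contributes the \<open>1\<close> in the exponent. An exponential tail is enough, as it is
  applied with \<open>c / sqrt N\<close> tending to minus infinity.\<close>

lemma card_sign_sequences_tail:
  assumes "1 \<le> N"
  shows "1 - exp (1 + real_of_int c / sqrt (real N))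
    \<le> real (card {e \<in> PiE {..<N} (\<lambda>_. {-1, 1::int}). c < (\<Sum>i<N. e i)}) / 2 ^ N"
proof -
  define S where "S = PiE {..<N} (\<lambda>_. {-1, 1::int})"
  have "finite S" unfolding S_def by (intro finite_PiE) auto
  have cS: "card S = 2 ^ N" unfolding S_def by (subst card_PiE) (auto simp: numeral_2_eq_2)
  define x where "x = 1 / sqrt (real N)"
  have x: "0 < x" "x \<le> 1" "real N * x\<^sup>2 = 1"
    using assms by (auto simp: x_def power_divide)
  define B where "B = {e \<in> S. (\<Sum>i<N. e i) \<le> c}"
  have "real (card B) = (\<Sum>e\<in>B. 1)" by simp
  also have "\<dots> \<le> (\<Sum>e\<in>B. exp (x * c) * (\<Prod>i<N. exp (- x * e i)))"
  proof (rule sum_mono)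
    fix e assume "e \<in> B"
    then have "real_of_int (\<Sum>i<N. e i) \<le> real_of_int c"
      unfolding B_def of_int_le_iff by simp
    then have "x * (\<Sum>i<N. real_of_int (e i)) \<le> x * c"
      using x(1) by (intro mult_left_mono) auto
    then have "0 \<le> x * c + (\<Sum>i<N. - x * e i)"
      by (simp add: sum_distrib_left sum_negf)
    then have "1 \<le> exp (x * c + (\<Sum>i<N. - x * e i))" by simp
    then show "1 \<le> exp (x * c) * (\<Prod>i<N. exp (- x * e i))" by (simp add: exp_add exp_sum)
  qed
  also have "\<dots> \<le> (\<Sum>e\<in>S. exp (x * c) * (\<Prod>i<N. exp (- x * e i)))"
    using \<open>finite S\<close> by (intro sum_mono2) (auto simp: B_def intro!: mult_nonneg_nonneg prod_nonneg)
  also have "\<dots> = exp (x * c) * (\<Prod>i<N. \<Sum>s\<in>{-1, 1::int}. exp (- x * s))"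
    unfolding S_def by (subst prod_sum_PiE) (auto simp: sum_distrib_left)
  also have "\<dots> = exp (x * c) * (exp x + exp (-x)) ^ N"
    by (simp add: add.commute)
  also have "\<dots> \<le> exp (x * c) * (2 * exp (x\<^sup>2)) ^ N"
    using x by (intro mult_left_mono power_mono exp_plus_exp_minus_le) (auto intro: add_nonneg_nonneg)
  also have "\<dots> = 2 ^ N * exp (1 + x * c)"
    using x(3) by (simp add: power_mult_distrib exp_add mult_ac flip: exp_of_nat_mult)
  finally have B: "real (card B) \<le> 2 ^ N * exp (1 + x * c)" .
  define T where "T = {e \<in> S. c < (\<Sum>i<N. e i)}"
  have "S = T \<union> B" "T \<inter> B = {}" by (auto simp: T_def B_def)
  moreover have "finite T" "finite B" using \<open>finite S\<close> by (simp_all add: T_def B_def)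
  ultimately have "card S = card T + card B" by (simp add: card_Un_disjoint)
  then have "real (2 ^ N) = real (card T + card B)" unfolding cS by simp
  then have "2 ^ N = real (card T) + real (card B)" by simp
  then have "2 ^ N * (1 - exp (1 + x * c)) \<le> real (card T)" using B by (simp add: algebra_simps)
  then show ?thesis
    by (simp add: T_def S_def x_def field_simps)
qed

section \<open>Correlations of the levels\<close>


text \<open>This is \<open>hat_d\<close> without the rounding, so that passing to the next level is
  exactly raising to the power \<gamma>, and products over levels become geometric sums in the
  exponent.\<close>

definition level_scale :: "real \<Rightarrow> nat \<Rightarrow> real" where
  "level_scale \<gamma> k = \<gamma> powr (\<gamma> ^ k)"

text \<open>The bound for \<open>P(A \<inter> A') / P(A)\<^sup>2\<close> at level \<open>k\<close> and distance \<open>h\<close> when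
  \<open>P(A) \<ge> level_scale \<gamma> k powr (-q)\<close>: the minimum of \<open>1 / P(A)\<close> and of the correlation hypothesis.\<close>

definition level_bound :: "real \<Rightarrow> real \<Rightarrow> real \<Rightarrow> real \<Rightarrow> nat \<Rightarrow> real \<Rightarrow> real" where
  "level_bound \<gamma> q a c k h = min (level_scale \<gamma> k powr q)
     (1 + c * level_scale \<gamma> k powr (2 * q - a) * h powr (-a))"

context
  fixes \<gamma> :: real
  assumes \<gamma>: "1 < \<gamma>"
begin

abbreviation scale :: "nat \<Rightarrow> real" where
  "scale \<equiv> level_scale \<gamma>"

lemma level_scale_pos: "0 < scale k"
  using \<gamma> by (simp add: level_scale_def)

lemma level_scale_ge_1: "1 \<le> scale k"
  using \<gamma> by (simp add: level_scale_def ge_one_powr_ge_zero)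

lemma level_scale_mono: "j \<le> k \<Longrightarrow> scale j \<le> scale k"
  using \<gamma> unfolding level_scale_def by (intro powr_mono power_increasing) auto

lemma level_scale_powr: "scale k powr b = \<gamma> powr (b * \<gamma> ^ k)"
  by (simp add: level_scale_def powr_powr mult.commute)

lemma power_growth: "1 + real i * (\<gamma> - 1) \<le> \<gamma> ^ i"
  using Bernoulli_inequality[of "\<gamma> - 1" i] \<gamma> by simp

text \<open>Bernoulli's inequality for \<open>\<gamma> ^ k\<close> reduces doubly exponential decay
  to geometric decay.\<close>

lemma level_scale_powr_le_geometric:
  assumes "0 < b"
  shows "scale k powr (-b) \<le> (\<gamma> powr (-b * (\<gamma> - 1))) ^ k"
proof -
  have "scale k powr (-b) = \<gamma> powr (-b * \<gamma> ^ k)" by (rule level_scale_powr)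
  also have "\<dots> \<le> \<gamma> powr (-b * (real k * (\<gamma> - 1)))"
    using power_growth[of k] \<gamma> assms by (intro powr_mono) (auto intro!: mult_left_mono)
  also have "\<dots> = (\<gamma> powr (-b * (\<gamma> - 1))) ^ k"
    using \<gamma> by (simp add: powr_realpow[symmetric] powr_powr mult_ac)
  finally show ?thesis .
qed

lemma ratio_less_1: "0 < b \<Longrightarrow> \<gamma> powr (-b * (\<gamma> - 1)) < 1"
  using \<gamma> powr_less_mono[of "-b * (\<gamma> - 1)" 0 \<gamma>] by simp

lemma summable_level_scale_powr:
  assumes "0 < b"
  shows "summable (\<lambda>k. scale k powr (-b))"
proof (rule summable_comparison_test')
  show "summable (\<lambda>k. (\<gamma> powr (-b * (\<gamma> - 1))) ^ k)"
    using ratio_less_1[OF assms] by (intro summable_geometric) auto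
  show "norm (scale k powr (-b)) \<le> (\<gamma> powr (-b * (\<gamma> - 1))) ^ k" for k
    using level_scale_powr_le_geometric[OF assms, of k] by simp
qed

text \<open>The exponents \<open>\<gamma> ^ k\<close> below level \<open>m\<close> sum to less than
  \<open>\<gamma> ^ m / (\<gamma> - 1)\<close>. This is the source of the denominator in the
  dimension bound.\<close>

lemma prod_level_scale_le:
  assumes "0 < q"
  shows "(\<Prod>k<m. scale k powr q) \<le> scale m powr (q / (\<gamma> - 1))"
proof -
  have "(\<Prod>k<m. scale k powr q) = \<gamma> powr (\<Sum>k<m. q * \<gamma> ^ k)"
    using \<gamma> by (simp add: level_scale_powr powr_sum)
  also have "(\<Sum>k<m. q * \<gamma> ^ k) = q * ((\<gamma> ^ m - 1) / (\<gamma> - 1))"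
    using \<gamma> by (simp add: sum_distrib_left[symmetric] geometric_sum)
  also have "\<gamma> powr \<dots> \<le> \<gamma> powr (q / (\<gamma> - 1) * \<gamma> ^ m)"
    using \<gamma> assms by (intro powr_mono) (auto simp: divide_simps)
  finally show ?thesis by (simp add: level_scale_powr)
qed

text \<open>The correlation term at level \<open>k\<close> equals \<open>1\<close>, up to the factor
  \<open>c\<close>, when \<open>scale k powr \<theta> = 1 / h\<close>. Levels above this threshold
  are called separated, those below it coarse. The assumed lower bound on \<theta> puts the coarse
  levels below \<open>h powr (- \<gamma> powr (3/2))\<close>.\<close>

context
  fixes q a c \<theta> :: real
  assumes q: "0 < q" and a: "2 * q < a" and c: "0 < c" and \<theta>_def: "\<theta> = 1 - 2 * q / a"
    and \<theta>: "\<gamma> powr (-3/2) \<le> \<theta>"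
begin

abbreviation bound :: "nat \<Rightarrow> real \<Rightarrow> real" where
  "bound \<equiv> level_bound \<gamma> q a c"

lemma \<theta>_pos: "0 < \<theta>"
  using a q unfolding \<theta>_def by (simp add: divide_simps)

lemma correlation_term_eq:
  assumes "0 < h"
  shows "scale k powr (2 * q - a) * h powr (-a) = (scale k powr \<theta> * h) powr (-a)"
proof -
  have "scale k powr (2 * q - a) = (scale k powr \<theta>) powr (-a)"
    using a q by (simp add: powr_powr \<theta>_def left_diff_distrib)
  then show ?thesis using assms by (simp add: powr_mult)
qed

lemma level_bound_nonneg: "0 \<le> bound k h"
  using c by (simp add: level_bound_def)

text \<open>Meant for distances bounded away from \<open>0\<close>: there the tail of the convergent
  series makes the bound close to \<open>1\<close> as \<open>k0\<close> grows.\<close>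

lemma prod_level_bound_le_exp:
  assumes "0 < h"
  shows "(\<Prod>k\<in>{k0..n}. bound k h)
    \<le> exp (c * h powr (-a) * (\<Sum>k. scale (k + k0) powr (-(a - 2 * q))))"
proof -
  have sm: "summable (\<lambda>k. scale (k + k0) powr (-(a - 2 * q)))"
    using summable_level_scale_powr[of "a - 2 * q"] a by (subst summable_iff_shift) simp
  have "(\<Prod>k\<in>{k0..n}. bound k h)
      \<le> (\<Prod>k\<in>{k0..n}. exp (c * h powr (-a) * scale k powr (-(a - 2 * q))))"
  proof (intro prod_mono conjI level_bound_nonneg)
    fix k
    have "bound k h \<le> 1 + c * h powr (-a) * scale k powr (-(a - 2 * q))"
      by (simp add: level_bound_def mult_ac)
    also have "\<dots> \<le> exp (c * h powr (-a) * scale k powr (-(a - 2 * q)))"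
      by (rule exp_ge_add_one_self)
    finally show "bound k h \<le> \<dots>" .
  qed
  also have "\<dots> = exp (c * h powr (-a) * (\<Sum>k\<in>{k0..n}. scale k powr (-(a - 2 * q))))"
    by (simp add: exp_sum sum_distrib_left)
  also have "\<dots> \<le> exp (c * h powr (-a) * (\<Sum>k. scale (k + k0) powr (-(a - 2 * q))))"
  proof -
    have "(\<Sum>k\<in>{k0..n}. scale k powr (-(a - 2 * q))) = (\<Sum>k\<in>(\<lambda>k. k - k0) ` {k0..n}. scale (k + k0) powr (-(a - 2 * q)))"
      by (subst sum.reindex) (auto simp: inj_on_def)
    also have "\<dots> \<le> (\<Sum>k. scale (k + k0) powr (-(a - 2 * q)))"
      by (rule sum_le_suminf[OF sm]) auto
    finally show ?thesis using c by (simp add: mult_left_mono)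
  qed
  finally show ?thesis .
qed

text \<open>The lowest separated level has \<open>scale m powr \<theta> * h\<close> at least
  \<open>1\<close>, and above it the scales grow at least geometrically. The correlation terms are
  therefore dominated by a geometric series whose ratio does not depend on \<open>h\<close>.\<close>

lemma prod_separated_levels_le:
  assumes h: "0 < h" and A: "finite A" "\<And>k. k \<in> A \<Longrightarrow> 1 \<le> scale k powr \<theta> * h"
  shows "(\<Prod>k\<in>A. bound k h) \<le> exp (c / (1 - \<gamma> powr (-(a * \<theta>) * (\<gamma> - 1))))"
proof (cases "A = {}")
  case True
  have "\<gamma> powr (-(a * \<theta>) * (\<gamma> - 1)) < 1" using \<theta>_pos a q by (intro ratio_less_1) auto
  then show ?thesis using True c by simp
next
  case False
  define g where "g = \<gamma> powr (-(a * \<theta>) * (\<gamma> - 1))"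
  have g: "0 < g" "g < 1" using \<theta>_pos a q \<gamma> ratio_less_1[of "a * \<theta>"] by (auto simp: g_def)
  define m where "m = Min A"
  have m: "m \<in> A" "\<And>k. k \<in> A \<Longrightarrow> m \<le> k" using False A by (auto simp: m_def)
  have term_le: "(scale k powr \<theta> * h) powr (-a) \<le> g ^ (k - m)" if "k \<in> A" for k
  proof -
    define i where "i = k - m"
    have k: "k = m + i" using m(2)[OF that] by (simp add: i_def)
    have gm: "1 \<le> \<gamma> ^ m" using \<gamma> by simp
    have "real i * (\<gamma> - 1) \<le> 1 * (\<gamma> ^ i - 1)" using power_growth[of i] by simp
    also have "\<dots> \<le> \<gamma> ^ m * (\<gamma> ^ i - 1)"
      using gm \<gamma> by (intro mult_right_mono) auto
    finally have e: "real i * (\<gamma> - 1) \<le> \<gamma> ^ k - \<gamma> ^ m" unfolding k by (simp add: power_add algebra_simps)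
    have "\<gamma> powr (\<theta> * (real i * (\<gamma> - 1))) \<le> \<gamma> powr (\<theta> * (\<gamma> ^ k - \<gamma> ^ m))"
      using e \<theta>_pos \<gamma> by (intro powr_mono mult_left_mono) auto
    also have "\<dots> = scale k powr \<theta> / scale m powr \<theta>"
      by (simp add: level_scale_powr powr_diff right_diff_distrib)
    also have "\<dots> \<le> scale k powr \<theta> * h"
      using A(2)[OF m(1)] level_scale_pos[of m] level_scale_pos[of k]
      by (simp add: divide_simps) (simp add: mult.assoc mult.commute mult_le_cancel_left1)
    finally have "(scale k powr \<theta> * h) powr (-a) \<le> (\<gamma> powr (\<theta> * (real i * (\<gamma> - 1)))) powr (-a)"
      using \<gamma> a q by (intro powr_mono2') auto
    also have "\<dots> = g ^ (k - m)"
      using \<gamma> by (simp add: g_def powr_powr i_def[symmetric] mult_ac flip: powr_realpow)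
    finally show ?thesis .
  qed
  have "(\<Prod>k\<in>A. bound k h) \<le> (\<Prod>k\<in>A. exp (c * g ^ (k - m)))"
  proof (intro prod_mono conjI level_bound_nonneg)
    fix k assume "k \<in> A"
    have "bound k h \<le> 1 + c * (scale k powr \<theta> * h) powr (-a)"
      using correlation_term_eq[OF h, of k] by (simp add: level_bound_def mult.assoc)
    also have "\<dots> \<le> 1 + c * g ^ (k - m)" using term_le[OF \<open>k \<in> A\<close>] c by simp
    also have "\<dots> \<le> exp (c * g ^ (k - m))" by (rule exp_ge_add_one_self)
    finally show "bound k h \<le> \<dots>" .
  qed
  also have "\<dots> = exp (c * (\<Sum>k\<in>A. g ^ (k - m)))"
    using A by (simp add: exp_sum sum_distrib_left)
  also have "(\<Sum>k\<in>A. g ^ (k - m)) = (\<Sum>i\<in>(\<lambda>k. k - m) ` A. g ^ i)"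
    by (subst sum.reindex) (use m in \<open>auto simp: inj_on_def eq_diff_iff\<close>)
  also have "\<dots> \<le> (\<Sum>i. g ^ i)"
    using g A by (intro sum_le_suminf summable_geometric) auto
  also have "(\<Sum>i. g ^ i) = 1 / (1 - g)" using g by (intro suminf_geometric) auto
  finally show ?thesis using c by (simp add: g_def)
qed

text \<open>Up to \<open>scale k = h powr (-2)\<close> the bound \<open>scale k powr q\<close> is
  small enough. Beyond it the correlation term is at most \<open>h powr (a - 4 * q)\<close>, and
  \<open>2 * q < a\<close> is what makes this at most \<open>h powr (-(2 * q))\<close>.\<close>

lemma level_bound_peak:
  assumes h: "0 < h" "h \<le> 1"
  shows "bound k h \<le> (1 + c) * h powr (-(2 * q))"
proof -
  have one: "1 \<le> h powr (-(2 * q))"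
    using h q powr_mono2'[of "-(2*q)" h 1] by simp
  show ?thesis
  proof (cases "scale k \<le> h powr (-2)")
    case True
    have "bound k h \<le> scale k powr q" by (simp add: level_bound_def)
    also have "\<dots> \<le> (h powr (-2)) powr q" using True q level_scale_pos[of k] by (intro powr_mono2) auto
    also have "\<dots> = 1 * h powr (-(2 * q))" by (simp add: powr_powr)
    also have "\<dots> \<le> (1 + c) * h powr (-(2 * q))" using c by (intro mult_right_mono) auto
    finally show ?thesis .
  next
    case False
    have "scale k powr (2 * q - a) \<le> (h powr (-2)) powr (2 * q - a)"
      using False a h by (intro powr_mono2') auto
    then have "scale k powr (2 * q - a) * h powr (-a) \<le> (h powr (-2)) powr (2 * q - a) * h powr (-a)"
      by (rule mult_right_mono) simp
    also have "\<dots> = h powr (a - 4 * q)"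
      using h by (simp add: powr_powr powr_add[symmetric])
    also have "\<dots> \<le> h powr (-(2 * q))"
      using h a by (intro powr_mono') auto
    finally have le: "scale k powr (2 * q - a) * h powr (-a) \<le> h powr (-(2 * q))" .
    have "bound k h \<le> 1 + c * (scale k powr (2 * q - a) * h powr (-a))"
      by (simp add: level_bound_def mult.assoc)
    also have "\<dots> \<le> h powr (-(2 * q)) + c * h powr (-(2 * q))"
      using le one c by (intro add_mono mult_left_mono) auto
    finally show ?thesis by (simp add: algebra_simps)
  qed
qed

text \<open>The largest coarse level contributes its peak, the summand \<open>2\<close> of the
  exponent. The lower ones are bounded by \<open>scale k powr q\<close>, and their product is a
  power of the largest scale, which is at most
  \<open>h powr (- \<gamma> powr (3/2))\<close>.\<close>

lemma prod_coarse_levels_le: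
  assumes h: "0 < h" "h \<le> 1" and A: "finite A" "\<And>k. k \<in> A \<Longrightarrow> scale k powr \<theta> * h < 1"
  shows "(\<Prod>k\<in>A. bound k h)
    \<le> (1 + c) * h powr (-(q * (2 + \<gamma> powr (3/2) / (\<gamma> - 1))))"
proof (cases "A = {}")
  case True
  have e: "0 \<le> q * (2 + \<gamma> powr (3/2) / (\<gamma> - 1))" using q \<gamma> by (intro mult_nonneg_nonneg add_nonneg_nonneg) auto
  then have "1 * 1 \<le> (1 + c) * h powr (-(q * (2 + \<gamma> powr (3/2) / (\<gamma> - 1))))"
    using c powr_mono2'[of "-(q * (2 + \<gamma> powr (3/2) / (\<gamma> - 1)))" h 1] h by (intro mult_mono) auto
  then show ?thesis using True by simp
next
  case False
  define m where "m = Max A"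
  have m: "m \<in> A" "\<And>k. k \<in> A \<Longrightarrow> k \<le> m" using False A by (auto simp: m_def)
  have "(\<Prod>k\<in>A - {m}. bound k h) \<le> (\<Prod>k\<in>A - {m}. scale k powr q)"
    by (intro prod_mono conjI level_bound_nonneg) (simp add: level_bound_def)
  also have "\<dots> \<le> (\<Prod>k<m. scale k powr q)"
  proof (rule prod_mono2)
    show "A - {m} \<subseteq> {..<m}" using m by force
    show "1 \<le> scale b powr q" for b using level_scale_ge_1[of b] q by (simp add: ge_one_powr_ge_zero)
  qed auto
  also have "\<dots> \<le> scale m powr (q / (\<gamma> - 1))" by (rule prod_level_scale_le[OF q])
  also have "\<dots> \<le> h powr (-(q * (\<gamma> powr (3/2) / (\<gamma> - 1))))"
  proof -
    have "scale m powr \<theta> \<le> h powr (-1)"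
      using A(2)[OF m(1)] h by (simp add: powr_minus divide_simps)
    then have "(scale m powr \<theta>) powr (1 / \<theta>) \<le> (h powr (-1)) powr (1 / \<theta>)"
      using \<theta>_pos by (intro powr_mono2) auto
    also have "(h powr (-1)) powr (1 / \<theta>) = h powr (-(1 / \<theta>))"
      unfolding powr_powr by simp
    also have "(scale m powr \<theta>) powr (1 / \<theta>) = scale m"
      using \<theta>_pos level_scale_pos[of m] by (simp add: powr_powr)
    finally have "scale m \<le> h powr (-(1 / \<theta>))" .
    also have "\<dots> \<le> h powr (-(\<gamma> powr (3/2)))"
    proof -
      have "1 / \<theta> \<le> 1 / \<gamma> powr (-3/2)" using \<theta> \<gamma> \<theta>_pos by (intro divide_left_mono) auto
      then have "1 / \<theta> \<le> \<gamma> powr (3/2)" by (simp add: powr_minus_divide)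
      then show ?thesis using h by (intro powr_mono') auto
    qed
    finally have "scale m powr (q / (\<gamma> - 1)) \<le> (h powr (-(\<gamma> powr (3/2)))) powr (q / (\<gamma> - 1))"
      using q \<gamma> level_scale_pos[of m] by (intro powr_mono2) auto
    also have "\<dots> = h powr (-(q * (\<gamma> powr (3/2) / (\<gamma> - 1))))"
      by (simp add: powr_powr mult_ac)
    finally show ?thesis .
  qed
  finally have "(\<Prod>k\<in>A - {m}. bound k h) \<le> h powr (-(q * (\<gamma> powr (3/2) / (\<gamma> - 1))))" .
  then have "bound m h * (\<Prod>k\<in>A - {m}. bound k h)
      \<le> ((1 + c) * h powr (-(2 * q))) * h powr (-(q * (\<gamma> powr (3/2) / (\<gamma> - 1))))"
    using c by (intro mult_mono level_bound_peak h prod_nonneg level_bound_nonneg) auto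
  also have "\<dots> = (1 + c) * h powr (-(q * (2 + \<gamma> powr (3/2) / (\<gamma> - 1))))"
    by (simp add: mult.assoc powr_add[symmetric] distrib_left mult.commute)
  finally show ?thesis using prod.remove[OF A(1) m(1), of "\<lambda>k. bound k h"] by simp
qed

lemma prod_level_bound_le_powr:
  assumes h: "0 < h" "h \<le> 1"
  shows "(\<Prod>k\<in>{k0..n}. bound k h)
    \<le> ((1 + c) * exp (c / (1 - \<gamma> powr (-(a * \<theta>) * (\<gamma> - 1))))) * h powr (-(q * (2 + \<gamma> powr (3/2) / (\<gamma> - 1))))"
proof -
  define A1 where "A1 = {k \<in> {k0..n}. scale k powr \<theta> * h < 1}"
  define A2 where "A2 = {k \<in> {k0..n}. \<not> scale k powr \<theta> * h < 1}"
  have "{k0..n} = A1 \<union> A2" "A1 \<inter> A2 = {}" "finite A1" "finite A2" by (auto simp: A1_def A2_def)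
  then have "(\<Prod>k\<in>{k0..n}. bound k h)
      = (\<Prod>k\<in>A1. bound k h) * (\<Prod>k\<in>A2. bound k h)"
    by (simp add: prod.union_disjoint)
  also have "\<dots> \<le> ((1 + c) * h powr (-(q * (2 + \<gamma> powr (3/2) / (\<gamma> - 1))))) * exp (c / (1 - \<gamma> powr (-(a * \<theta>) * (\<gamma> - 1))))"
    using c h by (intro mult_mono prod_coarse_levels_le prod_separated_levels_le prod_nonneg level_bound_nonneg)
      (auto simp: A1_def A2_def)
  finally show ?thesis by (simp add: mult_ac)
qed

text \<open>Two regimes: at short distance the strict inequality between the exponents leaves a
  spare power of \<open>h\<close> that absorbs the constant; at the remaining distances the product
  itself tends to \<open>1\<close> uniformly as \<open>k0\<close> grows.\<close>

lemma prod_level_bound_near_1: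
  assumes \<rho>: "q * (2 + \<gamma> powr (3/2) / (\<gamma> - 1)) < \<rho>" and \<delta>: "0 < \<delta>"
  shows "\<exists>K. \<forall>k0\<ge>K. \<forall>n h. 0 < h \<longrightarrow> h \<le> 1 \<longrightarrow>
    (\<Prod>k\<in>{k0..n}. bound k h) \<le> 1 + \<delta> * h powr (-\<rho>)"
proof -
  define \<rho>' where "\<rho>' = q * (2 + \<gamma> powr (3/2) / (\<gamma> - 1))"
  define c1 where "c1 = (1 + c) * exp (c / (1 - \<gamma> powr (-(a * \<theta>) * (\<gamma> - 1))))"
  have c1: "0 < c1" using c by (simp add: c1_def)
  have \<rho>'0: "0 < \<rho>'" unfolding \<rho>'_def using q \<gamma> by (intro mult_pos_pos add_pos_nonneg) auto
  \<comment> \<open>At \<open>h = h0\<close> the spare power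
    \<open>h powr (\<rho> - \<rho>')\<close> equals \<open>\<delta> / c1\<close>.\<close>
  define h0 where "h0 = (\<delta> / c1) powr (1 / (\<rho> - \<rho>'))"
  have h0: "0 < h0" using \<delta> c1 by (simp add: h0_def)
  define \<sigma> where "\<sigma> = (\<lambda>k0. \<Sum>k. scale (k + k0) powr (-(a - 2 * q)))"
  have "\<sigma> \<longlonglongrightarrow> 0"
    unfolding \<sigma>_def
    using suminf_exist_split2[OF summable_level_scale_powr[of "a - 2 * q"]] a by simp
  then have "(\<lambda>k0. exp (c * h0 powr (-a) * \<sigma> k0)) \<longlonglongrightarrow> exp (c * h0 powr (-a) * 0)"
    by (intro tendsto_intros)
  then have "eventually (\<lambda>k0. exp (c * h0 powr (-a) * \<sigma> k0) < 1 + \<delta>) sequentially"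
    using \<delta> by (intro order_tendstoD(2)) auto
  then obtain K where K: "\<And>k0. k0 \<ge> K \<Longrightarrow> exp (c * h0 powr (-a) * \<sigma> k0) < 1 + \<delta>"
    unfolding eventually_sequentially by auto
  have "(\<Prod>k\<in>{k0..n}. bound k h) \<le> 1 + \<delta> * h powr (-\<rho>)"
    if "k0 \<ge> K" and h: "0 < h" "h \<le> 1" for k0 n h
  proof (cases "h < h0")
    case True
    have "h powr (\<rho> - \<rho>') \<le> h0 powr (\<rho> - \<rho>')"
      using True h \<rho> by (intro powr_mono2) (auto simp: \<rho>'_def)
    also have "\<dots> = \<delta> / c1" using \<rho> \<delta> c1 by (simp add: h0_def powr_powr \<rho>'_def)
    finally have le: "c1 * h powr (\<rho> - \<rho>') \<le> \<delta>" using c1 by (simp add: field_simps)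
    have "(\<Prod>k\<in>{k0..n}. bound k h) \<le> c1 * h powr (-\<rho>')"
      unfolding c1_def \<rho>'_def by (rule prod_level_bound_le_powr[OF h])
    also have "\<dots> = (c1 * h powr (\<rho> - \<rho>')) * h powr (-\<rho>)"
      using h by (simp add: mult.assoc powr_add[symmetric])
    also have "\<dots> \<le> \<delta> * h powr (-\<rho>)" by (rule mult_right_mono[OF le]) simp
    finally show ?thesis by simp
  next
    case False
    have \<sigma>0: "0 \<le> \<sigma> k0"
      unfolding \<sigma>_def using summable_level_scale_powr[of "a - 2 * q"] a
      by (intro suminf_nonneg summable_ignore_initial_segment) auto
    have "(\<Prod>k\<in>{k0..n}. bound k h) \<le> exp (c * h powr (-a) * \<sigma> k0)"
      unfolding \<sigma>_def by (rule prod_level_bound_le_exp[OF h(1)])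
    also have "\<dots> \<le> exp (c * h0 powr (-a) * \<sigma> k0)"
      using False h0 c a q \<sigma>0 by (auto intro!: mult_right_mono mult_left_mono powr_mono2')
    also have "\<dots> \<le> 1 + \<delta>" using K[OF \<open>k0 \<ge> K\<close>] by simp
    also have "\<dots> \<le> 1 + \<delta> * h powr (-\<rho>)"
    proof -
      have "1 \<le> h powr (-\<rho>)" using powr_mono2'[of "-\<rho>" h 1] h \<rho> \<rho>'0 by (simp add: \<rho>'_def)
      then show ?thesis using \<delta> by simp
    qed
    finally show ?thesis .
  qed
  then show ?thesis by blast
qed

end

end

section \<open>Asymptotics of the rectangles\<close>


definition gauss_height :: "real \<Rightarrow> real \<Rightarrow> real" where
  "gauss_height C x = C * sqrt (x\<^sup>2 * ln (x\<^sup>2))"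

lemma gauss_height_mono:
  assumes "0 < C" "1 \<le> x" "x \<le> y"
  shows "gauss_height C x \<le> gauss_height C y"
proof -
  have "x\<^sup>2 \<le> y\<^sup>2" "1 \<le> x\<^sup>2" using assms by (auto intro: power_mono)
  moreover from this have "ln (x\<^sup>2) \<le> ln (y\<^sup>2)" using assms by (subst ln_le_cancel_iff) auto
  ultimately have "x\<^sup>2 * ln (x\<^sup>2) \<le> y\<^sup>2 * ln (y\<^sup>2)" by (intro mult_mono) auto
  then show ?thesis using assms by (simp add: gauss_height_def)
qed

lemma level_scale_at_top: "1 < \<gamma> \<Longrightarrow> filterlim (level_scale \<gamma>) at_top sequentially"
  unfolding level_scale_def by real_asymp

lemma double_floor_bounds:
  fixes x :: real
  shows "x < real_of_int (2 * (\<lfloor>x / 2\<rfloor> + 1)) \<and> real_of_int (2 * (\<lfloor>x / 2\<rfloor> + 1)) \<le> x + 2"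
proof -
  have "x / 2 < real_of_int \<lfloor>x / 2\<rfloor> + 1" "real_of_int \<lfloor>x / 2\<rfloor> \<le> x / 2" by linarith+
  moreover have "real_of_int (2 * (\<lfloor>x / 2\<rfloor> + 1)) = 2 * real_of_int \<lfloor>x / 2\<rfloor> + 2" by simp
  ultimately show ?thesis by linarith
qed

lemma hat_d_bounds:
  "level_scale \<gamma> k < real_of_int (hat_d \<gamma> k) \<and> real_of_int (hat_d \<gamma> k) \<le> level_scale \<gamma> k + 2"
  unfolding hat_d_def level_scale_def by (rule double_floor_bounds)

lemma hat_w_bounds:
  "gauss_height C (real_of_int (hat_d \<gamma> k)) < real_of_int (hat_w \<gamma> C k)
    \<and> real_of_int (hat_w \<gamma> C k) \<le> gauss_height C (real_of_int (hat_d \<gamma> k)) + 2"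
  unfolding hat_w_def gauss_height_def by (rule double_floor_bounds)

lemma even_hat_d: "even (hat_d \<gamma> k)" and even_hat_w: "even (hat_w \<gamma> C k)"
  by (simp_all add: hat_d_def hat_w_def)

lemma hat_d_ge_2:
  assumes "1 < \<gamma>"
  shows "2 \<le> hat_d \<gamma> k"
  using level_scale_pos[OF assms, of k] unfolding hat_d_def level_scale_def[symmetric] by simp

lemma hat_w_pos:
  assumes "1 < \<gamma>" "0 < C"
  shows "0 < hat_w \<gamma> C k"
proof -
  have "0 \<le> gauss_height C (real_of_int (hat_d \<gamma> k))"
    using hat_d_ge_2[OF assms(1), of k] assms(2) by (simp add: gauss_height_def ln_ge_zero)
  then have "0 < real_of_int (hat_w \<gamma> C k)" using hat_w_bounds[of C \<gamma> k] by linarith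
  then show ?thesis by simp
qed

lemma hat_d_mono: "1 < \<gamma> \<Longrightarrow> j \<le> k \<Longrightarrow> hat_d \<gamma> j \<le> hat_d \<gamma> k"
  using level_scale_mono[of \<gamma> j k] unfolding hat_d_def level_scale_def
  by (simp add: floor_mono divide_right_mono)

lemma hat_t_Suc: "hat_t \<gamma> (Suc k) = hat_t \<gamma> k + (hat_d \<gamma> k)\<^sup>2"
  by (simp add: hat_t_def)

lemma hat_t_nonneg: "0 \<le> hat_t \<gamma> k"
  by (simp add: hat_t_def sum_nonneg)

lemma hat_t_mono: "j \<le> k \<Longrightarrow> hat_t \<gamma> j \<le> hat_t \<gamma> k"
  unfolding hat_t_def by (rule sum_mono2) auto

lemma even_hat_t: "even (hat_t \<gamma> k)"
  unfolding hat_t_def by (rule dvd_sum) (simp add: even_hat_d)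

lemma hat_t_le:
  assumes "1 < \<gamma>"
  shows "hat_t \<gamma> (Suc k) \<le> (int k + 1) * (hat_d \<gamma> k)\<^sup>2"
proof -
  have "hat_t \<gamma> (Suc k) \<le> (\<Sum>j<Suc k. (hat_d \<gamma> k)\<^sup>2)"
    unfolding hat_t_def
  proof (rule sum_mono)
    fix j assume "j \<in> {..<Suc k}"
    then show "(hat_d \<gamma> j)\<^sup>2 \<le> (hat_d \<gamma> k)\<^sup>2"
      using hat_d_mono[OF assms, of j k] hat_d_ge_2[OF assms, of j] by (intro power_mono) auto
  qed
  then show ?thesis by (simp add: add.commute)
qed

text \<open>The last strip dominates: all earlier ones together last at most \<open>k + 1\<close>
  times the square of the previous \<open>hat_d\<close>, whereas \<open>hat_d\<close> grows by the
  power \<gamma> from level to level.\<close>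

lemma hat_t_ratio:
  assumes \<gamma>: "1 < \<gamma>"
  shows "(\<lambda>k. real_of_int (hat_t \<gamma> (Suc k)) / (real_of_int (hat_d \<gamma> k))\<^sup>2) \<longlonglongrightarrow> 1"
proof -
  have "(\<lambda>k. real_of_int (hat_t \<gamma> (Suc k)) / (real_of_int (hat_d \<gamma> (Suc k)))\<^sup>2) \<longlonglongrightarrow> 0"
  proof -
    \<comment> \<open>With this constant Bernoulli's inequality gives
      \<open>k <= c * ln (level_scale \<gamma> k)\<close>, so the whole bound becomes a function
      \<open>B\<close> of the scale alone.\<close>
    define c where "c = 1 / (ln \<gamma> * (\<gamma> - 1))"
    have c: "0 < c" using \<gamma> by (simp add: c_def)
    define B where "B = (\<lambda>x. (1 + c * ln x) * (x + 2)\<^sup>2 / (x powr \<gamma>)\<^sup>2)"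
    have "(B \<longlongrightarrow> 0) at_top" unfolding B_def using \<gamma> c by real_asymp
    then have lim: "(\<lambda>k. B (level_scale \<gamma> k)) \<longlonglongrightarrow> 0"
      by (rule filterlim_compose[OF _ level_scale_at_top[OF \<gamma>]])
    have le: "real_of_int (hat_t \<gamma> (Suc k)) / (real_of_int (hat_d \<gamma> (Suc k)))\<^sup>2 \<le> B (level_scale \<gamma> k)" for k
    proof -
      have "ln (level_scale \<gamma> k) = \<gamma> ^ k * ln \<gamma>" using \<gamma> by (simp add: level_scale_def ln_powr)
      then have "c * ln (level_scale \<gamma> k) = \<gamma> ^ k / (\<gamma> - 1)" using \<gamma> by (simp add: c_def)
      then have k: "real k + 1 \<le> 1 + c * ln (level_scale \<gamma> k)"
        using power_growth[OF \<gamma>, of k] \<gamma> by (simp add: pos_le_divide_eq)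
      have "real_of_int (hat_t \<gamma> (Suc k)) \<le> real_of_int ((int k + 1) * (hat_d \<gamma> k)\<^sup>2)"
        unfolding of_int_le_iff by (rule hat_t_le[OF \<gamma>])
      also have "\<dots> = (real k + 1) * (real_of_int (hat_d \<gamma> k))\<^sup>2" by simp
      also have "\<dots> \<le> (1 + c * ln (level_scale \<gamma> k)) * (level_scale \<gamma> k + 2)\<^sup>2"
        using hat_d_bounds[where \<gamma> = \<gamma> and k = k] hat_d_ge_2[OF \<gamma>, of k] k by (intro mult_mono power_mono) auto
      finally have num: "real_of_int (hat_t \<gamma> (Suc k)) \<le> (1 + c * ln (level_scale \<gamma> k)) * (level_scale \<gamma> k + 2)\<^sup>2" .
      have "level_scale \<gamma> (Suc k) = level_scale \<gamma> k powr \<gamma>"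
        by (simp add: level_scale_def powr_powr mult.commute)
      then have "level_scale \<gamma> k powr \<gamma> \<le> real_of_int (hat_d \<gamma> (Suc k))"
        using hat_d_bounds[of \<gamma> "Suc k"] by simp
      then have den: "(level_scale \<gamma> k powr \<gamma>)\<^sup>2 \<le> (real_of_int (hat_d \<gamma> (Suc k)))\<^sup>2"
        by (intro power_mono) auto
      have "0 \<le> (1 + c * ln (level_scale \<gamma> k)) * (level_scale \<gamma> k + 2)\<^sup>2"
        using c level_scale_ge_1[OF \<gamma>, of k] by (intro mult_nonneg_nonneg add_nonneg_nonneg) auto
      moreover have "0 < (level_scale \<gamma> k powr \<gamma>)\<^sup>2"
        using level_scale_pos[OF \<gamma>, of k] by simp
      ultimately show ?thesis unfolding B_def by (rule frac_le[OF _ num _ den])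
    qed
    show ?thesis
      by (rule tendsto_sandwich[OF _ _ tendsto_const lim]) (use le in \<open>auto simp: hat_t_nonneg\<close>)
  qed
  then have "(\<lambda>k. real_of_int (hat_t \<gamma> (Suc k)) / (real_of_int (hat_d \<gamma> (Suc k)))\<^sup>2 + 1) \<longlonglongrightarrow> 0 + 1"
    by (intro tendsto_intros)
  moreover have "real_of_int (hat_t \<gamma> (Suc k)) / (real_of_int (hat_d \<gamma> (Suc k)))\<^sup>2 + 1
      = real_of_int (hat_t \<gamma> (Suc (Suc k))) / (real_of_int (hat_d \<gamma> (Suc k)))\<^sup>2" for k
    using hat_d_ge_2[OF \<gamma>, of "Suc k"] by (subst (2) hat_t_Suc) (simp add: add_divide_distrib)
  ultimately show ?thesis by (subst filterlim_sequentially_Suc[symmetric]) simp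
qed

lemma hat_d_square_at_top:
  assumes \<gamma>: "1 < \<gamma>"
  shows "filterlim (\<lambda>k. (real_of_int (hat_d \<gamma> k))\<^sup>2) at_top sequentially"
proof (rule filterlim_at_top_mono[OF level_scale_at_top[OF \<gamma>] always_eventually], rule allI)
  fix k
  have "level_scale \<gamma> k \<le> real_of_int (hat_d \<gamma> k) * 1" using hat_d_bounds[of \<gamma> k] by simp
  also have "\<dots> \<le> real_of_int (hat_d \<gamma> k) * real_of_int (hat_d \<gamma> k)"
    using hat_d_ge_2[OF \<gamma>, of k] by (intro mult_left_mono) auto
  finally show "level_scale \<gamma> k \<le> (real_of_int (hat_d \<gamma> k))\<^sup>2" by (simp add: power2_eq_square)
qed

lemma hat_t_at_top:
  assumes \<gamma>: "1 < \<gamma>"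
  shows "filterlim (\<lambda>k. real_of_int (hat_t \<gamma> (Suc k))) at_top sequentially"
  by (rule filterlim_at_top_mono[OF hat_d_square_at_top[OF \<gamma>] always_eventually])
     (use hat_t_nonneg in \<open>auto simp: hat_t_Suc\<close>)

lemma hat_t_Suc_pos:
  assumes \<gamma>: "1 < \<gamma>"
  shows "4 \<le> hat_t \<gamma> (Suc k)"
proof -
  have "2\<^sup>2 \<le> (hat_d \<gamma> k)\<^sup>2" using hat_d_ge_2[OF \<gamma>, of k] by (intro power_mono) auto
  then show ?thesis using hat_t_nonneg[of \<gamma> k] by (simp add: hat_t_Suc)
qed

lemma hat_d_square_ge_4: "1 < \<gamma> \<Longrightarrow> 4 \<le> (real_of_int (hat_d \<gamma> k))\<^sup>2"
  using power_mono[of 2 "real_of_int (hat_d \<gamma> k)" 2] hat_d_ge_2[of \<gamma> k] by simp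

text \<open>Since \<open>hat_t\<close> at the end of the strip is asymptotic to
  \<open>hat_d^2\<close>, so is its logarithm to \<open>ln (hat_d^2)\<close>:
  \<open>ln T = ln x * (1 + ln (T / x) / ln x)\<close>.\<close>

lemma eventually_hat_w_large:
  assumes \<gamma>: "1 < \<gamma>" and C: "0 < C" and c: "c < C"
  shows "eventually (\<lambda>k. c < real_of_int (hat_w \<gamma> C k) / sqrt (real_of_int (hat_t \<gamma> (Suc k)) * ln (real_of_int (hat_t \<gamma> (Suc k))))) sequentially"
proof -
  define x where "x = (\<lambda>k. (real_of_int (hat_d \<gamma> k))\<^sup>2)"
  define T where "T = (\<lambda>k. real_of_int (hat_t \<gamma> (Suc k)))"
  have x4: "4 \<le> x k" for k unfolding x_def by (rule hat_d_square_ge_4[OF \<gamma>])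
  have T4: "4 \<le> T k" for k unfolding T_def using hat_t_Suc_pos[OF \<gamma>, of k] by linarith
  have ratio: "(\<lambda>k. T k / x k) \<longlonglongrightarrow> 1" unfolding T_def x_def by (rule hat_t_ratio[OF \<gamma>])
  have "filterlim (\<lambda>k. ln (x k)) at_top sequentially"
    using filterlim_compose[OF ln_at_top hat_d_square_at_top[OF \<gamma>]] by (simp add: x_def)
  then have "(\<lambda>k. ln (T k / x k) / ln (x k)) \<longlonglongrightarrow> 0"
    using tendsto_ln[OF ratio] by (intro tendsto_divide_0[of _ "ln 1"] filterlim_at_top_imp_at_infinity) auto
  then have "(\<lambda>k. C / sqrt (T k / x k * (1 + ln (T k / x k) / ln (x k)))) \<longlonglongrightarrow> C / sqrt (1 * (1 + 0))"
    by (intro tendsto_intros ratio) auto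
  then have "eventually (\<lambda>k. c < C / sqrt (T k / x k * (1 + ln (T k / x k) / ln (x k)))) sequentially"
    using c by (intro order_tendstoD(1)) auto
  then show ?thesis
  proof eventually_elim
    case (elim k)
    have lnx: "0 < ln (x k)" using x4[of k] by simp
    have lnT: "0 < ln (T k)" using T4[of k] by simp
    have "T k / x k * (1 + ln (T k / x k) / ln (x k)) = (T k * ln (T k)) / (x k * ln (x k))"
      using x4[of k] T4[of k] lnx by (simp add: ln_div field_simps)
    then have "c < C * sqrt (x k * ln (x k)) / sqrt (T k * ln (T k))"
      using elim by (simp add: real_sqrt_divide)
    also have "\<dots> \<le> real_of_int (hat_w \<gamma> C k) / sqrt (T k * ln (T k))"
      using hat_w_bounds[of C \<gamma> k] T4[of k] lnT
      by (intro divide_right_mono) (auto simp: gauss_height_def x_def)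
    finally show ?case by (simp add: T_def)
  qed
qed

text \<open>The height exceeds the diffusive scale by the square root of a logarithm. This makes the
  initial condition on the path from the origin almost certain at a high level.\<close>

lemma hat_w_tail_tendsto:
  assumes \<gamma>: "1 < \<gamma>" and C: "0 < C"
  shows "(\<lambda>k. exp (1 - real_of_int (hat_w \<gamma> C k) / sqrt (real_of_int (hat_t \<gamma> (Suc k))))) \<longlonglongrightarrow> 0"
proof -
  define x where "x = (\<lambda>k. (real_of_int (hat_d \<gamma> k))\<^sup>2)"
  define T where "T = (\<lambda>k. real_of_int (hat_t \<gamma> (Suc k)))"
  have x4: "4 \<le> x k" for k unfolding x_def by (rule hat_d_square_ge_4[OF \<gamma>])
  have T4: "4 \<le> T k" for k unfolding T_def using hat_t_Suc_pos[OF \<gamma>, of k] by linarith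
  have ratio: "(\<lambda>k. T k / x k) \<longlonglongrightarrow> 1" unfolding T_def x_def by (rule hat_t_ratio[OF \<gamma>])
  have "filterlim (\<lambda>k. sqrt (ln (x k))) at_top sequentially"
    using filterlim_compose[OF sqrt_at_top filterlim_compose[OF ln_at_top hat_d_square_at_top[OF \<gamma>]]] by (simp add: x_def)
  moreover have "(\<lambda>k. C / sqrt (T k / x k)) \<longlonglongrightarrow> C / sqrt 1"
    by (intro tendsto_intros ratio) auto
  ultimately have "filterlim (\<lambda>k. C / sqrt (T k / x k) * sqrt (ln (x k))) at_top sequentially"
    using C by (intro filterlim_tendsto_pos_mult_at_top[of _ "C / sqrt 1"]) auto
  then have "filterlim (\<lambda>k. real_of_int (hat_w \<gamma> C k) / sqrt (T k)) at_top sequentially"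
  proof (rule filterlim_at_top_mono[OF _ always_eventually], intro allI)
    fix k
    have "C / sqrt (T k / x k) * sqrt (ln (x k)) = C * sqrt (x k * ln (x k)) / sqrt (T k)"
      using x4[of k] T4[of k] by (simp add: real_sqrt_divide real_sqrt_mult field_simps)
    also have "\<dots> \<le> real_of_int (hat_w \<gamma> C k) / sqrt (T k)"
      using hat_w_bounds[of C \<gamma> k] T4[of k] by (intro divide_right_mono) (auto simp: gauss_height_def x_def)
    finally show "C / sqrt (T k / x k) * sqrt (ln (x k)) \<le> real_of_int (hat_w \<gamma> C k) / sqrt (T k)" .
  qed
  then have "filterlim (\<lambda>k. - (real_of_int (hat_w \<gamma> C k) / sqrt (T k))) at_bot sequentially"
    by (simp add: filterlim_uminus_at_top)
  then have "(\<lambda>k. exp 1 * exp (- (real_of_int (hat_w \<gamma> C k) / sqrt (T k)))) \<longlonglongrightarrow> exp 1 * 0"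
    by (intro tendsto_intros filterlim_compose[OF exp_at_bot])
  then show ?thesis unfolding T_def by (simp add: exp_add[symmetric])
qed

text \<open>\<open>x\<close> stands for the scale of a level, \<open>x powr b\<close> for the
  previous one; \<open>U x\<close> bounds \<open>J + r\<close> of the counting lemma including all
  roundings, and \<open>x^2 / 2\<close> bounds \<open>m\<close> from below. Since
  \<open>ln (x^2) = 2 ln x\<close>, the leading term is asymptotic to \<open>C^2 ln x\<close>. The
  cubic term stems from \<open>ln (1 - z) >= - z - 2 z^2\<close>, and \<open>ln 4\<close> from the
  prefactor \<open>1/4\<close>.\<close>

lemma eventually_gauss_exponent_le:
  fixes b C q :: real
  assumes "0 < b" "b < 1" "0 < C" "C\<^sup>2 < q"
  defines "U \<equiv> (\<lambda>x. (gauss_height C (x + 2) + 2 + (gauss_height C (x powr b + 2) + 2) + (x + 2)) / 2)"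
  shows "eventually (\<lambda>x. (U x)\<^sup>2 / (x\<^sup>2 / 2) + 2 * (U x) ^ 3 / (x\<^sup>2 / 2)\<^sup>2 + ln 4 \<le> q * ln x
      \<and> U x / (x\<^sup>2 / 2) \<le> 1/2) at_top"
proof (rule eventually_conj)
  have "((\<lambda>x. ((U x)\<^sup>2 / (x\<^sup>2 / 2) + 2 * (U x) ^ 3 / (x\<^sup>2 / 2)\<^sup>2 + ln 4) / ln x) \<longlongrightarrow> C\<^sup>2) at_top"
    unfolding U_def gauss_height_def using assms(1-4)
    by (real_asymp, simp add: powr_half_sqrt power_mult_distrib power_divide)
  then have "eventually (\<lambda>x. ((U x)\<^sup>2 / (x\<^sup>2 / 2) + 2 * (U x) ^ 3 / (x\<^sup>2 / 2)\<^sup>2 + ln 4) / ln x < q) at_top"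
    using assms by (intro order_tendstoD(2)) auto
  then show "eventually (\<lambda>x. (U x)\<^sup>2 / (x\<^sup>2 / 2) + 2 * (U x) ^ 3 / (x\<^sup>2 / 2)\<^sup>2 + ln 4 \<le> q * ln x) at_top"
    using eventually_gt_at_top[of 1] by eventually_elim (simp add: divide_less_eq)
  have "((\<lambda>x. U x / (x\<^sup>2 / 2)) \<longlongrightarrow> 0) at_top"
    unfolding U_def gauss_height_def using assms by real_asymp
  then have "eventually (\<lambda>x. U x / (x\<^sup>2 / 2) < 1/2) at_top"
    by (intro order_tendstoD(2)) auto
  then show "eventually (\<lambda>x. U x / (x\<^sup>2 / 2) \<le> 1/2) at_top" by eventually_elim simp
qed

text \<open>The path must climb from \<open>- hat_w \<gamma> C k\<close> to above
  \<open>hat_w \<gamma> C (Suc k)\<close>, but the lower height is of smaller order, so the Gaussian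
  exponent is still \<open>C^2\<close>.\<close>

lemma eventually_card_hat_ge:
  assumes \<gamma>: "1 < \<gamma>" and C: "0 < C" and q: "C\<^sup>2 < q"
  shows "eventually (\<lambda>k. level_scale \<gamma> (Suc k) powr (-q) \<le>
    real (card {e \<in> PiE {..<nat ((hat_d \<gamma> (Suc k))\<^sup>2)} (\<lambda>_. {-1, 1::int}).
      hat_w \<gamma> C (Suc k) + hat_w \<gamma> C k < (\<Sum>i<nat ((hat_d \<gamma> (Suc k))\<^sup>2). e i)}) / 2 ^ nat ((hat_d \<gamma> (Suc k))\<^sup>2)) sequentially"
proof -
  define U where "U = (\<lambda>x. (gauss_height C (x + 2) + 2 + (gauss_height C (x powr (1/\<gamma>) + 2) + 2) + (x + 2)) / 2)"
  have "filterlim (\<lambda>k. level_scale \<gamma> (Suc k)) at_top sequentially"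
    using level_scale_at_top[OF \<gamma>] by (rule filterlim_compose) (rule filterlim_Suc)
  moreover have "eventually (\<lambda>x. (U x)\<^sup>2 / (x\<^sup>2 / 2) + 2 * (U x) ^ 3 / (x\<^sup>2 / 2)\<^sup>2 + ln 4 \<le> q * ln x
      \<and> U x / (x\<^sup>2 / 2) \<le> 1/2) at_top"
    unfolding U_def by (rule eventually_gauss_exponent_le) (use \<gamma> C q in auto)
  ultimately have "eventually (\<lambda>k. (U (level_scale \<gamma> (Suc k)))\<^sup>2 / ((level_scale \<gamma> (Suc k))\<^sup>2 / 2)
      + 2 * (U (level_scale \<gamma> (Suc k))) ^ 3 / ((level_scale \<gamma> (Suc k))\<^sup>2 / 2)\<^sup>2 + ln 4 \<le> q * ln (level_scale \<gamma> (Suc k))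
      \<and> U (level_scale \<gamma> (Suc k)) / ((level_scale \<gamma> (Suc k))\<^sup>2 / 2) \<le> 1/2) sequentially"
    unfolding filterlim_iff by blast
  then show ?thesis
  proof eventually_elim
    case (elim k)
    define x where "x = level_scale \<gamma> (Suc k)"
    have x: "1 \<le> x" unfolding x_def by (rule level_scale_ge_1[OF \<gamma>])
    have y: "x powr (1/\<gamma>) = level_scale \<gamma> k"
      using \<gamma> by (simp add: x_def level_scale_def powr_powr)
    have el: "(U x)\<^sup>2 / (x\<^sup>2 / 2) + 2 * (U x) ^ 3 / (x\<^sup>2 / 2)\<^sup>2 + ln 4 \<le> q * ln x" "U x / (x\<^sup>2 / 2) \<le> 1/2"
      using elim by (auto simp: x_def)
    obtain D where D: "hat_d \<gamma> (Suc k) = 2 * D" using even_hat_d[of \<gamma> "Suc k"] by (rule evenE)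
    have D1: "1 \<le> D" using hat_d_ge_2[OF \<gamma>, of "Suc k"] D by simp
    define r where "r = nat D"
    have r: "1 \<le> r" "D = int r" using D1 by (auto simp: r_def)
    \<comment> \<open>With \<open>hat_d = 2 r\<close> there are \<open>2 m = 4 r^2\<close> steps.
      The window of \<open>r\<close> values is then of order \<open>sqrt m\<close>, and the
      prefactor of the counting lemma is at least \<open>1/4\<close>.\<close>
    define m where "m = 2 * r\<^sup>2"
    have m: "nat ((hat_d \<gamma> (Suc k))\<^sup>2) = 2 * m" "1 \<le> m"
    proof -
      have "(hat_d \<gamma> (Suc k))\<^sup>2 = int (2 * m)" unfolding D r by (simp add: m_def power2_eq_square)
      then show "nat ((hat_d \<gamma> (Suc k))\<^sup>2) = 2 * m" by simp
      show "1 \<le> m" using r by (simp add: m_def)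
    qed
    have "even (hat_w \<gamma> C (Suc k) + hat_w \<gamma> C k)" using even_hat_w by simp
    then obtain J' where J': "hat_w \<gamma> C (Suc k) + hat_w \<gamma> C k = 2 * J'" by (rule evenE)
    have "0 \<le> J'" using J' hat_w_pos[OF \<gamma> C, of k] hat_w_pos[OF \<gamma> C, of "Suc k"] by simp
    define J where "J = nat J'"
    have J: "hat_w \<gamma> C (Suc k) + hat_w \<gamma> C k = 2 * int J" using J' \<open>0 \<le> J'\<close> by (simp add: J_def)
    define n where "n = J + r"
    define z where "z = real n / real m"
    have d: "real_of_int (hat_d \<gamma> (Suc k)) = 2 * real r" unfolding D r by simp
    have mr: "real m = 2 * (real r)\<^sup>2" by (simp add: m_def)
    have x2: "x\<^sup>2 / 2 \<le> real m"
    proof -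
      have "x\<^sup>2 \<le> (2 * real r)\<^sup>2"
        using hat_d_bounds[of \<gamma> "Suc k"] x unfolding d x_def by (intro power_mono) auto
      then show ?thesis unfolding mr by (simp add: power_mult_distrib)
    qed
    have nU: "real n \<le> U x"
    proof -
      have "gauss_height C (real_of_int (hat_d \<gamma> (Suc k))) \<le> gauss_height C (x + 2)"
        using hat_d_bounds[of \<gamma> "Suc k"] hat_d_ge_2[OF \<gamma>, of "Suc k"] C
        by (intro gauss_height_mono) (auto simp: x_def)
      moreover have "gauss_height C (real_of_int (hat_d \<gamma> k)) \<le> gauss_height C (x powr (1/\<gamma>) + 2)"
        using hat_d_bounds[of \<gamma> k] hat_d_ge_2[OF \<gamma>, of k] C unfolding y
        by (intro gauss_height_mono) auto
      moreover have "2 * real r \<le> x + 2" using hat_d_bounds[of \<gamma> "Suc k"] unfolding d x_def by simp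
      moreover have "2 * real J = real_of_int (hat_w \<gamma> C (Suc k)) + real_of_int (hat_w \<gamma> C k)"
        unfolding of_int_add[symmetric] J by simp
      ultimately show ?thesis
        using hat_w_bounds[of C \<gamma> k] hat_w_bounds[of C \<gamma> "Suc k"] unfolding U_def n_def by simp
    qed
    have x2pos: "0 < x\<^sup>2 / 2" using x by simp
    have zU: "z \<le> U x / (x\<^sup>2 / 2)"
      unfolding z_def using nU x2 x2pos by (intro frac_le) auto
    have z: "0 \<le> z" "z \<le> 1/2" using order_trans[OF zU el(2)] by (simp_all add: z_def)
    then have "real n \<le> real m" using m by (simp add: z_def divide_le_eq)
    then have nm: "J + r \<le> m" by (simp add: n_def)
    have "real n * (z + 2 * z\<^sup>2) \<le> (U x)\<^sup>2 / (x\<^sup>2 / 2) + 2 * (U x) ^ 3 / (x\<^sup>2 / 2)\<^sup>2"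
    proof -
      have "real n * (z + 2 * z\<^sup>2) \<le> U x * (U x / (x\<^sup>2 / 2) + 2 * (U x / (x\<^sup>2 / 2))\<^sup>2)"
        using nU zU z by (intro mult_mono add_mono power_mono mult_left_mono) auto
      also have "\<dots> = (U x)\<^sup>2 / (x\<^sup>2 / 2) + 2 * (U x) ^ 3 / (x\<^sup>2 / 2)\<^sup>2"
        by (simp add: power_divide distrib_left power2_eq_square power3_eq_cube mult_ac)
      finally show ?thesis .
    qed
    then have ex: "real n * (z + 2 * z\<^sup>2) + ln 4 \<le> q * ln x" using el by linarith
    have "x powr (-q) = exp (- (q * ln x))" using x by (simp add: powr_def)
    also have "\<dots> \<le> exp (- (real n * (z + 2 * z\<^sup>2) + ln 4))" using ex by simp
    also have "\<dots> = 1/4 * exp (real n * (- z - 2 * z\<^sup>2))"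
      by (simp add: exp_minus exp_add field_simps exp_diff)
    also have "\<dots> \<le> 1/4 * exp (real n * ln (1 - z))"
      using ln_one_minus_pos_lower_bound[OF z] by (simp add: mult_left_mono)
    also have "exp (real n * ln (1 - z)) = (1 - z) ^ n"
      using z by (simp add: exp_of_nat_mult)
    also have "1/4 * (1 - z) ^ n \<le> real r / (2 * sqrt (real m)) * (1 - z) ^ n"
    proof (rule mult_right_mono)
      have "sqrt (real m) \<le> sqrt ((2 * real r)\<^sup>2)" unfolding mr by (intro real_sqrt_le_mono) (simp add: power_mult_distrib)
      then have "sqrt (real m) \<le> 2 * real r" by (simp only: real_sqrt_abs)
      then show "1/4 \<le> real r / (2 * sqrt (real m))" using m by (simp add: divide_simps)
    qed (use z in simp)
    also have "\<dots> \<le> real (card {e \<in> PiE {..<2 * m} (\<lambda>_. {-1, 1::int}). 2 * int J < (\<Sum>i<2 * m. e i)}) / 2 ^ (2 * m)"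
      unfolding z_def n_def by (rule card_sign_sequences_ge[OF nm m(2)])
    finally show ?case unfolding J m(1) x_def .
  qed
qed

section \<open>The dimension bound\<close>


lemma Limsup_ge_along_hat_t:
  fixes f :: "real \<Rightarrow> real"
  assumes \<gamma>: "1 < \<gamma>" and C: "0 < C"
    and f: "\<And>k. k0 \<le> k \<Longrightarrow> real_of_int (hat_w \<gamma> C k) < f (real_of_int (hat_t \<gamma> (Suc k)))"
  shows "ereal C \<le> Limsup at_top (\<lambda>t. ereal (f t / sqrt (t * ln t)))"
proof (rule dense_le)
  fix y assume y: "y < ereal C"
  show "y \<le> Limsup at_top (\<lambda>t. ereal (f t / sqrt (t * ln t)))"
  proof (cases y)
    case (real c)
    then have c: "c < C" using y by simp
    show ?thesis
      unfolding Limsup_def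
    proof (rule INF_greatest)
      fix P :: "real \<Rightarrow> bool" assume "P \<in> {P. eventually P at_top}"
      then have "eventually (\<lambda>k. P (real_of_int (hat_t \<gamma> (Suc k)))) sequentially"
        using hat_t_at_top[OF \<gamma>] unfolding filterlim_iff by auto
      then have "eventually (\<lambda>k. P (real_of_int (hat_t \<gamma> (Suc k))) \<and> k0 \<le> k \<and>
          c < real_of_int (hat_w \<gamma> C k) / sqrt (real_of_int (hat_t \<gamma> (Suc k)) * ln (real_of_int (hat_t \<gamma> (Suc k))))) sequentially"
        using eventually_hat_w_large[OF \<gamma> C c] eventually_ge_at_top[of k0] by eventually_elim auto
      then obtain k where k: "P (real_of_int (hat_t \<gamma> (Suc k)))" "k0 \<le> k"
          "c < real_of_int (hat_w \<gamma> C k) / sqrt (real_of_int (hat_t \<gamma> (Suc k)) * ln (real_of_int (hat_t \<gamma> (Suc k))))"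
        using eventually_happens trivial_limit_sequentially by blast
      define T where "T = real_of_int (hat_t \<gamma> (Suc k))"
      have T: "4 \<le> T" unfolding T_def using hat_t_Suc_pos[OF \<gamma>, of k] by linarith
      have "real_of_int (hat_w \<gamma> C k) / sqrt (T * ln T) \<le> f T / sqrt (T * ln T)"
        using f[OF k(2)] T by (intro divide_right_mono) (auto simp: T_def)
      then have "y \<le> ereal (f T / sqrt (T * ln T))" using k(3) real by (simp add: T_def)
      also have "\<dots> \<le> (SUP t\<in>Collect P. ereal (f t / sqrt (t * ln t)))"
        using k(1) by (intro SUP_upper) (simp add: T_def)
      finally show "y \<le> (SUP t\<in>Collect P. ereal (f t / sqrt (t * ln t)))" .
    qed
  qed (use y in auto)
qed

lemma hausdorff_dim_ge:
  assumes "\<And>t. 0 \<le> t \<Longrightarrow> t < \<eta> \<Longrightarrow> hausdorff_measure t A \<noteq> 0"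
  shows "ereal \<eta> \<le> hausdorff_dim A"
  unfolding hausdorff_dim_def
proof (rule Inf_greatest)
  fix x assume "x \<in> ereal ` {s. 0 \<le> s \<and> hausdorff_measure s A = 0}"
  then obtain s where "x = ereal s" "0 \<le> s" "hausdorff_measure s A = 0" by auto
  then show "ereal \<eta> \<le> x" using assms[of s] by (cases "s < \<eta>") auto
qed

text \<open>All requirements are open or slack at \<open>q = C^2\<close>. The hypothesis on
  \<open>a\<close> provides the room for the bound on \<theta>; for the last inequality,
  \<open>\<gamma> powr (3/2) <= \<gamma>^2\<close> and \<open>2 (\<gamma> - 1) < \<gamma>^2\<close>,
  the latter from \<open>(\<gamma> - 1)^2 + 1 > 0\<close>.\<close>

lemma level_exponent_exists:
  fixes \<gamma> C a :: real
  assumes \<gamma>: "1 < \<gamma>" and C: "0 < C" and a: "0 < a" and ineq: "0 < a * (1 - \<gamma> powr (-3/2)) - 2 * C\<^sup>2"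
  shows "\<exists>q. C\<^sup>2 < q \<and> 2 * q < a \<and> \<gamma> powr (-3/2) \<le> 1 - 2 * q / a
    \<and> q * (2 + \<gamma> powr (3/2) / (\<gamma> - 1)) < 2 * \<gamma>\<^sup>2 * C\<^sup>2 / (\<gamma> - 1)"
proof -
  define u where "u = a * (1 - \<gamma> powr (-3/2)) / 2"
  define B where "B = 2 + \<gamma> powr (3/2) / (\<gamma> - 1)"
  define v where "v = 2 * \<gamma>\<^sup>2 * C\<^sup>2 / (\<gamma> - 1) / B"
  have B: "0 < B" unfolding B_def using \<gamma> by (intro add_pos_nonneg) auto
  have "\<gamma> powr (3/2) \<le> \<gamma> powr 2" using \<gamma> by (intro powr_mono) auto
  then have "\<gamma> powr (3/2) \<le> \<gamma>\<^sup>2" using \<gamma> by (simp add: powr_numeral)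
  moreover have "0 < (\<gamma> - 1)\<^sup>2 + 1" by (rule add_nonneg_pos) auto
  then have "2 * (\<gamma> - 1) < \<gamma>\<^sup>2" by (simp add: power2_eq_square algebra_simps)
  ultimately have "B * (\<gamma> - 1) < 2 * \<gamma>\<^sup>2" using \<gamma> by (simp add: B_def distrib_right)
  then have "C\<^sup>2 * (B * (\<gamma> - 1)) < C\<^sup>2 * (2 * \<gamma>\<^sup>2)" using C by (intro mult_strict_left_mono) auto
  then have "C\<^sup>2 < v" using \<gamma> B by (simp add: v_def field_simps)
  moreover have "C\<^sup>2 < u" using ineq by (simp add: u_def)
  ultimately obtain q where q: "C\<^sup>2 < q" "q < min u v" using dense[of "C\<^sup>2" "min u v"] by auto
  have "0 < \<gamma> powr (-3/2)" using \<gamma> by simp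
  then have "u < a / 2" using a by (simp add: u_def)
  moreover have "\<gamma> powr (-3/2) \<le> 1 - 2 * q / a" using q a by (simp add: u_def field_simps)
  moreover have "q * B < 2 * \<gamma>\<^sup>2 * C\<^sup>2 / (\<gamma> - 1)"
  proof -
    have "q * B < v * B" using q B by (intro mult_strict_right_mono) auto
    then show ?thesis using B by (simp add: v_def)
  qed
  ultimately show ?thesis using q unfolding B_def by (intro exI[of _ q]) auto
qed

section \<open>Chaining the rectangle events\<close>

context dynamical_discrete_web
begin

lemma web_path_of_int:
  assumes "snd z \<le> T"
  shows "web_path gap mark z \<tau> \<omega> (real_of_int T) = real_of_int (path_end z (nat (T - snd z)) \<tau> \<omega>)"
  unfolding web_path_def path_end_def by (rule arrow_path_of_int[OF assms])

lemma hat_A_eq: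
  "hat_A M gap mark \<gamma> C k \<tau> = {\<omega> \<in> space M. hat_w \<gamma> C k < path_end (hat_l \<gamma> C k) (nat ((hat_d \<gamma> k)\<^sup>2)) \<tau> \<omega>}"
  unfolding hat_A_def
  by (subst web_path_of_int) (simp_all add: hat_l_def hat_t_Suc)

lemma hat_l_even: "hat_l \<gamma> C k \<in> even_sites"
  using even_hat_w even_hat_t by (simp add: hat_l_def even_sites_def)

lemma origin_even: "(0, 0) \<in> even_sites"
  by (simp add: even_sites_def)

text \<open>The starting point of each rectangle path lies weakly to the left of the path from the
  origin, so by non-crossing the latter also ends above the height of that rectangle. A position
  above the positive height is to the right of the next starting point, which closes the
  induction.\<close>

lemma path_chain:
  assumes \<gamma>: "1 < \<gamma>" and C: "0 < C" and \<omega>: "\<omega> \<in> space M"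
    and start: "- hat_w \<gamma> C K \<le> path_end (0, 0) (nat (hat_t \<gamma> (Suc K))) \<tau> \<omega>"
    and rect: "\<And>k. Suc K \<le> k \<Longrightarrow> hat_w \<gamma> C k < path_end (hat_l \<gamma> C k) (nat ((hat_d \<gamma> k)\<^sup>2)) \<tau> \<omega>"
    and "Suc K \<le> k"
  shows "hat_w \<gamma> C k < path_end (0, 0) (nat (hat_t \<gamma> (Suc k))) \<tau> \<omega>"
proof -
  define a where "a = arrow \<tau> \<omega>"
  have a: "a w \<in> {-1, 1}" if "w \<in> even_sites" for w unfolding a_def by (rule xi_sign[OF that \<omega>])
  have crossing: "hat_w \<gamma> C (Suc k) < path_end (0, 0) (nat (hat_t \<gamma> (Suc (Suc k)))) \<tau> \<omega>"
    if le: "- hat_w \<gamma> C k \<le> path_end (0, 0) (nat (hat_t \<gamma> (Suc k))) \<tau> \<omega>" and k: "K \<le> k" for k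
  proof -
    define u where "u = (arrow_step a ^^ nat (hat_t \<gamma> (Suc k))) (0, 0)"
    have "nat (hat_t \<gamma> (Suc (Suc k))) = nat ((hat_d \<gamma> (Suc k))\<^sup>2) + nat (hat_t \<gamma> (Suc k))"
      unfolding hat_t_Suc[of \<gamma> "Suc k"] using hat_t_nonneg[of \<gamma> "Suc k"] by (simp add: nat_add_distrib)
    then have eq: "path_end (0, 0) (nat (hat_t \<gamma> (Suc (Suc k)))) \<tau> \<omega> = fst ((arrow_step a ^^ nat ((hat_d \<gamma> (Suc k))\<^sup>2)) u)"
      unfolding path_end_def u_def a_def by (simp add: funpow_add)
    have u_even: "u \<in> even_sites" unfolding u_def by (rule funpow_arrow_step_even[OF a origin_even])
    have "snd u = hat_t \<gamma> (Suc k)" using hat_t_nonneg[of \<gamma> "Suc k"] by (simp add: u_def)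
    then have snd_eq: "snd (hat_l \<gamma> C (Suc k)) = snd u" by (simp add: hat_l_def)
    have fst_le: "fst (hat_l \<gamma> C (Suc k)) \<le> fst u" using le by (simp add: hat_l_def u_def path_end_def a_def)
    have "hat_w \<gamma> C (Suc k) < path_end (hat_l \<gamma> C (Suc k)) (nat ((hat_d \<gamma> (Suc k))\<^sup>2)) \<tau> \<omega>"
      using k by (intro rect) simp
    also have "\<dots> \<le> fst ((arrow_step a ^^ nat ((hat_d \<gamma> (Suc k))\<^sup>2)) u)"
      unfolding path_end_def a_def[symmetric]
      by (rule funpow_arrow_step_mono[OF a hat_l_even u_even snd_eq fst_le])
    finally show ?thesis unfolding eq .
  qed
  have "hat_w \<gamma> C (Suc k') < path_end (0, 0) (nat (hat_t \<gamma> (Suc (Suc k')))) \<tau> \<omega>" if "K \<le> k'" for k'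
    using that
  proof (induction k' rule: dec_induct)
    case base
    show ?case by (rule crossing[OF start]) simp
  next
    case (step k')
    have "- hat_w \<gamma> C (Suc k') \<le> path_end (0, 0) (nat (hat_t \<gamma> (Suc (Suc k')))) \<tau> \<omega>"
      using step.IH hat_w_pos[OF \<gamma> C, of "Suc k'"] by linarith
    then show ?case by (rule crossing) (use step in simp)
  qed
  then show ?thesis using \<open>Suc K \<le> k\<close> by (cases k) auto
qed

end



context dynamical_discrete_web
begin

abbreviation large_times :: "real \<Rightarrow> 'a \<Rightarrow> real set" where
  "large_times C \<omega> \<equiv> {\<tau>::real. 0 \<le> \<tau> \<and>
     Limsup at_top (\<lambda>t::real. ereal (web_path gap mark (0, 0) \<tau> \<omega> t / sqrt (t * ln t))) \<ge> ereal C}"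

abbreviation nonnull_upto :: "real \<Rightarrow> real \<Rightarrow> 'a \<Rightarrow> bool" where
  "nonnull_upto C s \<omega> \<equiv> \<forall>t. 0 \<le> t \<longrightarrow> t \<le> s \<longrightarrow> hausdorff_measure t (large_times C \<omega>) \<noteq> 0"

lemma AE_space_Un_events:
  assumes A: "\<And>n::nat. A n \<in> events" and p: "\<And>n. 1 - 1 / (real n + 1) \<le> prob (A n)"
  shows "AE \<omega> in M. \<exists>n. \<omega> \<in> A n"
proof -
  have U: "(\<Union>n. A n) \<in> events" using A by auto
  have "1 - 1 / (real n + 1) \<le> prob (\<Union>n. A n)" for n
    using order_trans[OF p finite_measure_mono[OF UN_upper U]] by simp
  moreover have "(\<lambda>n. 1 - 1 / (real n + 1)) \<longlonglongrightarrow> 1" by real_asymp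
  ultimately have "1 \<le> prob (\<Union>n. A n)" by (intro LIMSEQ_le_const2) auto
  then have "prob (\<Union>n. A n) = 1" using prob_le_1[of "\<Union>n. A n"] by linarith
  then have "AE \<omega> in M. \<omega> \<in> (\<Union>n. A n)" using U by (simp add: prob_eq_1)
  then show ?thesis by simp
qed

text \<open>Levels up to \<open>K\<close> are replaced by one initial condition of probability close
  to \<open>1\<close>; only then is the second moment close to the squared first moment. The
  conclusion is an almost sure implication on a measurable \<open>A\<close>, because the set of
  sample points with \<open>nonnull_upto\<close> is not shown to be measurable.\<close>

lemma large_times_positive_measure_event:
  fixes \<gamma> C a' s \<epsilon> :: real
  assumes \<gamma>: "1 < \<gamma>" and C: "0 < C" and a': "0 < a'" and c': "0 < c'"
    and corr: "\<And>k \<tau> \<tau>'. 1 \<le> k \<Longrightarrow> 0 \<le> \<tau> \<Longrightarrow> 0 \<le> \<tau>' \<Longrightarrow> \<tau> \<noteq> \<tau>' \<Longrightarrow>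
       prob (hat_A M gap mark \<gamma> C k \<tau> \<inter> hat_A M gap mark \<gamma> C k \<tau>')
         \<le> (prob (hat_A M gap mark \<gamma> C k 0))\<^sup>2 + c' * (1 / (real_of_int (hat_d \<gamma> k) * \<bar>\<tau> - \<tau>'\<bar>)) powr a'"
    and ineq: "0 < a' * (1 - \<gamma> powr (-3/2)) - 2 * C\<^sup>2"
    and s: "0 < s" "s + 2 * \<gamma>\<^sup>2 * C\<^sup>2 / (\<gamma> - 1) < 1" and \<epsilon>: "0 < \<epsilon>"
  shows "\<exists>A\<in>events. 1 - \<epsilon> \<le> prob A \<and>
    (AE \<omega> in M. \<omega> \<in> A \<longrightarrow> nonnull_upto C s \<omega>)"
proof -
  define \<rho> where "\<rho> = 2 * \<gamma>\<^sup>2 * C\<^sup>2 / (\<gamma> - 1)"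
  have \<rho>: "0 \<le> \<rho>" "s + \<rho> < 1" using \<gamma> s by (auto simp: \<rho>_def)
  obtain q where q: "C\<^sup>2 < q" "2 * q < a'" "\<gamma> powr (-3/2) \<le> 1 - 2 * q / a'"
      "q * (2 + \<gamma> powr (3/2) / (\<gamma> - 1)) < \<rho>"
    using level_exponent_exists[OF \<gamma> C a' ineq] unfolding \<rho>_def by auto
  have q0: "0 < q" using q(1) zero_le_power2[of C] by linarith
  \<comment> \<open>The combined factor will be \<open>1 + 3 \<delta> h powr (-\<rho>)\<close>;
    \<open>48 = 2 * 8 * 3\<close> makes the Chebyshev loss at most \<open>\<epsilon> / 2\<close>,
    leaving the other half to the energy.\<close>
  define \<delta> where "\<delta> = min 1 (\<epsilon> * (1 - \<rho>) / 48)"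
  have \<delta>: "0 < \<delta>" "\<delta> \<le> 1" "8 * (3 * \<delta>) / (1 - \<rho>) \<le> \<epsilon> / 2"
    using \<epsilon> \<rho> s by (auto simp: \<delta>_def min_def field_simps)
  define p where "p = (\<lambda>k. prob (hat_A M gap mark \<gamma> C k 0))"
  have p_eq: "p k = prob {\<omega> \<in> space M. hat_w \<gamma> C k < path_end (hat_l \<gamma> C k) (nat ((hat_d \<gamma> k)\<^sup>2)) \<tau> \<omega>}" for k \<tau>
    unfolding p_def hat_A_eq prob_path_end[OF hat_l_even] ..
  have p_card: "p (Suc k) = real (card {e \<in> PiE {..<nat ((hat_d \<gamma> (Suc k))\<^sup>2)} (\<lambda>_. {-1, 1::int}).
      hat_w \<gamma> C (Suc k) + hat_w \<gamma> C k < (\<Sum>i<nat ((hat_d \<gamma> (Suc k))\<^sup>2). e i)}) / 2 ^ nat ((hat_d \<gamma> (Suc k))\<^sup>2)" for k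
  proof -
    have "x < fst (hat_l \<gamma> C (Suc k)) + y \<longleftrightarrow> x + hat_w \<gamma> C k < y" for x y
      by (auto simp: hat_l_def)
    then show ?thesis unfolding p_def hat_A_eq prob_path_end[OF hat_l_even] by simp
  qed
  obtain K1 where K1: "\<And>k. k \<ge> K1 \<Longrightarrow> level_scale \<gamma> (Suc k) powr (-q) \<le> p (Suc k)"
    using eventually_card_hat_ge[OF \<gamma> C q(1)] unfolding p_card eventually_sequentially by auto
  obtain K2 where K2: "\<And>k0 n h. k0 \<ge> K2 \<Longrightarrow> 0 < h \<Longrightarrow> h \<le> 1 \<Longrightarrow>
      (\<Prod>k\<in>{k0..n}. level_bound \<gamma> q a' c' k h) \<le> 1 + \<delta> * h powr (-\<rho>)"
    using prod_level_bound_near_1[OF \<gamma> q0 q(2) c' refl q(3) q(4) \<delta>(1)] by blast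
  have "eventually (\<lambda>k. exp (1 - real_of_int (hat_w \<gamma> C k) / sqrt (real_of_int (hat_t \<gamma> (Suc k)))) < \<delta> / 2) sequentially"
    using hat_w_tail_tendsto[OF \<gamma> C] \<delta> by (intro order_tendstoD(2)) auto
  then obtain K3 where K3: "\<And>k. k \<ge> K3 \<Longrightarrow> exp (1 - real_of_int (hat_w \<gamma> C k) / sqrt (real_of_int (hat_t \<gamma> (Suc k)))) < \<delta> / 2"
    unfolding eventually_sequentially by auto
  define K where "K = max K1 (max K2 K3)"
  have KK: "K1 \<le> K" "K2 \<le> K" "K3 \<le> K" by (auto simp: K_def)
  define z where "z = (\<lambda>j. if j = 0 then (0, 0) else hat_l \<gamma> C (K + j))"
  define N where "N = (\<lambda>j. if j = 0 then nat (hat_t \<gamma> (Suc K)) else nat ((hat_d \<gamma> (K + j))\<^sup>2))"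
  \<comment> \<open>Index \<open>0\<close> is the initial condition and \<open>j > 0\<close> the
    rectangle of level \<open>K + j\<close>. The extra \<open>- 1\<close> turns the common strict
    inequality into the weak one \<open>- hat_w \<gamma> C K <= path_end\<close>.\<close>
  define c where "c = (\<lambda>j. if j = 0 then - hat_w \<gamma> C K - 1 else hat_w \<gamma> C (K + j))"
  let ?F = "\<lambda>x \<omega> j. c j < path_end (z j) (N j) x \<omega>"
  define P where "P = (\<lambda>j. prob {\<omega> \<in> space M. ?F 0 \<omega> j})"
  define Q where "Q = (\<lambda>x y j. prob {\<omega> \<in> space M. ?F x \<omega> j \<and> ?F y \<omega> j})"
  have z_even: "z j \<in> even_sites" for j by (simp add: z_def hat_l_even origin_even)
  have P_eq: "prob {\<omega> \<in> space M. ?F \<tau> \<omega> j} = P j" for j \<tau>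
    unfolding P_def prob_path_end[OF z_even] ..
  have P_p: "P j = p (K + j)" if "j \<noteq> 0" for j
    using that p_eq[of "K + j" 0] by (simp add: P_def c_def z_def N_def)
  have strips: "disjoint_family_on (\<lambda>j. {snd (z j)..<snd (z j) + int (N j)}) L" for L
  proof -
    have hi: "snd (z j) + int (N j) = hat_t \<gamma> (K + Suc j)" for j
      using hat_t_nonneg[of \<gamma> "Suc K"] by (simp add: z_def N_def hat_l_def hat_t_Suc)
    have "{snd (z i)..<snd (z i) + int (N i)} \<inter> {snd (z j)..<snd (z j) + int (N j)} = {}" if "i < j" for i j
    proof -
      have "snd (z j) = hat_t \<gamma> (K + j)" using that by (simp add: z_def hat_l_def)
      moreover have "hat_t \<gamma> (K + Suc i) \<le> hat_t \<gamma> (K + j)" using that by (intro hat_t_mono) simp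
      ultimately show ?thesis unfolding hi by auto
    qed
    then show ?thesis
      unfolding disjoint_family_on_def by (intro ballI impI) (metis Int_commute linorder_neqE_nat)
  qed
  have P0: "1 - \<delta> / 2 \<le> P 0"
  proof -
    have "1 \<le> N 0" using hat_t_Suc_pos[OF \<gamma>, of K] by (simp add: N_def)
    from card_sign_sequences_tail[OF this, of "c 0"]
    have "1 - exp (1 + real_of_int (c 0) / sqrt (real (N 0))) \<le> P 0"
      unfolding P_def prob_path_end[OF z_even] by (simp add: z_def)
    moreover have "exp (1 + real_of_int (c 0) / sqrt (real (N 0))) \<le> exp (1 - real_of_int (hat_w \<gamma> C K) / sqrt (real_of_int (hat_t \<gamma> (Suc K))))"
    proof -
      have "real (N 0) = real_of_int (hat_t \<gamma> (Suc K))" using hat_t_nonneg[of \<gamma> "Suc K"] by (simp add: N_def)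
      moreover have "real_of_int (c 0) / x \<le> - (real_of_int (hat_w \<gamma> C K) / x)" if "0 \<le> x" for x
        using that divide_right_mono[of "real_of_int (c 0)" "- real_of_int (hat_w \<gamma> C K)" x] by (simp add: c_def)
      ultimately show ?thesis using hat_t_nonneg[of \<gamma> "Suc K"] by simp
    qed
    ultimately show ?thesis using K3[OF KK(3)] by linarith
  qed
  have P_pos: "0 < P j" for j
  proof (cases j)
    case 0
    then show ?thesis using P0 \<delta> by simp
  next
    case (Suc i)
    have "0 < level_scale \<gamma> (Suc (K + i)) powr (-q)" using level_scale_pos[OF \<gamma>, of "Suc (K + i)"] by simp
    also have "\<dots> \<le> p (Suc (K + i))" using KK(1) by (intro K1) simp
    also have "\<dots> = P j" using P_p[of j] Suc by simp
    finally show ?thesis .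
  qed
  have meas: "{\<omega> \<in> space M. ?F x \<omega> j} \<in> events" for j x
    by (rule path_end_measurable[OF z_even])
  have Q_le_P: "Q x y j \<le> P j" for x y j
    unfolding Q_def P_eq[symmetric, of j x] by (rule finite_measure_mono) (use meas in auto)
  have Q_le: "Q x y j \<le> (P j)\<^sup>2 * level_bound \<gamma> q a' c' (K + j) \<bar>x - y\<bar>"
    if xy: "x \<in> {0..1}" "y \<in> {0..1}" "x \<noteq> y" and j: "j \<noteq> 0" for x y j
  proof -
    define D where "D = level_scale \<gamma> (K + j)"
    define h where "h = \<bar>x - y\<bar>"
    have h: "0 < h" using xy by (simp add: h_def)
    have D: "0 < D" unfolding D_def by (rule level_scale_pos[OF \<gamma>])
    obtain i where i: "j = Suc i" using j by (cases j) auto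
    have "D powr (-q) \<le> P j"
      using K1[of "K + i"] KK(1) P_p[OF j] i by (simp add: D_def)
    then have inv: "1 / P j \<le> D powr q"
      using P_pos[of j] D by (simp add: powr_minus field_simps)
    have b1: "Q x y j \<le> (P j)\<^sup>2 * D powr q"
    proof -
      have "Q x y j \<le> (P j)\<^sup>2 * (1 / P j)" using Q_le_P[of x y j] P_pos[of j] by (simp add: power2_eq_square)
      also have "\<dots> \<le> (P j)\<^sup>2 * D powr q" using inv by (intro mult_left_mono) auto
      finally show ?thesis .
    qed
    have b2: "Q x y j \<le> (P j)\<^sup>2 * (1 + c' * D powr (2 * q - a') * h powr (-a'))"
    proof -
      have "Q x y j = prob (hat_A M gap mark \<gamma> C (K + j) x \<inter> hat_A M gap mark \<gamma> C (K + j) y)"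
        unfolding Q_def hat_A_eq using j by (intro arg_cong[where f = prob]) (auto simp: c_def z_def N_def)
      also have "\<dots> \<le> (P j)\<^sup>2 + c' * (1 / (real_of_int (hat_d \<gamma> (K + j)) * h)) powr a'"
        unfolding P_p[OF j] p_def h_def using xy j by (intro corr) auto
      also have "\<dots> \<le> (P j)\<^sup>2 + c' * (1 / (D * h)) powr a'"
        using hat_d_bounds[of \<gamma> "K + j"] h D c' a'
        by (intro add_left_mono mult_left_mono powr_mono2 divide_left_mono mult_right_mono) (auto simp: D_def)
      also have "(1 / (D * h)) powr a' = D powr (-a') * h powr (-a')"
        using D h by (simp add: powr_divide powr_mult powr_minus_divide)
      \<comment> \<open>The hypothesis bounds an additive error; \<open>1 <= P j * D powr q\<close>
        makes it relative to \<open>(P j)^2\<close>.\<close>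
      also have "(P j)\<^sup>2 + c' * (D powr (-a') * h powr (-a')) \<le> (P j)\<^sup>2 + c' * ((P j)\<^sup>2 * D powr (2 * q) * (D powr (-a') * h powr (-a')))"
      proof -
        have "1 \<le> P j * D powr q" using inv P_pos[of j] by (simp add: field_simps)
        then have "1\<^sup>2 \<le> (P j * D powr q)\<^sup>2" by (intro power_mono) auto
        also have "\<dots> = (P j)\<^sup>2 * D powr (2 * q)"
          using D by (simp add: power_mult_distrib powr_power mult.commute)
        finally have "1 * (D powr (-a') * h powr (-a')) \<le> (P j)\<^sup>2 * D powr (2 * q) * (D powr (-a') * h powr (-a'))"
          by (intro mult_right_mono) auto
        then show ?thesis using c' by simp
      qed
      also have "\<dots> = (P j)\<^sup>2 * (1 + c' * D powr (2 * q - a') * h powr (-a'))"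
        by (simp add: powr_diff powr_minus field_simps)
      finally show ?thesis .
    qed
    show ?thesis
      unfolding level_bound_def D_def[symmetric] h_def[symmetric] using b1 b2 by (simp add: min_def)
  qed
  define \<pi> where "\<pi> = (\<lambda>n. \<Prod>j\<in>{..n}. P j)"
  have \<pi>_pos: "0 < \<pi> n" for n unfolding \<pi>_def by (rule prod_pos) (use P_pos in auto)
  define R where "R = (\<lambda>n. {r \<in> space (borel \<Otimes>\<^sub>M M). \<forall>j\<in>{..n}. ?F (fst r) (snd r) j})"
  have R_meas: "R n \<in> sets (borel \<Otimes>\<^sub>M M)" for n
  proof -
    have "R n = (\<Inter>j\<in>{..n}. {r \<in> space (borel \<Otimes>\<^sub>M M). ?F (fst r) (snd r) j})"
      by (auto simp: R_def)
    also have "\<dots> \<in> sets (borel \<Otimes>\<^sub>M M)"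
      by (rule sets.finite_INT) (use path_end_joint_measurable[OF z_even] in auto)
    finally show ?thesis .
  qed
  have R_iff: "(x, \<omega>) \<in> R n \<longleftrightarrow> (\<forall>j\<in>{..n}. ?F x \<omega> j)" if "\<omega> \<in> space M" for x \<omega> n
    using that by (simp add: R_def space_pair_measure)
  have first: "prob {\<omega> \<in> space M. (x, \<omega>) \<in> R n} = \<pi> n" for x n
  proof -
    have "{\<omega> \<in> space M. (x, \<omega>) \<in> R n}
        = {\<omega> \<in> space M. \<forall>j\<in>{..n}. ?F x \<omega> j \<and> ?F x \<omega> j}"
      using R_iff by auto
    also have "prob \<dots> = \<pi> n"
      by (subst prob_strips[OF _ z_even strips]) (simp_all add: \<pi>_def P_eq)
    finally show ?thesis .
  qed
  have second: "prob {\<omega> \<in> space M. (x, \<omega>) \<in> R n \<and> (y, \<omega>) \<in> R n} \<le> (\<pi> n)\<^sup>2 * (1 + (3 * \<delta>) * \<bar>x - y\<bar> powr (-\<rho>))"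
    if xy: "x \<in> {0..1}" "y \<in> {0..1}" "x \<noteq> y" for n x y
  proof -
    define h where "h = \<bar>x - y\<bar>"
    have h: "0 < h" "h \<le> 1" using xy by (auto simp: h_def)
    have "{\<omega> \<in> space M. (x, \<omega>) \<in> R n \<and> (y, \<omega>) \<in> R n}
        = {\<omega> \<in> space M. \<forall>j\<in>{..n}. ?F x \<omega> j \<and> ?F y \<omega> j}"
      using R_iff by auto
    also have "prob \<dots> = (\<Prod>j\<in>{..n}. Q x y j)"
      by (subst prob_strips[OF _ z_even strips]) (simp_all add: Q_def)
    also have "\<dots> = Q x y 0 * (\<Prod>j\<in>{Suc 0..n}. Q x y j)"
      by (simp add: atMost_atLeast0 prod.atLeast_Suc_atMost)
    \<comment> \<open>The initial condition has no correlation estimate. Its joint probability is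
      bounded by \<open>P 0\<close> instead of \<open>(P 0)^2\<close>, which costs a factor
      \<open>1 / P 0\<close>, at most \<open>1 + \<delta>\<close>.\<close>
    also have "\<dots> \<le> P 0 * (\<Prod>j\<in>{Suc 0..n}. (P j)\<^sup>2 * level_bound \<gamma> q a' c' (K + j) h)"
    proof (intro mult_mono Q_le_P prod_mono conjI)
      show "Q x y j \<le> (P j)\<^sup>2 * level_bound \<gamma> q a' c' (K + j) h" if "j \<in> {Suc 0..n}" for j
        unfolding h_def by (rule Q_le[OF xy]) (use that in auto)
    qed (auto simp: Q_def P_def intro!: prod_nonneg)
    also have "\<dots> = P 0 * (\<Prod>j\<in>{Suc 0..n}. (P j)\<^sup>2) * (\<Prod>j\<in>{Suc 0..n}. level_bound \<gamma> q a' c' (K + j) h)"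
      by (simp add: prod.distrib)
    also have "(\<Prod>j\<in>{Suc 0..n}. level_bound \<gamma> q a' c' (K + j) h) = (\<Prod>k\<in>{K + Suc 0..K + n}. level_bound \<gamma> q a' c' k h)"
      by (rule prod.reindex_bij_witness[of _ "\<lambda>k. k - K" "\<lambda>j. K + j"]) auto
    also have "P 0 * (\<Prod>j\<in>{Suc 0..n}. (P j)\<^sup>2) * \<dots> \<le> P 0 * (\<Prod>j\<in>{Suc 0..n}. (P j)\<^sup>2) * (1 + \<delta> * h powr (-\<rho>))"
      using P_pos[of 0] h KK(2) by (intro mult_left_mono K2 mult_nonneg_nonneg prod_nonneg) auto
    also have "\<dots> \<le> ((1 + \<delta>) * (P 0)\<^sup>2) * (\<Prod>j\<in>{Suc 0..n}. (P j)\<^sup>2) * (1 + \<delta> * h powr (-\<rho>))"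
    proof -
      have "1 \<le> (1 + \<delta>) * (1 - \<delta> / 2)"
        using \<delta> mult_left_mono[of \<delta> 1 \<delta>] by (simp add: algebra_simps)
      also have "\<dots> \<le> (1 + \<delta>) * P 0" using P0 \<delta> by (intro mult_left_mono) auto
      finally have "P 0 * 1 \<le> P 0 * ((1 + \<delta>) * P 0)" using P_pos[of 0] by (intro mult_left_mono) auto
      then have "P 0 \<le> (1 + \<delta>) * (P 0)\<^sup>2" by (simp add: power2_eq_square mult_ac)
      then show ?thesis using \<delta> by (intro mult_right_mono prod_nonneg add_nonneg_nonneg mult_nonneg_nonneg) auto
    qed
    also have "\<dots> = (\<pi> n)\<^sup>2 * ((1 + \<delta>) * (1 + \<delta> * h powr (-\<rho>)))"
    proof -
      have "\<pi> n = P 0 * (\<Prod>j\<in>{Suc 0..n}. P j)"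
        by (simp add: \<pi>_def atMost_atLeast0 prod.atLeast_Suc_atMost)
      then show ?thesis by (simp add: power_mult_distrib prod_power_distrib mult_ac)
    qed
    also have "\<dots> \<le> (\<pi> n)\<^sup>2 * (1 + (3 * \<delta>) * h powr (-\<rho>))"
    proof (rule mult_left_mono)
      define H where "H = h powr (-\<rho>)"
      have H: "1 \<le> H" using powr_mono2'[of "-\<rho>" h 1] h \<rho> by (simp add: H_def)
      have "\<delta> * (\<delta> * H) \<le> 1 * (\<delta> * H)" using \<delta> H by (intro mult_right_mono) auto
      moreover have "\<delta> * 1 \<le> \<delta> * H" using \<delta> H by (intro mult_left_mono) auto
      ultimately show "(1 + \<delta>) * (1 + \<delta> * h powr (-\<rho>)) \<le> 1 + (3 * \<delta>) * h powr (-\<rho>)"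
        unfolding H_def[symmetric] by (simp add: algebra_simps)
    qed simp
    finally show ?thesis by (simp add: h_def)
  qed
  have "\<exists>b>0. \<exists>A\<in>events. 1 - 8 * (3 * \<delta>) / (1 - \<rho>) - \<epsilon> / 2 \<le> prob A \<and>
     (\<forall>\<omega>\<in>A. \<exists>\<^sub>\<infinity>n. ennreal (1/2) \<le> ennreal (1 / \<pi> n) * emeasure lborel (time_slice (R n) \<omega>)
                   \<and> ennreal ((1 / \<pi> n)\<^sup>2) * riesz_energy s (time_slice (R n) \<omega>) \<le> ennreal b)"
    by (rule frequently_mass_and_energy[OF R_meas first \<pi>_pos second]) (use s \<rho> \<delta> \<epsilon> in auto)
  then obtain b A where b: "0 < b" and A: "A \<in> events" "1 - 8 * (3 * \<delta>) / (1 - \<rho>) - \<epsilon> / 2 \<le> prob A"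
    and freq: "\<And>\<omega>. \<omega> \<in> A \<Longrightarrow> \<exists>\<^sub>\<infinity>n. ennreal (1/2) \<le> ennreal (1 / \<pi> n) * emeasure lborel (time_slice (R n) \<omega>)
                   \<and> ennreal ((1 / \<pi> n)\<^sup>2) * riesz_energy s (time_slice (R n) \<omega>) \<le> ennreal b"
    by blast
  have "AE \<omega> in M. \<omega> \<in> A \<longrightarrow> nonnull_upto C s \<omega>"
    using AE_gap_nonneg AE_space
  proof eventually_elim
    case (elim \<omega>)
    show ?case
    proof (intro impI allI)
      fix t assume \<omega>A: "\<omega> \<in> A" and t: "0 \<le> t" "t \<le> s"
      define E where "E = (\<lambda>n. time_slice (R n) \<omega>)"
      define J where "J = (\<Union>w\<in>even_sites. jump_times (\<lambda>i. gap w i \<omega>))"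
      have E_iff: "\<tau> \<in> E n \<longleftrightarrow> \<tau> \<in> {0..1} \<and> (\<forall>j\<in>{..n}. ?F \<tau> \<omega> j)" for \<tau> n
        using R_iff[OF elim(2)] by (simp add: E_def time_slice_def)
      have E_borel: "E n \<in> sets borel" for n
      proof -
        have "E n = {0..1} \<inter> (\<lambda>\<tau>. (\<tau>, \<omega>)) -` R n" by (auto simp: E_def time_slice_def)
        moreover have "(\<lambda>\<tau>. (\<tau>, \<omega>)) -` R n \<inter> space borel \<in> sets borel"
          by (rule measurable_sets[OF measurable_Pair2'[OF elim(2)] R_meas])
        ultimately show ?thesis by simp
      qed
      have "countable J" unfolding J_def
        by (intro countable_UN countable_jump_times) simp
      have "closure (E n) \<subseteq> E n \<union> (J \<union> {})" for n
      proof -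
        \<comment> \<open>Local constancy of paths excludes new limit points off \<open>J\<close>
          within the unit interval; outside it the closedness of \<open>{0..1}\<close> takes
          over.\<close>
        have "closure (E n) \<subseteq> E n \<union> (J \<union> - {0..1})"
        proof (rule closure_subset_exceptional)
          fix \<tau> assume \<tau>: "\<tau> \<notin> J \<union> - {0..1}" "\<tau> \<notin> E n"
          then obtain j where j: "j \<in> {..n}" "\<not> ?F \<tau> \<omega> j" by (auto simp: E_iff)
          have "eventually (\<lambda>\<tau>'. (arrow_step (arrow \<tau>' \<omega>) ^^ N j) (z j) = (arrow_step (arrow \<tau> \<omega>) ^^ N j) (z j)) (nhds \<tau>)"
            by (rule eventually_path_eq) (use elim mark_sign z_even \<tau> in \<open>auto simp: J_def\<close>)
          then show "eventually (\<lambda>\<tau>'. \<tau>' \<notin> E n) (nhds \<tau>)"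
          proof eventually_elim
            case (elim \<tau>')
            then have "\<not> ?F \<tau>' \<omega> j" using j(2) by (simp add: path_end_def)
            then show ?case using j(1) by (auto simp: E_iff)
          qed
        qed
        moreover have "closure (E n) \<subseteq> {0..1}"
          by (rule closure_minimal) (auto simp: E_iff)
        ultimately show ?thesis by blast
      qed
      then have clos: "closure (E n) \<subseteq> E n \<union> J" for n by simp
      have "hausdorff_measure t (\<Inter>n. E n) \<noteq> 0"
      proof (rule hausdorff_measure_limit_set_nonzero[where c = "\<lambda>n. 1 / \<pi> n" and s = s and b = b and D = J])
        show "E n \<subseteq> {0..1}" for n by (auto simp: E_iff)
        show "decseq E" unfolding decseq_def by (auto simp: E_iff)
        show "\<exists>\<^sub>\<infinity>n. ennreal (1/2) \<le> ennreal (1 / \<pi> n) * emeasure lborel (E n)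
                   \<and> ennreal ((1 / \<pi> n)\<^sup>2) * riesz_energy s (E n) \<le> ennreal b"
          unfolding E_def by (rule freq[OF \<omega>A])
      qed (use E_borel \<open>countable J\<close> clos \<pi>_pos b t s in auto)
      moreover have "(\<Inter>n. E n) \<subseteq> large_times C \<omega>"
      proof
        fix \<tau> assume "\<tau> \<in> (\<Inter>n. E n)"
        then have \<tau>: "0 \<le> \<tau>" "\<And>j. ?F \<tau> \<omega> j" by (auto simp: E_iff)
        have start: "- hat_w \<gamma> C K \<le> path_end (0, 0) (nat (hat_t \<gamma> (Suc K))) \<tau> \<omega>"
          using \<tau>(2)[of 0] by (simp add: c_def z_def N_def)
        have rect: "hat_w \<gamma> C k < path_end (hat_l \<gamma> C k) (nat ((hat_d \<gamma> k)\<^sup>2)) \<tau> \<omega>" if "Suc K \<le> k" for k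
          using \<tau>(2)[of "k - K"] that by (simp add: c_def z_def N_def)
        have "ereal C \<le> Limsup at_top (\<lambda>t. ereal (web_path gap mark (0, 0) \<tau> \<omega> t / sqrt (t * ln t)))"
        proof (rule Limsup_ge_along_hat_t[OF \<gamma> C])
          fix k assume "Suc K \<le> k"
          then have "hat_w \<gamma> C k < path_end (0, 0) (nat (hat_t \<gamma> (Suc k))) \<tau> \<omega>"
            by (intro path_chain[OF \<gamma> C elim(2) start rect])
          then show "real_of_int (hat_w \<gamma> C k) < web_path gap mark (0, 0) \<tau> \<omega> (real_of_int (hat_t \<gamma> (Suc k)))"
            using hat_t_nonneg[of \<gamma> "Suc k"] by (subst web_path_of_int) auto
        qed
        then show "\<tau> \<in> large_times C \<omega>" using \<tau>(1) by simp
      qed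
      ultimately show "hausdorff_measure t (large_times C \<omega>) \<noteq> 0"
        using hausdorff_measure_mono[of "\<Inter>n. E n" "large_times C \<omega>" t] by auto
    qed
  qed
  moreover have "1 - \<epsilon> \<le> prob A" using A(2) \<delta>(3) by linarith
  ultimately show ?thesis using A(1) by blast
qed

end

theorem proposition8:
  fixes M :: "'a measure"
    and gap :: "site \<Rightarrow> nat \<Rightarrow> 'a \<Rightarrow> real"
    and mark :: "site \<Rightarrow> nat \<Rightarrow> 'a \<Rightarrow> int"
    and \<gamma> C a' :: real
  assumes "dynamical_discrete_web M gap mark"
    and "\<gamma> > 1" and "C > 0" and "a' > 0"
    and "\<exists>c'>0. \<forall>k\<ge>1. \<forall>\<tau>\<ge>0. \<forall>\<tau>'\<ge>0. \<tau> \<noteq> \<tau>' \<longrightarrow>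
           measure M (hat_A M gap mark \<gamma> C k \<tau> \<inter> hat_A M gap mark \<gamma> C k \<tau>')
             \<le> (measure M (hat_A M gap mark \<gamma> C k 0))\<^sup>2
               + c' * (1 / (real_of_int (hat_d \<gamma> k) * \<bar>\<tau> - \<tau>'\<bar>)) powr a'"
    and "a' * (1 - \<gamma> powr (-3/2)) - 2 * C\<^sup>2 > 0"
  shows "AE \<omega> in M.
           hausdorff_dim {\<tau>::real. 0 \<le> \<tau> \<and>
             Limsup at_top (\<lambda>t::real. ereal (web_path gap mark (0, 0) \<tau> \<omega> t / sqrt (t * ln t)))
               \<ge> ereal C}
           \<ge> ereal (1 - 2 * \<gamma>\<^sup>2 * C\<^sup>2 / (\<gamma> - 1))"
proof -
  interpret dynamical_discrete_web M gap mark by fact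
  define \<eta> where "\<eta> = 1 - 2 * \<gamma>\<^sup>2 * C\<^sup>2 / (\<gamma> - 1)"
  obtain c' where c': "0 < c'" and corr: "\<And>k \<tau> \<tau>'. 1 \<le> k \<Longrightarrow> 0 \<le> \<tau> \<Longrightarrow> 0 \<le> \<tau>' \<Longrightarrow> \<tau> \<noteq> \<tau>' \<Longrightarrow>
       prob (hat_A M gap mark \<gamma> C k \<tau> \<inter> hat_A M gap mark \<gamma> C k \<tau>')
         \<le> (prob (hat_A M gap mark \<gamma> C k 0))\<^sup>2 + c' * (1 / (real_of_int (hat_d \<gamma> k) * \<bar>\<tau> - \<tau>'\<bar>)) powr a'"
    using assms(5) by blast
  have single: "AE \<omega> in M. nonnull_upto C s \<omega>"
    if s: "0 < s" "s < \<eta>" for s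
  proof -
    define good where "good = (\<lambda>A. AE \<omega> in M. \<omega> \<in> A \<longrightarrow>
      nonnull_upto C s \<omega>)"
    have "\<exists>A\<in>events. 1 - 1 / (real n + 1) \<le> prob A \<and> good A" for n :: nat
      unfolding good_def
      by (rule large_times_positive_measure_event[OF assms(2-4) c' corr assms(6)])
         (use s in \<open>auto simp: \<eta>_def\<close>)
    then have "\<forall>n. \<exists>A. A \<in> events \<and> 1 - 1 / (real n + 1) \<le> prob A \<and> good A" by blast
    then have "\<exists>A. \<forall>n. A n \<in> events \<and> 1 - 1 / (real n + 1) \<le> prob (A n) \<and> good (A n)" by (rule choice)
    then obtain A where A: "\<And>n::nat. A n \<in> events" "\<And>n. 1 - 1 / (real n + 1) \<le> prob (A n)"
      and AE_A: "\<And>n. good (A n)" by blast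
    have "AE \<omega> in M. \<forall>n. \<omega> \<in> A n \<longrightarrow> nonnull_upto C s \<omega>"
      unfolding AE_all_countable using AE_A unfolding good_def by (rule allI)
    then show ?thesis using AE_space_Un_events[OF A] by eventually_elim blast
  qed
  show ?thesis
    unfolding \<eta>_def[symmetric]
  proof (cases "0 < \<eta>")
    case True
    \<comment> \<open>The null set depends on the exponent, so countably many exponents increasing
      to \<eta> are used; the offset \<open>2\<close> keeps the factor positive at
      \<open>n = 0\<close>.\<close>
    have "AE \<omega> in M. \<forall>n::nat. nonnull_upto C (\<eta> * (1 - 1 / (real n + 2))) \<omega>"
      unfolding AE_all_countable
    proof
      fix n :: nat
      have "0 < 1 - 1 / (real n + 2)" "1 - 1 / (real n + 2) < 1" by (auto simp: field_simps)
      then have "0 < \<eta> * (1 - 1 / (real n + 2))" "\<eta> * (1 - 1 / (real n + 2)) < \<eta> * 1"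
        using True by (auto intro: mult_pos_pos mult_strict_left_mono)
      then show "AE \<omega> in M. nonnull_upto C (\<eta> * (1 - 1 / (real n + 2))) \<omega>"
        by (intro single) auto
    qed
    then show "AE \<omega> in M. ereal \<eta> \<le> hausdorff_dim (large_times C \<omega>)"
    proof eventually_elim
      case (elim \<omega>)
      show ?case
      proof (rule hausdorff_dim_ge)
        fix t assume t: "0 \<le> t" "t < \<eta>"
        have "(\<lambda>n. \<eta> * (1 - 1 / (real n + 2))) \<longlonglongrightarrow> \<eta>" by real_asymp
        then have "eventually (\<lambda>n. t < \<eta> * (1 - 1 / (real n + 2))) sequentially"
          using t by (intro order_tendstoD(1)) auto
        then obtain n where "t < \<eta> * (1 - 1 / (real n + 2))"
          using eventually_happens trivial_limit_sequentially by blast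
        then show "hausdorff_measure t (large_times C \<omega>) \<noteq> 0" using elim t by (intro elim[rule_format, of t n]) auto
      qed
    qed
  next
    case False
    \<comment> \<open>No \<open>t\<close> satisfies \<open>0 <= t < \<eta>\<close>, so the criterion
      holds vacuously.\<close>
    show "AE \<omega> in M. ereal \<eta> \<le> hausdorff_dim (large_times C \<omega>)"
      by (intro AE_I2 hausdorff_dim_ge) (use False in auto)
  qed
qed

end
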